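(* Let $K$ be a discrete valuation field with valuation ring $\mathcal{O}_K$, normalised valuation $v$ and uniformiser $\pi$. Let $\Phi,\Phi'\in X_5(\mathcal{O}_K)$ with $v(\Delta(\Phi))\le1$ and $v(\Delta(\Phi'))\le1$. If $$\Phi'=[\mathrm{Diag}(\pi^{-r_1},\dots,\pi^{-r_5}),\,\mathrm{Diag}(\pi^{s_1},\dots,\pi^{s_5})]\,\Phi$$ for some integers $r_1,\dots,r_5,s_1,\dots,s_5$, then $s_1=s_2=\dots=s_5$.
   Context: A Pfaffian model over a ring $R$ is a $5\times5$ alternating matrix $\Phi$ of linear forms in $R[x_1,\dots,x_5]$; $X_5(R)$ is the set of these. For invertible $5\times5$ matrices $A,B$ over $K$, $[A,B]\Phi$ is obtained by replacing $\Phi$ by $A\Phi A^T$ and substituting $x_j'=\sum_iB_{ij}x_i$ for $x_j$ in each entry. $\Delta\in\mathbb{Z}[X_5]$ is the standard discriminant invariant of Pfaffian models (Fisher's normalisation): an integer polynomial of degree $60$ in the coefficients with $\Delta([A,B]\Phi)=((\det A)^2\det B)^{12}\Delta(\Phi)$, nonzero exactly when the subscheme of $\mathbb{P}^4$ defined by the $4\times4$ Pfaffians of $\Phi$ is a smooth genus one curve, in which case it equals the discriminant of a Weierstrass equation for the Jacobian of that curve. Here $v(0)=+\infty$. *)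

theory Defs
  imports
    "HOL-Analysis.Analysis"
    "HOL-Library.Poly_Mapping"
    "HOL-Algebra.Algebraic_Closure_Type"
begin

section \<open>Discrete valuation fields\<close>

definition normalised_discrete_valuation :: "('k::field \<Rightarrow> ereal) \<Rightarrow> bool" where
  "normalised_discrete_valuation v \<longleftrightarrow>
     v 0 = \<infinity> \<and>
     (\<forall>x. x \<noteq> 0 \<longrightarrow> (\<exists>n::int. v x = ereal (real_of_int n))) \<and>
     (\<forall>x y. v (x * y) = v x + v y) \<and>
     (\<forall>x y. v (x + y) \<ge> min (v x) (v y)) \<and>
     (\<exists>x. v x = 1)"

definition valuation_ring :: "('k::field \<Rightarrow> ereal) \<Rightarrow> 'k set" where
  "valuation_ring v = {x. v x \<ge> 0}"

definition uniformiser :: "('k::field \<Rightarrow> ereal) \<Rightarrow> 'k \<Rightarrow> bool" where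
  "uniformiser v p \<longleftrightarrow> v p = 1"


section \<open>Multivariate polynomials\<close>

type_synonym ('v, 'c) mpoly = "('v \<Rightarrow>\<^sub>0 nat) \<Rightarrow>\<^sub>0 'c"

text \<open>The value at the point \<open>a\<close>, with coefficients mapped by \<open>h\<close>.\<close>

definition mpoly_eval :: "('c::zero \<Rightarrow> 'b::comm_semiring_1) \<Rightarrow> ('v \<Rightarrow> 'b) \<Rightarrow> ('v, 'c) mpoly \<Rightarrow> 'b" where
  "mpoly_eval h a p =
     (\<Sum>m\<in>Poly_Mapping.keys p. h (Poly_Mapping.lookup p m) * (\<Prod>x\<in>Poly_Mapping.keys m. a x ^ Poly_Mapping.lookup m x))"

definition homogeneous :: "nat \<Rightarrow> ('v, 'c::zero) mpoly \<Rightarrow> bool" where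
  "homogeneous d p \<longleftrightarrow> (\<forall>m\<in>Poly_Mapping.keys p. (\<Sum>x\<in>Poly_Mapping.keys m. Poly_Mapping.lookup m x) = d)"

definition mpoly_partial :: "'v \<Rightarrow> ('v, 'c::comm_semiring_1) mpoly \<Rightarrow> ('v, 'c) mpoly" where
  "mpoly_partial x p =
     (\<Sum>m\<in>Poly_Mapping.keys p. Poly_Mapping.single (m - Poly_Mapping.single x 1)
                      (of_nat (Poly_Mapping.lookup m x) * Poly_Mapping.lookup p m))"

definition mpoly_scale :: "'c::comm_semiring_1 \<Rightarrow> ('v, 'c) mpoly \<Rightarrow> ('v, 'c) mpoly" where
  "mpoly_scale c p = Poly_Mapping.single 0 c * p"

lemma vector_space_mpoly_scale:
  "vector_space (mpoly_scale :: 'c::field \<Rightarrow> ('v, 'c) mpoly \<Rightarrow> ('v, 'c) mpoly)"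
  by unfold_locales
     (simp_all add: mpoly_scale_def distrib_left distrib_right single_add
        mult.assoc [symmetric] mult_single)


section \<open>Smooth curves in projective space\<close>

text \<open>
  A family \<open>p\<close> of homogeneous polynomials over a field \<open>k\<close> stands for the closed subscheme of
  projective space it defines. Points of a projective space over the algebraic closure of \<open>k\<close> are
  represented by non-zero vectors, to be compared by \<open>proj_eq\<close>.
\<close>

definition proj_eq :: "'k::field^'n \<Rightarrow> 'k^'n \<Rightarrow> bool" where
  "proj_eq x y \<longleftrightarrow> (\<exists>c. c \<noteq> 0 \<and> x = c *s y)"

definition geom_points :: "('i \<Rightarrow> ('n, 'k::field) mpoly) \<Rightarrow> ('k alg_closure^'n) set" where
  "geom_points p = {x. x \<noteq> 0 \<and> (\<forall>i. mpoly_eval to_ac (($) x) (p i) = 0)}"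

definition geom_irreducible :: "('i \<Rightarrow> ('n::finite, 'k::field) mpoly) \<Rightarrow> bool" where
  "geom_irreducible p \<longleftrightarrow>
     geom_points p \<noteq> {} \<and>
     (\<forall>(f :: ('n, 'k alg_closure) mpoly) (g :: ('n, 'k alg_closure) mpoly) d e.
        homogeneous d f \<longrightarrow> homogeneous e g \<longrightarrow>
        (\<forall>x\<in>geom_points p. mpoly_eval id (($) x) f = 0 \<or> mpoly_eval id (($) x) g = 0) \<longrightarrow>
        (\<forall>x\<in>geom_points p. mpoly_eval id (($) x) f = 0) \<or>
        (\<forall>x\<in>geom_points p. mpoly_eval id (($) x) g = 0))"

definition jacobian_at ::
    "('i::finite \<Rightarrow> ('n::finite, 'k::field) mpoly) \<Rightarrow> 'k alg_closure^'n \<Rightarrow> 'k alg_closure^'n^'i" where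
  "jacobian_at p x = (\<chi> i j. mpoly_eval to_ac (($) x) (mpoly_partial j (p i)))"

definition ideal_gen :: "('i::finite \<Rightarrow> ('n, 'k::field) mpoly) \<Rightarrow> ('n, 'k) mpoly set" where
  "ideal_gen p = range (\<lambda>q. \<Sum>i\<in>UNIV. q i * p i)"

definition hilbert_function :: "('n, 'k::field) mpoly set \<Rightarrow> nat \<Rightarrow> int" where
  "hilbert_function I d =
     int (vector_space.dim mpoly_scale {f :: ('n, 'k) mpoly. homogeneous d f})
     - int (vector_space.dim mpoly_scale {f \<in> I. homogeneous d f})"

text \<open>
  Dimension one and (arithmetic) genus \<open>g\<close> are read off from the Hilbert polynomial
  \<open>e d + 1 - g\<close>; smoothness is the Jacobian criterion, the ambient space having dimension
  \<open>CARD('n) - 1\<close>.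
\<close>

definition smooth_curve_of_genus :: "nat \<Rightarrow> ('i::finite \<Rightarrow> ('n::finite, 'k::field) mpoly) \<Rightarrow> bool" where
  "smooth_curve_of_genus g p \<longleftrightarrow>
     geom_irreducible p \<and>
     (\<exists>e>0. \<forall>\<^sub>F d in sequentially.
        hilbert_function (ideal_gen p) d = e * int d + 1 - int g) \<and>
     (\<forall>x\<in>geom_points p. rank (jacobian_at p x) = (CARD('n) - 1) - 1)"

text \<open>
  Morphisms over \<open>k\<close> from a product of two projective varieties, given on geometric points:
  locally they are represented by polynomials with coefficients in \<open>k\<close>. Bihomogeneity of the
  representing polynomials need not be demanded, since \<open>f\<close> is compatible with \<open>proj_eq\<close> and so the
  bihomogeneous components represent \<open>f\<close> as well.
\<close>

definition morphism2 ::
    "('k::field alg_closure^'m) set \<Rightarrow> ('k alg_closure^'n) set \<Rightarrow> ('k alg_closure^'l) set \<Rightarrow>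
     ('k alg_closure^'m \<Rightarrow> 'k alg_closure^'n \<Rightarrow> 'k alg_closure^'l) \<Rightarrow> bool" where
  "morphism2 U V W f \<longleftrightarrow>
     (\<forall>x\<in>U. \<forall>y\<in>V. f x y \<in> W) \<and>
     (\<forall>x\<in>U. \<forall>x'\<in>U. \<forall>y\<in>V. \<forall>y'\<in>V.
        proj_eq x x' \<longrightarrow> proj_eq y y' \<longrightarrow> proj_eq (f x y) (f x' y')) \<and>
     (\<forall>x\<in>U. \<forall>y\<in>V. \<exists>q :: ('m + 'n, 'k) mpoly^'l.
        let val = (\<lambda>x y. \<chi> i. mpoly_eval to_ac (case_sum (($) x) (($) y)) (q $ i))
        in val x y \<noteq> 0 \<and>
           (\<forall>x'\<in>U. \<forall>y'\<in>V. val x' y' \<noteq> 0 \<longrightarrow> proj_eq (val x' y') (f x' y')))"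


section \<open>Weierstrass equations and Jacobians\<close>

definition weierstrass_disc :: "'k::field \<Rightarrow> 'k \<Rightarrow> 'k \<Rightarrow> 'k \<Rightarrow> 'k \<Rightarrow> 'k" where
  "weierstrass_disc a1 a2 a3 a4 a6 =
     (let b2 = a1\<^sup>2 + 4 * a2;
          b4 = 2 * a4 + a1 * a3;
          b6 = a3\<^sup>2 + 4 * a6;
          b8 = a1\<^sup>2 * a6 + 4 * a2 * a6 - a1 * a3 * a4 + a2 * a3\<^sup>2 - a4\<^sup>2
      in - (b2\<^sup>2 * b8) - 8 * b4 ^ 3 - 27 * b6\<^sup>2 + 9 * b2 * b4 * b6)"

definition weierstrass_points ::
    "'k::field \<Rightarrow> 'k \<Rightarrow> 'k \<Rightarrow> 'k \<Rightarrow> 'k \<Rightarrow> ('k alg_closure^3) set" where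
  "weierstrass_points a1 a2 a3 a4 a6 =
     {P. P \<noteq> 0 \<and>
         (let x = P $ 1; y = P $ 2; z = P $ 3
          in y\<^sup>2 * z + to_ac a1 * x * y * z + to_ac a3 * y * z\<^sup>2
             = x ^ 3 + to_ac a2 * x\<^sup>2 * z + to_ac a4 * x * z\<^sup>2 + to_ac a6 * z ^ 3)}"

definition weierstrass_origin :: "'k::field^3" where
  "weierstrass_origin = vector [0, 1, 0]"

text \<open>
  The group law of an elliptic curve is the only morphism that makes it a group with the given
  origin as the neutral element.
\<close>

definition elliptic_group_law ::
    "('k::field alg_closure^3) set \<Rightarrow>
     ('k alg_closure^3 \<Rightarrow> 'k alg_closure^3 \<Rightarrow> 'k alg_closure^3) \<Rightarrow> bool" where
  "elliptic_group_law E madd \<longleftrightarrow>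
     morphism2 E E E madd \<and>
     (\<forall>P\<in>E. \<forall>Q\<in>E. \<forall>R\<in>E. proj_eq (madd (madd P Q) R) (madd P (madd Q R))) \<and>
     (\<forall>P\<in>E. proj_eq (madd P weierstrass_origin) P \<and> proj_eq (madd weierstrass_origin P) P) \<and>
     (\<forall>P\<in>E. \<exists>Q\<in>E. proj_eq (madd P Q) weierstrass_origin \<and> proj_eq (madd Q P) weierstrass_origin)"

text \<open>
  The Jacobian of a smooth curve \<open>C\<close> of genus one over \<open>k\<close> is the elliptic curve over \<open>k\<close> under
  which \<open>C\<close> is a principal homogeneous space. The subtraction map is required to be a morphism,
  which in positive characteristic excludes purely inseparable twists of the action.
\<close>

definition weierstrass_eqn_for_jacobian ::
    "('k::field alg_closure^'n) set \<Rightarrow> 'k \<Rightarrow> 'k \<Rightarrow> 'k \<Rightarrow> 'k \<Rightarrow> 'k \<Rightarrow> bool" where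
  "weierstrass_eqn_for_jacobian C a1 a2 a3 a4 a6 \<longleftrightarrow>
     weierstrass_disc a1 a2 a3 a4 a6 \<noteq> 0 \<and>
     (let E = weierstrass_points a1 a2 a3 a4 a6
      in \<exists>madd mact msub.
           elliptic_group_law E madd \<and>
           morphism2 C E C mact \<and>
           morphism2 C C E msub \<and>
           (\<forall>x\<in>C. proj_eq (mact x weierstrass_origin) x) \<and>
           (\<forall>x\<in>C. \<forall>P\<in>E. \<forall>Q\<in>E. proj_eq (mact (mact x P) Q) (mact x (madd P Q))) \<and>
           (\<forall>x\<in>C. \<forall>y\<in>C. proj_eq (mact x (msub y x)) y) \<and>
           (\<forall>x\<in>C. \<forall>P\<in>E. proj_eq (msub (mact x P) x) P))"


section \<open>Pfaffian models\<close>

text \<open>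
  A matrix of linear forms is given by its coefficients: \<open>\<Phi> $ i $ j $ k\<close> is the coefficient of
  \<open>x\<^sub>k\<close> in the entry \<open>(i, j)\<close>. The five indices are the elements of the type \<open>5\<close>, where \<open>5 = 0\<close>.
\<close>

type_synonym 'k matrix_of_forms = "'k^5^5^5"

definition X5 :: "'k::comm_ring_1 set \<Rightarrow> 'k matrix_of_forms set" where
  "X5 R = {\<Phi>. (\<forall>i. \<Phi> $ i $ i = 0) \<and> (\<forall>i j. \<Phi> $ j $ i = - (\<Phi> $ i $ j)) \<and>
               (\<forall>i j k. \<Phi> $ i $ j $ k \<in> R)}"

text \<open>
  Substituting \<open>\<Sum>\<^sub>i B\<^sub>i\<^sub>j x\<^sub>i\<close> for \<open>x\<^sub>j\<close> in the linear form with coefficient vector \<open>c\<close> gives the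
  linear form with coefficient vector \<open>B *v c\<close>.
\<close>

definition act5 :: "'k::comm_ring_1^5^5 \<Rightarrow> 'k^5^5 \<Rightarrow> 'k matrix_of_forms \<Rightarrow> 'k matrix_of_forms" where
  "act5 A B \<Phi> =
     (\<chi> i j. B *v (\<Sum>a\<in>UNIV. \<Sum>b\<in>UNIV. (A $ i $ a * A $ j $ b) *s (\<Phi> $ a $ b)))"

definition Diag :: "('n \<Rightarrow> 'k::zero) \<Rightarrow> 'k^'n^'n" where
  "Diag d = (\<chi> i j. if i = j then d i else 0)"

definition entry_form :: "'k::comm_ring_1 matrix_of_forms \<Rightarrow> 5 \<Rightarrow> 5 \<Rightarrow> (5, 'k) mpoly" where
  "entry_form \<Phi> i j =
     (\<Sum>k\<in>UNIV. Poly_Mapping.single (Poly_Mapping.single k 1) (\<Phi> $ i $ j $ k))"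

text \<open>
  The Pfaffian of the submatrix without row and column \<open>i\<close>. Its rows and columns are taken in the
  cyclic order \<open>i + 1, \<dots>, i + 4\<close>, which affects at most the sign.
\<close>

definition pfaffian :: "'k::comm_ring_1 matrix_of_forms \<Rightarrow> 5 \<Rightarrow> (5, 'k) mpoly" where
  "pfaffian \<Phi> i =
     entry_form \<Phi> (i + 1) (i + 2) * entry_form \<Phi> (i + 3) (i + 4)
     - entry_form \<Phi> (i + 1) (i + 3) * entry_form \<Phi> (i + 2) (i + 4)
     + entry_form \<Phi> (i + 1) (i + 4) * entry_form \<Phi> (i + 2) (i + 3)"

text \<open>
  An integer polynomial in the 50 coordinates \<open>\<Phi> $ i $ j $ k\<close>, \<open>i < j\<close>, on the space of Pfaffian
  models.
\<close>

type_synonym invariant5 = "(5 \<times> 5 \<times> 5, int) mpoly"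

definition in_coordinate_ring_X5 :: "invariant5 \<Rightarrow> bool" where
  "in_coordinate_ring_X5 D \<longleftrightarrow> (\<forall>m\<in>Poly_Mapping.keys D. Poly_Mapping.keys m \<subseteq> {(i, j, k). i < j})"

definition eval5 :: "invariant5 \<Rightarrow> 'k::comm_ring_1 matrix_of_forms \<Rightarrow> 'k" where
  "eval5 D \<Phi> = mpoly_eval of_int (\<lambda>(i, j, k). \<Phi> $ i $ j $ k) D"

text \<open>
  \<open>D\<close> is the discriminant of Pfaffian models, as it is seen over the infinite field \<open>k\<close>. In
  characteristic zero the condition on the content leaves only the two signs of the discriminant
  (without it, multiples by twelfth powers of integers would satisfy the remaining conditions); it
  holds since the discriminant does not vanish identically modulo any prime. In characteristic \<open>p\<close>
  the conditions determine \<open>D\<close> modulo \<open>p\<close> up to a non-zero constant of the prime field.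
\<close>

definition pfaffian_discriminant :: "'k::field itself \<Rightarrow> invariant5 \<Rightarrow> bool" where
  "pfaffian_discriminant TYPE('k) D \<longleftrightarrow>
     in_coordinate_ring_X5 D \<and>
     homogeneous 60 D \<and>
     Gcd (Poly_Mapping.lookup D ` UNIV) = 1 \<and>
     (\<forall>(A::'k^5^5) (B::'k^5^5). \<forall>\<Phi>\<in>X5 UNIV. invertible A \<longrightarrow> invertible B \<longrightarrow>
        eval5 D (act5 A B \<Phi>) = ((det A)\<^sup>2 * det B) ^ 12 * eval5 D \<Phi>) \<and>
     (\<forall>\<Phi>\<in>X5 (UNIV::'k set).
        eval5 D \<Phi> \<noteq> 0 \<longleftrightarrow> smooth_curve_of_genus 1 (pfaffian \<Phi>)) \<and>
     (\<forall>\<Phi>\<in>X5 (UNIV::'k set). smooth_curve_of_genus 1 (pfaffian \<Phi>) \<longrightarrow>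
        (\<exists>a1 a2 a3 a4 a6.
           weierstrass_eqn_for_jacobian (geom_points (pfaffian \<Phi>)) a1 a2 a3 a4 a6 \<and>
           eval5 D \<Phi> = weierstrass_disc a1 a2 a3 a4 a6))"

end

theory Submission
  imports Defs
begin

text \<open>
  If the curve of a model \<open>\<Phi>\<close> is singular at \<open>p\<close>, then \<open>\<Delta>\<close> vanishes at \<open>\<Phi>\<close>, and the infinitesimal
  invariance of \<open>\<Delta>\<close> shows that its derivative at \<open>\<Phi>\<close> is a multiple of \<open>\<Psi> \<mapsto> \<Psi>(u, w; p)\<close>, where the
  bivector \<open>u \<and> w\<close> encodes the linear dependence of the equations of the tangent space at \<open>p\<close>. Two
  different singular points therefore make \<open>\<Delta>\<close> vanish to order two. This is the case as soon as a
  line or a conic splits off the curve.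

  After sorting the weights, each of a list of inequalities \<open>r\<^sub>i + r\<^sub>j \<le> s\<^sub>k\<close> holds, because otherwise
  a line or a conic splits off the reduction of \<open>\<Phi>\<close> and \<open>\<pi>\<^sup>2\<close> divides \<open>\<Delta>(\<Phi>)\<close>. The same argument for
  \<open>\<Phi>'\<close> gives the opposite inequalities, and together they force the \<open>r\<^sub>i\<close> to be an arithmetic
  progression. If its difference were positive, the reduction of \<open>\<Phi>\<close> would have a singular point at
  which \<open>\<Phi>\<close> vanishes to such a high order that \<open>\<pi>\<^sup>2\<close> divides \<open>\<Delta>(\<Phi>)\<close> once more.
\<close>

text \<open>The discriminant is known only over K; nothing is assumed about it over the residue
  field, which may be finite. Reduction modulo \<pi> is therefore replaced by truncation:
  coefficients divisible by \<pi> are set to zero inside K, and \<Delta> is expanded as a polynomial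
  along the line from the truncated model to \<Phi>. Its constant term vanishes, its linear
  coefficient is zero or divisible by \<pi>, and integrality of the remaining coefficients yields
  the factor \<pi>^2. The second obstacle is that singular points have to be rational over K, which
  is not algebraically closed. On a line or conic that splits off they correspond to the roots of a
  binary quadratic form; perturbing one entry makes these roots rational for infinitely many values
  of a parameter, and vanishing to order two is a closed condition on a line of models. Derivatives
  are formal and the linear system for them has pivots 1 and -1, so the characteristic of K is
  arbitrary, 2 included.\<close>

no_notation fps_nth (infixl \<open>$\<close> 75)

section \<open>Evaluation and derivatives of polynomials\<close>

lemma UNIV_5: "(UNIV :: 5 set) = {0, 1, 2, 3, 4}"
proof -
  have "{0, 1, 2, 3, 4} \<subseteq> (UNIV :: 5 set)"
    by simp
  moreover have "card {0, 1, 2, 3, 4 :: 5} = card (UNIV :: 5 set)"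
    by simp
  ultimately show ?thesis
    by (metis card_subset_eq finite)
qed

lemma all_5: "(\<forall>i :: 5. P i) \<longleftrightarrow> P 0 \<and> P 1 \<and> P 2 \<and> P 3 \<and> P 4"
proof -
  have "(\<forall>i :: 5. P i) \<longleftrightarrow> (\<forall>i \<in> {0, 1, 2, 3, 4 :: 5}. P i)"
    by (metis UNIV_5 UNIV_I)
  then show ?thesis
    by simp
qed

lemma sum_5: "(\<Sum>i\<in>(UNIV :: 5 set). f i) = f 0 + f 1 + f 2 + f 3 + f 4"
  unfolding UNIV_5 by (simp add: add.assoc)

lemma order_5:
  "(0::5) < 1" "(0::5) < 2" "(0::5) < 3" "(0::5) < 4" "(1::5) < 2" "(1::5) < 3" "(1::5) < 4"
  "(2::5) < 3" "(2::5) < 4" "(3::5) < 4"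
  by (simp_all add: less_bit1_def bit1.Rep_numeral bit1.Rep_0 bit1.Rep_1)

lemma mpoly_eval_superset:
  assumes "finite S" "Poly_Mapping.keys p \<subseteq> S" "h 0 = 0"
  shows "mpoly_eval h a p =
    (\<Sum>m\<in>S. h (Poly_Mapping.lookup p m) * (\<Prod>x\<in>Poly_Mapping.keys m. a x ^ Poly_Mapping.lookup m x))"
  unfolding mpoly_eval_def
  by (rule sum.mono_neutral_left) (use assms in \<open>auto simp: in_keys_iff\<close>)

lemma mpoly_eval_add:
  assumes "h 0 = 0" "\<And>x y. h (x + y) = h x + h y"
  shows "mpoly_eval h a (p + q) = mpoly_eval h a p + mpoly_eval h a q"
proof -
  let ?S = "Poly_Mapping.keys p \<union> Poly_Mapping.keys q"
  have "Poly_Mapping.keys (p + q) \<subseteq> ?S"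
    by (rule Poly_Mapping.keys_add)
  then show ?thesis
    by (simp add: mpoly_eval_superset [where S = ?S and h = h] lookup_add assms
        distrib_right sum.distrib)
qed

lemma mpoly_eval_sum:
  assumes "h 0 = 0" "\<And>x y. h (x + y) = h x + h y"
  shows "mpoly_eval h a (\<Sum>i\<in>I. f i) = (\<Sum>i\<in>I. mpoly_eval h a (f i))"
proof (induction I rule: infinite_finite_induct)
  case (insert x F)
  then show ?case
    by (simp add: mpoly_eval_add [OF assms])
qed (simp_all add: mpoly_eval_def)

lemma mpoly_eval_single:
  assumes "h 0 = 0"
  shows "mpoly_eval h a (Poly_Mapping.single m c) =
    h c * (\<Prod>x\<in>Poly_Mapping.keys m. a x ^ Poly_Mapping.lookup m x)"
  using assms by (simp add: mpoly_eval_def)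

lemma prod_keys_UNIV:
  fixes a :: "'v::finite \<Rightarrow> 'b::comm_semiring_1"
  shows "(\<Prod>x\<in>Poly_Mapping.keys m. a x ^ Poly_Mapping.lookup m x) = (\<Prod>x\<in>UNIV. a x ^ Poly_Mapping.lookup m x)"
  by (rule prod.mono_neutral_left) (auto simp: in_keys_iff)

lemma mpoly_partial_superset:
  assumes "finite S" "Poly_Mapping.keys p \<subseteq> S"
  shows "mpoly_partial x p = (\<Sum>m\<in>S. Poly_Mapping.single (m - Poly_Mapping.single x 1)
                      (of_nat (Poly_Mapping.lookup m x) * Poly_Mapping.lookup p m))"
  unfolding mpoly_partial_def
  by (rule sum.mono_neutral_left) (use assms in \<open>auto simp: in_keys_iff\<close>)

lemma mpoly_partial_add: "mpoly_partial x (p + q) = mpoly_partial x p + mpoly_partial x q"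
proof -
  let ?S = "Poly_Mapping.keys p \<union> Poly_Mapping.keys q"
  have "Poly_Mapping.keys (p + q) \<subseteq> ?S"
    by (rule Poly_Mapping.keys_add)
  then show ?thesis
    by (simp add: mpoly_partial_superset [of ?S] lookup_add distrib_left single_add sum.distrib)
qed

lemma mpoly_partial_sum: "mpoly_partial x (\<Sum>i\<in>I. f i) = (\<Sum>i\<in>I. mpoly_partial x (f i))"
proof (induction I rule: infinite_finite_induct)
  case (insert x F)
  then show ?case
    by (simp add: mpoly_partial_add)
qed (simp_all add: mpoly_partial_def)

lemma mpoly_partial_single:
  "mpoly_partial x (Poly_Mapping.single m c) =
    Poly_Mapping.single (m - Poly_Mapping.single x 1) (of_nat (Poly_Mapping.lookup m x) * c)"
  by (simp add: mpoly_partial_def)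

text \<open>Integer coefficients are fixed by every unital ring homomorphism. The instance needed is
  evaluation of one-variable polynomials at a point, which relates a model over
  \<open>'k poly\<close> to the models on a line.\<close>

lemma eval5_hom:
  fixes f :: "'a::comm_ring_1 \<Rightarrow> 'b::comm_ring_1"
  assumes "f 0 = 0" "f 1 = 1" "\<And>x y. f (x + y) = f x + f y" "\<And>x y. f (x * y) = f x * f y"
  shows "f (eval5 D F) = eval5 D (\<chi> i j k. f (F $ i $ j $ k))"
proof -
  have minus: "f (- x) = - f x" for x
    using assms(3) [of x "- x"] by (simp add: assms(1) eq_neg_iff_add_eq_0 add.commute)
  have nat: "f (of_nat n) = of_nat n" for n
    by (induction n) (simp_all add: assms)
  have int: "f (of_int n) = of_int n" for n
    by (cases n rule: int_cases2) (simp_all add: nat minus)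
  have sum: "f (\<Sum>x\<in>A. g x) = (\<Sum>x\<in>A. f (g x))" for A and g :: "'c \<Rightarrow> 'a"
    by (induction A rule: infinite_finite_induct) (simp_all add: assms)
  have prod: "f (\<Prod>x\<in>A. g x) = (\<Prod>x\<in>A. f (g x))" for A and g :: "'d \<Rightarrow> 'a"
    by (induction A rule: infinite_finite_induct) (simp_all add: assms)
  have pow: "f (x ^ n) = f x ^ n" for x n
    by (induction n) (simp_all add: assms)
  show ?thesis
    by (simp add: eval5_def mpoly_eval_def sum prod pow int assms(4) case_prod_beta)
qed

lemma eval5_poly: "poly (eval5 D F) u = eval5 D (\<chi> i j k. poly (F $ i $ j $ k) u)"
  by (rule eval5_hom) simp_all

text \<open>The derivative of \<open>D\<close> at \<open>\<Phi>\<close> in the direction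
  \<open>\<Psi>\<close>. It is formal, hence integral at integral arguments and meaningful in every
  characteristic. Summing over all triples is harmless: for \<open>D\<close> in the coordinate ring
  the partial derivatives outside \<open>i < j\<close> are zero.\<close>

definition dir5 :: "invariant5 \<Rightarrow> 'k::comm_ring_1 matrix_of_forms \<Rightarrow> 'k matrix_of_forms \<Rightarrow> 'k" where
  "dir5 D \<Phi> \<Psi> = (\<Sum>i\<in>UNIV. \<Sum>j\<in>UNIV. \<Sum>k\<in>UNIV. eval5 (mpoly_partial (i, j, k) D) \<Phi> * \<Psi> $ i $ j $ k)"

lemma pderiv_sum: "pderiv (\<Sum>x\<in>A. f x) = (\<Sum>x\<in>A. pderiv (f x))"
  by (induction A rule: infinite_finite_induct) (simp_all add: pderiv_add)

lemma pderiv_of_int_mult: "pderiv (of_int c * p) = of_int c * pderiv p"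
  by (simp add: of_int_poly pderiv_smult)

text \<open>The exponent is lowered by truncated subtraction; where \<open>m x = 0\<close> this
  gives the wrong monomial, but the factor \<open>of_nat (m x)\<close> is then zero.\<close>

lemma pderiv_monomial:
  fixes a :: "'v::finite \<Rightarrow> 'k::field poly"
  shows "pderiv (\<Prod>x\<in>UNIV. a x ^ m x) =
    (\<Sum>x\<in>UNIV. of_nat (m x) * (\<Prod>y\<in>UNIV. a y ^ (m y - (if y = x then 1 else 0))) * pderiv (a x))"
proof -
  have "(\<Prod>y\<in>UNIV. a y ^ (m y - (if y = x then 1 else 0))) =
      a x ^ (m x - 1) * (\<Prod>y\<in>UNIV - {x}. a y ^ m y)" for x
    by (subst prod.remove [of UNIV x]) (auto intro!: prod.cong)
  then show ?thesis
    by (simp add: pderiv_prod pderiv_power of_nat_poly mult_ac)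
qed

lemma pderiv_eval5:
  fixes F :: "'k::field poly matrix_of_forms"
  shows "pderiv (eval5 D F) = (\<Sum>i\<in>UNIV. \<Sum>j\<in>UNIV. \<Sum>k\<in>UNIV.
    eval5 (mpoly_partial (i, j, k) D) F * pderiv (F $ i $ j $ k))"
proof -
  define a where "a = (\<lambda>(i, j, k). F $ i $ j $ k)"
  have ev: "eval5 E F = (\<Sum>m\<in>Poly_Mapping.keys E. of_int (Poly_Mapping.lookup E m) *
      (\<Prod>x\<in>UNIV. a x ^ Poly_Mapping.lookup m x))" for E
    by (simp add: eval5_def mpoly_eval_def prod_keys_UNIV a_def)
  have part: "eval5 (mpoly_partial x D) F = (\<Sum>m\<in>Poly_Mapping.keys D. of_int (Poly_Mapping.lookup D m) *
      (of_nat (Poly_Mapping.lookup m x) *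
       (\<Prod>y\<in>UNIV. a y ^ (Poly_Mapping.lookup m y - (if y = x then 1 else 0)))))" for x
  proof -
    have "eval5 (mpoly_partial x D) F = (\<Sum>m\<in>Poly_Mapping.keys D.
        of_int (of_nat (Poly_Mapping.lookup m x) * Poly_Mapping.lookup D m) *
        (\<Prod>y\<in>UNIV. a y ^ Poly_Mapping.lookup (m - Poly_Mapping.single x 1) y))"
      unfolding eval5_def a_def [symmetric] mpoly_partial_def
      by (subst mpoly_eval_sum) (simp_all only: mpoly_eval_single prod_keys_UNIV of_int_0 of_int_add)
    also have "\<dots> = (\<Sum>m\<in>Poly_Mapping.keys D. of_int (Poly_Mapping.lookup D m) *
      (of_nat (Poly_Mapping.lookup m x) *
       (\<Prod>y\<in>UNIV. a y ^ (Poly_Mapping.lookup m y - (if y = x then 1 else 0)))))"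
      by (simp add: lookup_minus lookup_single when_def mult_ac eq_commute [of x] cong: if_cong)
    finally show ?thesis .
  qed
  have "pderiv (eval5 D F) = (\<Sum>m\<in>Poly_Mapping.keys D. \<Sum>x\<in>UNIV.
      of_int (Poly_Mapping.lookup D m) * (of_nat (Poly_Mapping.lookup m x) *
       (\<Prod>y\<in>UNIV. a y ^ (Poly_Mapping.lookup m y - (if y = x then 1 else 0)))) * pderiv (a x))"
    unfolding ev [of D]
    by (simp add: pderiv_sum pderiv_of_int_mult pderiv_monomial sum_distrib_left mult.assoc)
  also have "\<dots> = (\<Sum>x\<in>UNIV. eval5 (mpoly_partial x D) F * pderiv (a x))"
    unfolding part sum_distrib_right by (rule sum.swap)
  also have "\<dots> = (\<Sum>i\<in>UNIV. \<Sum>j\<in>UNIV. \<Sum>k\<in>UNIV.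
      eval5 (mpoly_partial (i, j, k) D) F * pderiv (F $ i $ j $ k))"
    by (simp add: sum.cartesian_product a_def case_prod_beta)
  finally show ?thesis .
qed

text \<open>A line of models packed into a single model over the polynomial ring, so that
  \<open>D\<close> along the line becomes a polynomial with accessible coefficients.\<close>

definition line5 :: "'k::comm_ring_1 matrix_of_forms \<Rightarrow> 'k matrix_of_forms \<Rightarrow> 'k poly matrix_of_forms" where
  "line5 \<Phi> \<Psi> = (\<chi> i j k. [:\<Phi> $ i $ j $ k, \<Psi> $ i $ j $ k:])"

definition scale5 :: "'k::comm_ring_1 \<Rightarrow> 'k matrix_of_forms \<Rightarrow> 'k matrix_of_forms" where
  "scale5 c \<Phi> = (\<chi> i j k. c * \<Phi> $ i $ j $ k)"

lemma scale5_nth [simp]: "scale5 c \<Phi> $ i $ j $ k = c * \<Phi> $ i $ j $ k"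
  by (simp add: scale5_def)

lemma eval5_line5: "poly (eval5 D (line5 \<Phi> \<Psi>)) u = eval5 D (\<Phi> + scale5 u \<Psi>)"
  unfolding eval5_poly by (rule arg_cong [where f = "eval5 D"]) (simp add: line5_def vec_eq_iff)

lemma scale5_0 [simp]: "scale5 0 \<Phi> = 0"
  by (simp add: vec_eq_iff)

text \<open>Ties the formal derivative to the linear Taylor coefficient, so that a polynomial
  identity along a line can be read as a statement about \<open>dir5\<close>.\<close>

lemma coeff_1_eval5_line5:
  fixes \<Phi> \<Psi> :: "'k::field matrix_of_forms"
  shows "poly.coeff (eval5 D (line5 \<Phi> \<Psi>)) 1 = dir5 D \<Phi> \<Psi>"
proof -
  have "poly.coeff (eval5 D (line5 \<Phi> \<Psi>)) 1 = poly (pderiv (eval5 D (line5 \<Phi> \<Psi>))) 0"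
    by (simp add: poly_0_coeff_0 coeff_pderiv)
  also have "\<dots> = dir5 D \<Phi> \<Psi>"
    by (simp add: pderiv_eval5 poly_sum eval5_line5 dir5_def) (simp add: line5_def pderiv_pCons)
  finally show ?thesis .
qed

section \<open>Pfaffian models as trilinear forms\<close>

text \<open>For a Pfaffian model this is alternating in the row vectors \<open>u\<close>,
  \<open>w\<close> and linear in the point \<open>p\<close>. In these terms \<open>act5\<close> is a
  change of basis in each argument.\<close>

definition tri :: "'k::comm_ring_1 matrix_of_forms \<Rightarrow> 'k^5 \<Rightarrow> 'k^5 \<Rightarrow> 'k^5 \<Rightarrow> 'k" where
  "tri \<Phi> u w p = (\<Sum>i\<in>UNIV. \<Sum>j\<in>UNIV. \<Sum>k\<in>UNIV. u $ i * w $ j * p $ k * \<Phi> $ i $ j $ k)"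

lemma act5_nth: "act5 A B \<Phi> $ i $ j $ k = tri \<Phi> (A $ i) (A $ j) (B $ k)"
proof -
  have "act5 A B \<Phi> $ i $ j $ k =
      (\<Sum>l\<in>UNIV. \<Sum>a\<in>UNIV. \<Sum>b\<in>UNIV. A $ i $ a * A $ j $ b * B $ k $ l * \<Phi> $ a $ b $ l)"
    by (simp add: act5_def matrix_vector_mult_def sum_distrib_left mult_ac)
  also have "\<dots> = tri \<Phi> (A $ i) (A $ j) (B $ k)"
    unfolding tri_def by (subst sum.swap, rule sum.cong [OF refl], rule sum.swap)
  finally show ?thesis .
qed

lemma sum_axis: "(\<Sum>c\<in>UNIV. axis k 1 $ c * f c) = (f k :: 'k::comm_ring_1)" for k :: "'n::finite"
proof -
  have "(\<Sum>c\<in>UNIV. axis k 1 $ c * f c) = (\<Sum>c\<in>UNIV. if c = k then f c else 0)"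
    by (intro sum.cong refl) (simp add: axis_def)
  then show ?thesis
    by simp
qed

lemma tri_nested:
  "tri \<Phi> u w p = (\<Sum>i\<in>UNIV. u $ i * (\<Sum>j\<in>UNIV. w $ j * (\<Sum>k\<in>UNIV. p $ k * \<Phi> $ i $ j $ k)))"
  by (simp add: tri_def sum_distrib_left mult_ac)

lemma tri_axis: "tri \<Phi> (axis i 1) (axis j 1) (axis k 1) = \<Phi> $ i $ j $ k"
  by (simp add: tri_nested sum_axis)

lemma tri_add_left: "tri \<Phi> (u + u') w p = tri \<Phi> u w p + tri \<Phi> u' w p"
  by (simp add: tri_def distrib_right sum.distrib)

lemma tri_add_mid: "tri \<Phi> u (w + w') p = tri \<Phi> u w p + tri \<Phi> u w' p"
  by (simp add: tri_def distrib_left distrib_right sum.distrib)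

lemma tri_add_right: "tri \<Phi> u w (p + p') = tri \<Phi> u w p + tri \<Phi> u w p'"
  by (simp add: tri_def distrib_left distrib_right sum.distrib)

lemma tri_scale_left: "tri \<Phi> (c *s u) w p = c * tri \<Phi> u w p"
  by (simp add: tri_def sum_distrib_left mult_ac)

lemma tri_scale_mid: "tri \<Phi> u (c *s w) p = c * tri \<Phi> u w p"
  by (simp add: tri_def sum_distrib_left mult_ac)

lemma tri_scale_right: "tri \<Phi> u w (c *s p) = c * tri \<Phi> u w p"
  by (simp add: tri_def sum_distrib_left mult_ac)

lemma tri_model_add: "tri (\<Phi> + \<Psi>) u w p = tri \<Phi> u w p + tri \<Psi> u w p"
  by (simp add: tri_def distrib_left sum.distrib)

lemma tri_model_scale: "tri (scale5 c \<Phi>) u w p = c * tri \<Phi> u w p"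
  by (simp add: tri_def sum_distrib_left mult_ac)

lemma act5_line: "act5 A B (\<Phi> + scale5 c \<Psi>) = act5 A B \<Phi> + scale5 c (act5 A B \<Psi>)"
  by (simp add: vec_eq_iff act5_nth tri_model_add tri_model_scale)

lemma X5_UNIV_iff:
  "\<Phi> \<in> X5 UNIV \<longleftrightarrow> (\<forall>i k. \<Phi> $ i $ i $ k = 0) \<and> (\<forall>i j k. \<Phi> $ j $ i $ k = - \<Phi> $ i $ j $ k)"
  by (simp only: X5_def mem_Collect_eq vec_eq_iff zero_index vector_uminus_component UNIV_I simp_thms)

lemma X5_subset_UNIV: "\<Phi> \<in> X5 R \<Longrightarrow> \<Phi> \<in> X5 UNIV"
  unfolding X5_def by blast

lemma X5_diag: "\<Phi> \<in> X5 R \<Longrightarrow> \<Phi> $ i $ i $ k = 0"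
  using X5_subset_UNIV X5_UNIV_iff by blast

lemma X5_alt: "\<Phi> \<in> X5 R \<Longrightarrow> \<Phi> $ j $ i $ k = - \<Phi> $ i $ j $ k"
  using X5_subset_UNIV X5_UNIV_iff by blast

lemma X5_UNIV_I:
  assumes "\<And>i k. \<Phi> $ i $ i $ k = 0" "\<And>i j k. \<Phi> $ j $ i $ k = - \<Phi> $ i $ j $ k"
  shows "\<Phi> \<in> X5 UNIV"
  unfolding X5_UNIV_iff by (intro conjI allI assms)

lemma tri_alt:
  assumes "\<Phi> \<in> X5 R"
  shows "tri \<Phi> w u p = - tri \<Phi> u w p" and tri_self: "tri \<Phi> u u p = 0"
proof -
  have s: "\<Phi> $ j $ i $ k = - \<Phi> $ i $ j $ k" "\<Phi> $ i $ i $ k = 0" for i j k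
    using assms by (rule X5_alt, rule X5_diag)
  have "tri \<Phi> w u p = (\<Sum>j\<in>UNIV. \<Sum>i\<in>UNIV. \<Sum>k\<in>UNIV. w $ i * u $ j * p $ k * \<Phi> $ i $ j $ k)"
    unfolding tri_def by (rule sum.swap)
  also have "\<dots> = - tri \<Phi> u w p"
  proof -
    have "w $ i * u $ j * p $ k * \<Phi> $ i $ j $ k = - (u $ j * w $ i * p $ k * \<Phi> $ j $ i $ k)" for i j k
      using s(1) [of i j k] by simp
    then show ?thesis
      by (simp only: tri_def sum_negf)
  qed
  finally show "tri \<Phi> w u p = - tri \<Phi> u w p" .
  \<comment> \<open>Antisymmetry gives only that twice the value is zero. To cover characteristic 2
    the vanishing diagonal is used, and the off-diagonal terms are cancelled in pairs.\<close>
  define f where "f i j = (\<Sum>k\<in>UNIV. p $ k * \<Phi> $ i $ j $ k)" for i j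
  have f: "f j i = - f i j" "f i i = 0" for i j
    using s(1) [of j i] by (simp_all only: f_def s(2) mult_minus_right sum_negf mult_zero_right sum.neutral_const)
  show "tri \<Phi> u u p = 0"
    unfolding tri_nested f_def [symmetric] sum_5
    by (simp add: f(2) f(1) [of 0 1] f(1) [of 0 2] f(1) [of 0 3] f(1) [of 0 4] f(1) [of 1 2]
        f(1) [of 1 3] f(1) [of 1 4] f(1) [of 2 3] f(1) [of 2 4] f(1) [of 3 4] algebra_simps)
qed

lemma act5_X5: "\<Phi> \<in> X5 UNIV \<Longrightarrow> act5 A B \<Phi> \<in> X5 UNIV"
  by (rule X5_UNIV_I) (simp_all only: act5_nth tri_self, rule tri_alt)

lemma add_X5:
  assumes "\<Phi> \<in> X5 UNIV" "\<Psi> \<in> X5 UNIV"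
  shows "\<Phi> + \<Psi> \<in> X5 UNIV"
proof (rule X5_UNIV_I)
  show "(\<Phi> + \<Psi>) $ j $ i $ k = - (\<Phi> + \<Psi>) $ i $ j $ k" for i j k
    using X5_alt [OF assms(1), of j i k] X5_alt [OF assms(2), of j i k] by simp
qed (simp add: assms [THEN X5_diag])

lemma scale5_X5:
  assumes "\<Phi> \<in> X5 UNIV"
  shows "scale5 c \<Phi> \<in> X5 UNIV"
proof (rule X5_UNIV_I)
  show "scale5 c \<Phi> $ j $ i $ k = - scale5 c \<Phi> $ i $ j $ k" for i j k
    using X5_alt [OF assms, of j i k] by simp
qed (simp add: assms [THEN X5_diag])

lemma diff_X5:
  assumes "\<Phi> \<in> X5 UNIV" "\<Psi> \<in> X5 UNIV"
  shows "\<Phi> - \<Psi> \<in> X5 UNIV"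
proof -
  have "\<Phi> - \<Psi> = \<Phi> + scale5 (- 1) \<Psi>"
    by (simp add: vec_eq_iff)
  then show ?thesis
    using add_X5 [OF assms(1) scale5_X5 [OF assms(2)]] by metis
qed

section \<open>Singular points\<close>

lemma entry_form_mult:
  "entry_form \<Phi> a b * entry_form \<Phi> c d = (\<Sum>k\<in>UNIV. \<Sum>l\<in>UNIV.
     Poly_Mapping.single (Poly_Mapping.single k 1 + Poly_Mapping.single l 1) (\<Phi> $ a $ b $ k * \<Phi> $ c $ d $ l))"
  by (simp add: entry_form_def sum_product mult_single)

lemma prod_two_variables:
  fixes a :: "'v::finite \<Rightarrow> 'b::comm_semiring_1"
  shows "(\<Prod>x\<in>UNIV. a x ^ Poly_Mapping.lookup (Poly_Mapping.single k 1 + Poly_Mapping.single l 1) x) = a k * a l"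
  by (simp add: lookup_add power_add prod.distrib lookup_single when_def
      if_distrib [where f = "\<lambda>n. _ ^ n"] cong: if_cong)

lemma prod_one_variable:
  fixes a :: "'v::finite \<Rightarrow> 'b::comm_semiring_1"
  shows "(\<Prod>x\<in>UNIV. a x ^ Poly_Mapping.lookup (Poly_Mapping.single k 1) x) = a k"
  by (simp add: lookup_single when_def if_distrib [where f = "\<lambda>n. _ ^ n"] cong: if_cong)

definition lin_form :: "'k::field matrix_of_forms \<Rightarrow> 'k alg_closure^5 \<Rightarrow> 5 \<Rightarrow> 5 \<Rightarrow> 'k alg_closure" where
  "lin_form \<Phi> x i j = (\<Sum>k\<in>UNIV. to_ac (\<Phi> $ i $ j $ k) * x $ k)"

lemma eval_entry_form_mult:
  "mpoly_eval to_ac (($) x) (entry_form \<Phi> a b * entry_form \<Phi> c d) = lin_form \<Phi> x a b * lin_form \<Phi> x c d"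
  by (simp add: entry_form_mult mpoly_eval_sum mpoly_eval_single prod_keys_UNIV prod_two_variables
      [unfolded One_nat_def] lin_form_def sum_product mult_ac)

lemma partial_entry_form_mult:
  "mpoly_eval to_ac (($) x) (mpoly_partial j (entry_form \<Phi> a b * entry_form \<Phi> c d)) =
     to_ac (\<Phi> $ a $ b $ j) * lin_form \<Phi> x c d + lin_form \<Phi> x a b * to_ac (\<Phi> $ c $ d $ j)"
proof -
  have m1: "Poly_Mapping.single j (1::nat) + Poly_Mapping.single l 1 - Poly_Mapping.single j 1 = Poly_Mapping.single l 1"
    "Poly_Mapping.single l (1::nat) + Poly_Mapping.single j 1 - Poly_Mapping.single j 1 = Poly_Mapping.single l 1" for l :: 5
    by simp_all
  have *: "mpoly_eval to_ac (($) x) (mpoly_partial j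
      (Poly_Mapping.single (Poly_Mapping.single k 1 + Poly_Mapping.single l 1) e)) =
      (if k = j then to_ac e * x $ l else 0) + (if l = j then to_ac e * x $ k else 0)" for k l e
  proof (cases "k = j"; cases "l = j")
    assume "k = j" "l = j"
    then show ?thesis
      by (simp add: mpoly_partial_single m1 [unfolded One_nat_def] mpoly_eval_single prod_keys_UNIV
         prod_one_variable [unfolded One_nat_def] lookup_add lookup_single to_ac_add to_ac_mult algebra_simps)
  next
    assume "k = j" "l \<noteq> j"
    then show ?thesis
      by (simp add: mpoly_partial_single m1 [unfolded One_nat_def] mpoly_eval_single prod_keys_UNIV
         prod_one_variable [unfolded One_nat_def] lookup_add lookup_single)
  next
    assume "k \<noteq> j" "l = j"
    then show ?thesis
      by (simp add: mpoly_partial_single m1 [unfolded One_nat_def] mpoly_eval_single prod_keys_UNIV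
         prod_one_variable [unfolded One_nat_def] lookup_add lookup_single)
  next
    assume "k \<noteq> j" "l \<noteq> j"
    then show ?thesis
      by (simp add: mpoly_partial_single mpoly_eval_def lookup_add lookup_single)
  qed
  have "mpoly_eval to_ac (($) x) (mpoly_partial j (entry_form \<Phi> a b * entry_form \<Phi> c d)) =
     (\<Sum>k\<in>UNIV. \<Sum>l\<in>UNIV. (if k = j then to_ac (\<Phi> $ a $ b $ k * \<Phi> $ c $ d $ l) * x $ l else 0) +
       (if l = j then to_ac (\<Phi> $ a $ b $ k * \<Phi> $ c $ d $ l) * x $ k else 0))"
    by (simp add: entry_form_mult mpoly_partial_sum mpoly_eval_sum * [unfolded One_nat_def] to_ac_add)
  also have "\<dots> = (\<Sum>l\<in>UNIV. to_ac (\<Phi> $ a $ b $ j * \<Phi> $ c $ d $ l) * x $ l) +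
      (\<Sum>k\<in>UNIV. to_ac (\<Phi> $ a $ b $ k * \<Phi> $ c $ d $ j) * x $ k)"
    unfolding sum.distrib
    by (rule arg_cong2 [where f = "(+)"], subst sum.swap) (simp_all)
  also have "\<dots> = to_ac (\<Phi> $ a $ b $ j) * lin_form \<Phi> x c d + lin_form \<Phi> x a b * to_ac (\<Phi> $ c $ d $ j)"
    by (simp add: lin_form_def sum_distrib_left sum_distrib_right to_ac_mult mult_ac)
  finally show ?thesis .
qed

lemma mpoly_eval_diff:
  fixes h :: "'c::comm_ring_1 \<Rightarrow> 'b::comm_ring_1"
  assumes "h 0 = 0" "\<And>x y. h (x + y) = h x + h y"
  shows "mpoly_eval h a (p - q) = mpoly_eval h a p - mpoly_eval h a q"
  using mpoly_eval_add [OF assms, of a "p - q" q] by (simp add: eq_diff_eq)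

lemma mpoly_partial_diff:
  "mpoly_partial x (p - q) = mpoly_partial x p - (mpoly_partial x q :: ('v, 'c::comm_ring_1) mpoly)"
  using mpoly_partial_add [of x "p - q" q] by (simp add: eq_diff_eq)

text \<open>A Pfaffian omitting row 0, 1 or 2 still involves rows 3 and 4. Each of its terms
  contains either the zero entry (3, 4) or one entry from row 3 and one from row 4, both vanishing
  at the point. Three of the five equations thus vanish there to second order, and the Jacobian has
  rank at most 2 instead of 3.\<close>

lemma not_smooth_if_node:
  fixes \<Phi> :: "'k::field matrix_of_forms"
  assumes X: "\<Phi> \<in> X5 UNIV"
    and z: "\<And>j. \<Phi> $ 3 $ j $ 0 = 0" "\<And>j. \<Phi> $ 4 $ j $ 0 = 0" "\<And>k. \<Phi> $ 3 $ 4 $ k = 0"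
  shows "\<not> smooth_curve_of_genus g (pfaffian \<Phi>)"
proof
  assume smooth: "smooth_curve_of_genus g (pfaffian \<Phi>)"
  define x :: "'k alg_closure^5" where "x = axis 0 1"
  have z': "\<Phi> $ j $ 3 $ 0 = 0" "\<Phi> $ j $ 4 $ 0 = 0" "\<Phi> $ 4 $ 3 $ k = 0" for j k
    by (simp_all add: z X5_alt [OF X, of j 3] X5_alt [OF X, of j 4] X5_alt [OF X, of 4 3])
  have wrap: "(5::5) = 0" "(6::5) = 1" "(7::5) = 2" "(8::5) = 3"
    by simp_all
  have L: "lin_form \<Phi> x i j = to_ac (\<Phi> $ i $ j $ 0)" for i j
    by (simp add: lin_form_def x_def axis_def if_distrib [where f = "\<lambda>x. _ * x"] cong: if_cong)
  have pf: "mpoly_eval to_ac (($) x) (pfaffian \<Phi> i) = 0" for i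
  proof -
    have "\<forall>i. mpoly_eval to_ac (($) x) (pfaffian \<Phi> i) = 0"
      unfolding all_5 pfaffian_def
      by (simp add: mpoly_eval_add mpoly_eval_diff to_ac_add eval_entry_form_mult L z z' wrap)
    then show ?thesis by simp
  qed
  have xp: "x \<in> geom_points (pfaffian \<Phi>)"
    by (auto simp: geom_points_def pf) (simp add: x_def axis_eq_0_iff)
  have J: "jacobian_at (pfaffian \<Phi>) x $ i $ j = 0" if "i \<in> {0, 1, 2}" for i j
    using that
    by (auto simp: jacobian_at_def pfaffian_def mpoly_eval_add mpoly_eval_diff mpoly_partial_add
      mpoly_partial_diff to_ac_add partial_entry_form_mult L z z' wrap)
  define R where "R = {row 3 (jacobian_at (pfaffian \<Phi>) x), row 4 (jacobian_at (pfaffian \<Phi>) x)}"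
  have "rows (jacobian_at (pfaffian \<Phi>) x) \<subseteq> insert 0 R"
  proof -
    have "\<forall>i. row i (jacobian_at (pfaffian \<Phi>) x) \<in> insert 0 R"
      unfolding all_5 by (auto simp: R_def row_def vec_eq_iff J)
    then show ?thesis
      by (auto simp: rows_def)
  qed
  then have "rows (jacobian_at (pfaffian \<Phi>) x) \<subseteq> vec.span R"
    using vec.span_base vec.span_zero by blast
  then have "rank (jacobian_at (pfaffian \<Phi>) x) \<le> card R"
    unfolding row_rank_def_gen by (rule vec.dim_le_card) (simp add: R_def)
  also have "\<dots> \<le> 2"
    by (simp add: R_def card_insert_if)
  finally have "rank (jacobian_at (pfaffian \<Phi>) x) \<noteq> CARD(5) - 1 - 1"
    by simp
  with smooth xp show False
    by (auto simp: smooth_curve_of_genus_def)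
qed

text \<open>A singular point in standard position: the point is e_0 and the kernel vectors are e_3
  and e_4, where e_i is \<open>axis i 1\<close>.\<close>

definition node0 :: "'k::comm_ring_1 matrix_of_forms \<Rightarrow> bool" where
  "node0 \<Phi> \<longleftrightarrow> \<Phi> \<in> X5 UNIV \<and> (\<forall>j. \<Phi> $ 3 $ j $ 0 = 0) \<and> (\<forall>j. \<Phi> $ 4 $ j $ 0 = 0) \<and> (\<forall>k. \<Phi> $ 3 $ 4 $ k = 0)"

section \<open>Coordinate directions and infinitesimal symmetries\<close>

definition elem5 :: "5 \<Rightarrow> 5 \<Rightarrow> 5 \<Rightarrow> 'k::comm_ring_1 matrix_of_forms" where
  "elem5 i j k = (\<chi> a b c. if c = k then (if a = i \<and> b = j then 1 else if a = j \<and> b = i then - 1 else 0) else 0)"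

lemma elem5_X5: "i \<noteq> j \<Longrightarrow> elem5 i j k \<in> X5 UNIV"
  by (rule X5_UNIV_I) (auto simp: elem5_def)

text \<open>The Lie algebra action: this is the derivative at t = 0 of
  \<open>transvection a b t\<close> acting on rows and columns. \<open>varop\<close> is the analogue
  for the variables.\<close>

definition rowop :: "5 \<Rightarrow> 5 \<Rightarrow> 'k::comm_ring_1 matrix_of_forms \<Rightarrow> 'k matrix_of_forms" where
  "rowop a b \<Phi> = (\<chi> i j k. (if i = a then \<Phi> $ b $ j $ k else 0) + (if j = a then \<Phi> $ i $ b $ k else 0))"

definition varop :: "5 \<Rightarrow> 5 \<Rightarrow> 'k::comm_ring_1 matrix_of_forms \<Rightarrow> 'k matrix_of_forms" where
  "varop a b \<Phi> = (\<chi> i j k. if k = a then \<Phi> $ i $ j $ b else 0)"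

definition transvection :: "5 \<Rightarrow> 5 \<Rightarrow> 'k::comm_ring_1 \<Rightarrow> 'k^5^5" where
  "transvection a b t = (\<chi> i. if i = a then axis a 1 + t *s axis b 1 else axis i 1)"

lemma mat_1_nth: "mat 1 $ k = axis k 1"
  by (simp add: mat_def axis_def vec_eq_iff)

lemma det_transvection:
  fixes t :: "'k::comm_ring_1"
  assumes "a \<noteq> b"
  shows "det (transvection a b t) = 1"
proof -
  have "row i (mat 1 :: 'k^5^5) = axis i 1" for i
    by (simp add: row_def mat_def axis_def vec_eq_iff)
  then show ?thesis
    using det_row_operation [OF assms, of "mat 1 :: 'k^5^5" t] by (simp only: transvection_def det_I)
qed

text \<open>No quadratic term appears: it could only be t^2 times the entry (b, b), placed at (a,
  a), and the diagonal is zero.\<close>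

lemma act5_row_transvection:
  assumes "\<Phi> \<in> X5 UNIV"
  shows "act5 (transvection a b t) (mat 1) \<Phi> = \<Phi> + scale5 t (rowop a b \<Phi>)"
  by (simp add: vec_eq_iff act5_nth transvection_def rowop_def mat_1_nth tri_add_left tri_add_mid
      tri_scale_left tri_scale_mid tri_axis algebra_simps X5_diag [OF assms])

lemma act5_var_transvection:
  "act5 (mat 1) (transvection a b t) \<Phi> = \<Phi> + scale5 t (varop a b \<Phi>)"
  by (simp add: vec_eq_iff act5_nth transvection_def varop_def mat_1_nth tri_add_right tri_scale_right
      tri_axis)

lemma dir5_add: "dir5 D \<Phi> (\<Psi> + \<Psi>') = dir5 D \<Phi> \<Psi> + dir5 D \<Phi> \<Psi>'"
  by (simp add: dir5_def distrib_left sum.distrib)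

lemma dir5_scale: "dir5 D \<Phi> (scale5 c \<Psi>) = c * dir5 D \<Phi> \<Psi>"
  by (simp add: dir5_def sum_distrib_left mult_ac)

lemma dir5_UNIV:
  "dir5 D \<Phi> \<Psi> = (\<Sum>x\<in>UNIV. eval5 (mpoly_partial x D) \<Phi> * (case x of (i, j, k) \<Rightarrow> \<Psi> $ i $ j $ k))"
  by (simp add: dir5_def sum.cartesian_product case_prod_beta)

lemma partial_outside_coordinate_ring:
  assumes "in_coordinate_ring_X5 D" "\<not> i < j"
  shows "mpoly_partial (i, j, k) D = 0"
proof -
  have "(i, j, k) \<notin> Poly_Mapping.keys m" if "m \<in> Poly_Mapping.keys D" for m
    using assms that unfolding in_coordinate_ring_X5_def by auto
  then have "Poly_Mapping.lookup m (i, j, k) = 0" if "m \<in> Poly_Mapping.keys D" for m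
    using that by (simp add: in_keys_iff)
  then show ?thesis
    by (simp add: mpoly_partial_def)
qed

lemma eval5_0 [simp]: "eval5 0 \<Phi> = 0"
  by (simp add: eval5_def mpoly_eval_def)

section \<open>Invariants that vanish on models with a singular point\<close>

text \<open>The properties of the discriminant on which the argument rests. Vanishing is stated for
  nodes in standard position and reaches all nodes by invariance; an infinite field lets polynomial
  identities be checked on values.\<close>

locale pfaffian_invariant =
  fixes D :: invariant5 and ty :: "'k::field itself"
  assumes infinite_field: "infinite (UNIV :: 'k set)"
    and coordinates: "in_coordinate_ring_X5 D"
    and invariance: "\<And>(A :: 'k^5^5) B \<Phi>. invertible A \<Longrightarrow> invertible B \<Longrightarrow> \<Phi> \<in> X5 UNIV \<Longrightarrow>
      eval5 D (act5 A B \<Phi>) = ((det A)\<^sup>2 * det B) ^ 12 * eval5 D \<Phi>"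
    and vanish_node0: "\<And>\<Phi> :: 'k matrix_of_forms. node0 \<Phi> \<Longrightarrow> eval5 D \<Phi> = 0"
begin

lemma poly_eq_0I: "(p :: 'k poly) = 0" if "infinite {u. poly p u = 0}"
  using that poly_roots_finite by blast

lemma poly_eqI: "(p :: 'k poly) = q" if "\<And>u. poly p u = poly q u"
proof -
  have "p - q = 0"
    by (rule poly_eq_0I) (simp add: that infinite_field)
  then show ?thesis
    by simp
qed

lemma dir5_eq_0_if_constant:
  fixes \<Phi> \<Psi> :: "'k matrix_of_forms"
  assumes "\<And>u. eval5 D (\<Phi> + scale5 u \<Psi>) = eval5 D \<Phi>"
  shows "dir5 D \<Phi> \<Psi> = 0"
proof -
  have "eval5 D (line5 \<Phi> \<Psi>) = [:eval5 D \<Phi>:]"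
    by (rule poly_eqI) (simp add: eval5_line5 assms)
  then show ?thesis
    by (simp flip: coeff_1_eval5_line5)
qed

lemma invertible_transvection: "a \<noteq> b \<Longrightarrow> invertible (transvection a b (t :: 'k))"
  by (simp add: invertible_det_nz det_transvection)

lemma invertible_one: "invertible (mat 1 :: 'k^5^5)"
  by (simp add: invertible_det_nz)

lemma dir5_rowop:
  fixes \<Phi> :: "'k matrix_of_forms"
  assumes "\<Phi> \<in> X5 UNIV" "a \<noteq> b"
  shows "dir5 D \<Phi> (rowop a b \<Phi>) = 0"
proof (rule dir5_eq_0_if_constant)
  fix u
  have "eval5 D (act5 (transvection a b u) (mat 1) \<Phi>) = eval5 D \<Phi>"
    using assms by (simp add: invariance invertible_transvection invertible_one det_transvection)
  then show "eval5 D (\<Phi> + scale5 u (rowop a b \<Phi>)) = eval5 D \<Phi>"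
    by (simp add: act5_row_transvection assms)
qed

lemma dir5_varop:
  fixes \<Phi> :: "'k matrix_of_forms"
  assumes "\<Phi> \<in> X5 UNIV" "a \<noteq> b"
  shows "dir5 D \<Phi> (varop a b \<Phi>) = 0"
proof (rule dir5_eq_0_if_constant)
  fix u
  have "eval5 D (act5 (mat 1) (transvection a b u) \<Phi>) = eval5 D \<Phi>"
    using assms by (simp add: invariance invertible_transvection invertible_one det_transvection)
  then show "eval5 D (\<Phi> + scale5 u (varop a b \<Phi>)) = eval5 D \<Phi>"
    by (simp add: act5_var_transvection)
qed

text \<open>The action is linear in the model and so maps lines to lines; the invariance identity
  may be compared coefficient by coefficient along a line.\<close>

lemma dir5_act5:
  fixes \<Phi> \<Psi> :: "'k matrix_of_forms"
  assumes "invertible A" "invertible B" "\<Phi> \<in> X5 UNIV" "\<Psi> \<in> X5 UNIV"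
  shows "dir5 D (act5 A B \<Phi>) (act5 A B \<Psi>) = ((det A)\<^sup>2 * det B) ^ 12 * dir5 D \<Phi> \<Psi>"
proof -
  have "eval5 D (line5 (act5 A B \<Phi>) (act5 A B \<Psi>)) =
      Polynomial.smult (((det A)\<^sup>2 * det B) ^ 12) (eval5 D (line5 \<Phi> \<Psi>))"
    by (rule poly_eqI) (simp add: eval5_line5 invariance assms add_X5 scale5_X5 flip: act5_line)
  then show ?thesis
    by (simp flip: coeff_1_eval5_line5)
qed

lemma dir5_elem5:
  fixes \<Phi> :: "'k matrix_of_forms"
  assumes "i < j"
  shows "dir5 D \<Phi> (elem5 i j k) = eval5 (mpoly_partial (i, j, k) D) \<Phi>"
proof -
  have "eval5 (mpoly_partial x D) \<Phi> * (case x of (a, b, c) \<Rightarrow> elem5 i j k $ a $ b $ c) =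
      (if x = (i, j, k) then eval5 (mpoly_partial (i, j, k) D) \<Phi> else 0)" for x
    using assms partial_outside_coordinate_ring [OF coordinates, of j i k]
    by (cases x) (auto simp: elem5_def)
  then show ?thesis
    by (simp add: dir5_UNIV)
qed

text \<open>All other coordinate directions are tangent to the linear space of models in \<^const>\<open>node0\<close>.\<close>

definition normal_coords :: "(5 \<times> 5 \<times> 5) set" where
  "normal_coords = {(0,3,0), (1,3,0), (2,3,0), (0,4,0), (1,4,0), (2,4,0),
    (3,4,0), (3,4,1), (3,4,2), (3,4,3), (3,4,4)}"

lemma partial_tangent_node0:
  fixes \<Phi> :: "'k matrix_of_forms"
  assumes "node0 \<Phi>" "x \<notin> normal_coords"
  shows "eval5 (mpoly_partial x D) \<Phi> = 0"
proof -
  obtain i j k where x: "x = (i, j, k)"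
    by (cases x)
  show ?thesis
  proof (cases "i < j")
    case False
    then show ?thesis
      by (simp add: x partial_outside_coordinate_ring [OF coordinates])
  next
    case True
    have nt: "\<not> (i = 3 \<and> j = 4)" "\<not> (k = 0 \<and> (i = 3 \<or> j = 3 \<or> i = 4 \<or> j = 4))"
    proof -
      have "\<forall>i j k :: 5. (i, j, k) \<notin> normal_coords \<longrightarrow> i < j \<longrightarrow>
          \<not> (i = 3 \<and> j = 4) \<and> \<not> (k = 0 \<and> (i = 3 \<or> j = 3 \<or> i = 4 \<or> j = 4))"
        unfolding all_5 normal_coords_def
        by (simp add: order_5 order_5 [THEN less_not_sym])
      with True assms(2) x show "\<not> (i = 3 \<and> j = 4)" "\<not> (k = 0 \<and> (i = 3 \<or> j = 3 \<or> i = 4 \<or> j = 4))"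
        by blast+
    qed
    have "node0 (\<Phi> + scale5 u (elem5 i j k))" for u
      unfolding node0_def
    proof (intro conjI allI)
      show "\<Phi> + scale5 u (elem5 i j k) \<in> X5 UNIV"
        using assms(1) True by (intro add_X5 scale5_X5 elem5_X5) (simp_all add: node0_def)
      show "(\<Phi> + scale5 u (elem5 i j k)) $ 3 $ b $ 0 = 0" "(\<Phi> + scale5 u (elem5 i j k)) $ 4 $ b $ 0 = 0" for b
        using assms(1) nt by (auto simp: node0_def elem5_def)
      show "(\<Phi> + scale5 u (elem5 i j k)) $ 3 $ 4 $ c = 0" for c
        using assms(1) nt True order_5(10) by (auto simp: node0_def elem5_def)
    qed
    then have "dir5 D \<Phi> (elem5 i j k) = 0"
      by (intro dir5_eq_0_if_constant) (simp add: vanish_node0 assms)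
    then show ?thesis
      by (simp add: dir5_elem5 True x)
  qed
qed

lemma dir5_node0:
  fixes \<Phi> \<Psi> :: "'k matrix_of_forms"
  assumes "node0 \<Phi>"
  defines "y \<equiv> \<lambda>x. eval5 (mpoly_partial x D) \<Phi>"
  shows "dir5 D \<Phi> \<Psi> =
    y (0,3,0) * \<Psi> $ 0 $ 3 $ 0 + y (1,3,0) * \<Psi> $ 1 $ 3 $ 0 + y (2,3,0) * \<Psi> $ 2 $ 3 $ 0 +
    y (0,4,0) * \<Psi> $ 0 $ 4 $ 0 + y (1,4,0) * \<Psi> $ 1 $ 4 $ 0 + y (2,4,0) * \<Psi> $ 2 $ 4 $ 0 +
    y (3,4,0) * \<Psi> $ 3 $ 4 $ 0 + y (3,4,1) * \<Psi> $ 3 $ 4 $ 1 + y (3,4,2) * \<Psi> $ 3 $ 4 $ 2 +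
    y (3,4,3) * \<Psi> $ 3 $ 4 $ 3 + y (3,4,4) * \<Psi> $ 3 $ 4 $ 4"
proof -
  have "dir5 D \<Phi> \<Psi> = (\<Sum>x\<in>normal_coords. y x * (case x of (i, j, k) \<Rightarrow> \<Psi> $ i $ j $ k))"
    unfolding dir5_UNIV y_def
    by (rule sum.mono_neutral_right) (auto simp: partial_tangent_node0 [OF assms(1)])
  then show ?thesis
    by (simp add: normal_coords_def add.assoc)
qed

text \<open>Adding row \<open>a\<close> to row 3 or 4, or moving e_0, destroys the standard node, so
  invariance under these symmetries constrains the normal derivatives. The coefficient of the
  derivative at (3, 4, 0) is always zero; there remain 3 + 3 + 4 linear equations for the ten
  others.\<close>

lemma node0_equations:
  fixes \<Phi> :: "'k matrix_of_forms"
  assumes "node0 \<Phi>"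
  defines "y \<equiv> \<lambda>x. eval5 (mpoly_partial x D) \<Phi>"
  shows "a \<noteq> 3 \<Longrightarrow> a \<noteq> 4 \<Longrightarrow>
      y (0,3,0) * \<Phi> $ 0 $ a $ 0 + y (1,3,0) * \<Phi> $ 1 $ a $ 0 + y (2,3,0) * \<Phi> $ 2 $ a $ 0 +
      y (3,4,1) * \<Phi> $ a $ 4 $ 1 + y (3,4,2) * \<Phi> $ a $ 4 $ 2 + y (3,4,3) * \<Phi> $ a $ 4 $ 3 + y (3,4,4) * \<Phi> $ a $ 4 $ 4 = 0"
    and "a \<noteq> 3 \<Longrightarrow> a \<noteq> 4 \<Longrightarrow>
      y (0,4,0) * \<Phi> $ 0 $ a $ 0 + y (1,4,0) * \<Phi> $ 1 $ a $ 0 + y (2,4,0) * \<Phi> $ 2 $ a $ 0 +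
      y (3,4,1) * \<Phi> $ 3 $ a $ 1 + y (3,4,2) * \<Phi> $ 3 $ a $ 2 + y (3,4,3) * \<Phi> $ 3 $ a $ 3 + y (3,4,4) * \<Phi> $ 3 $ a $ 4 = 0"
    and "k \<noteq> 0 \<Longrightarrow>
      y (0,3,0) * \<Phi> $ 0 $ 3 $ k + y (1,3,0) * \<Phi> $ 1 $ 3 $ k + y (2,3,0) * \<Phi> $ 2 $ 3 $ k +
      y (0,4,0) * \<Phi> $ 0 $ 4 $ k + y (1,4,0) * \<Phi> $ 1 $ 4 $ k + y (2,4,0) * \<Phi> $ 2 $ 4 $ k = 0"
proof -
  have X: "\<Phi> \<in> X5 UNIV" and z: "\<And>j. \<Phi> $ 3 $ j $ 0 = 0" "\<And>j. \<Phi> $ 4 $ j $ 0 = 0" "\<And>k. \<Phi> $ 3 $ 4 $ k = 0"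
    using assms(1) by (auto simp: node0_def)
  have z': "\<Phi> $ j $ 3 $ 0 = 0" "\<Phi> $ j $ 4 $ 0 = 0" for j
    by (simp_all add: z X5_alt [OF X, of j 3] X5_alt [OF X, of j 4])
  note dir = dir5_node0 [OF assms(1)]
  show "y (0,3,0) * \<Phi> $ 0 $ a $ 0 + y (1,3,0) * \<Phi> $ 1 $ a $ 0 + y (2,3,0) * \<Phi> $ 2 $ a $ 0 +
      y (3,4,1) * \<Phi> $ a $ 4 $ 1 + y (3,4,2) * \<Phi> $ a $ 4 $ 2 + y (3,4,3) * \<Phi> $ a $ 4 $ 3 + y (3,4,4) * \<Phi> $ a $ 4 $ 4 = 0"
    if "a \<noteq> 3" "a \<noteq> 4"
    using dir5_rowop [OF X, of 3 a] that by (simp add: dir rowop_def z z' y_def)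
  show "y (0,4,0) * \<Phi> $ 0 $ a $ 0 + y (1,4,0) * \<Phi> $ 1 $ a $ 0 + y (2,4,0) * \<Phi> $ 2 $ a $ 0 +
      y (3,4,1) * \<Phi> $ 3 $ a $ 1 + y (3,4,2) * \<Phi> $ 3 $ a $ 2 + y (3,4,3) * \<Phi> $ 3 $ a $ 3 + y (3,4,4) * \<Phi> $ 3 $ a $ 4 = 0"
    if "a \<noteq> 3" "a \<noteq> 4"
    using dir5_rowop [OF X, of 4 a] that by (simp add: dir rowop_def z z' y_def)
  show "y (0,3,0) * \<Phi> $ 0 $ 3 $ k + y (1,3,0) * \<Phi> $ 1 $ 3 $ k + y (2,3,0) * \<Phi> $ 2 $ 3 $ k +
      y (0,4,0) * \<Phi> $ 0 $ 4 $ k + y (1,4,0) * \<Phi> $ 1 $ 4 $ k + y (2,4,0) * \<Phi> $ 2 $ 4 $ k = 0"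
    if "k \<noteq> 0"
    using dir5_varop [OF X, of 0 k] that by (simp add: dir varop_def z z' y_def)
qed

end

lemma coeff_mult_linear:
  "poly.coeff (q * [:a, b:]) (Suc n) = poly.coeff q (Suc n) * a + poly.coeff q n * b"
  by (simp add: mult.commute)

text \<open>Steinitz exchange against the standard basis. That the added rows are basis vectors
  different from the prescribed ones matters in \<open>flat_line_first_row\<close>, where they must
  lie in a coordinate hyperplane.\<close>

lemma extend_to_invertible:
  fixes f :: "5 \<Rightarrow> 'k::field^5"
  assumes ind: "\<And>c. (\<Sum>i\<in>I. c i *s f i) = 0 \<Longrightarrow> \<forall>i\<in>I. c i = 0"
  obtains A :: "'k^5^5" where "invertible A" "\<And>i. i \<in> I \<Longrightarrow> A $ i = f i"
    "\<And>i. i \<notin> I \<Longrightarrow> \<exists>a. A $ i = axis a 1 \<and> axis a 1 \<notin> f ` I"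
proof -
  have fin: "finite I"
    by simp
  have inj: "inj_on f I"
  proof (rule inj_onI, rule ccontr)
    fix i j
    assume ij: "i \<in> I" "j \<in> I" "f i = f j" "i \<noteq> j"
    define c where "c l = (if l = i then 1 else if l = j then - 1 else 0 :: 'k)" for l
    have "(\<Sum>l\<in>I. c l *s f l) = (\<Sum>l\<in>{i, j}. c l *s f l)"
      by (rule sum.mono_neutral_right) (use ij in \<open>auto simp: c_def\<close>)
    also have "\<dots> = 0"
      using ij by (simp add: c_def)
    finally have "c i = 0"
      using ind ij by blast
    then show False
      by (simp add: c_def)
  qed
  have indep: "vec.independent (f ` I)"
  proof (rule ccontr)
    assume "\<not> vec.independent (f ` I)"
    then obtain c where c: "\<exists>v\<in>f ` I. c v \<noteq> 0" "(\<Sum>v\<in>f ` I. c v *s v) = 0"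
      using vec.dependent_finite [of "f ` I"] by auto
    from c(2) have "(\<Sum>i\<in>I. c (f i) *s f i) = 0"
      by (simp add: sum.reindex [OF inj])
    from ind [OF this] c(1) show False
      by auto
  qed
  define V where "V = f ` I \<union> range (\<lambda>a. axis a 1 :: 'k^5)"
  obtain B where B: "f ` I \<subseteq> B" "B \<subseteq> V" "vec.independent B" "V \<subseteq> vec.span B"
    using vec.maximal_independent_subset_extend [of "f ` I" V] indep unfolding V_def by blast
  have "v \<in> vec.span (range (\<lambda>a. axis a 1 :: 'k^5))" for v :: "'k^5"
  proof -
    have "v = (\<Sum>a\<in>UNIV. v $ a *s axis a 1)"
      by (simp add: vec_eq_iff axis_def if_distrib [where f = "\<lambda>x. _ * x"] cong: if_cong)
    also have "\<dots> \<in> vec.span (range (\<lambda>a. axis a 1 :: 'k^5))"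
      by (intro vec.span_sum vec.span_scale vec.span_base) auto
    finally show ?thesis .
  qed
  moreover have "vec.span (range (\<lambda>a. axis a 1 :: 'k^5)) \<subseteq> vec.span B"
    using B(4) by (intro vec.span_minimal) (auto simp: V_def)
  ultimately have span: "vec.span B = UNIV"
    by blast
  have cB: "card B = 5"
  proof -
    have "vec.dim (UNIV :: ('k^5) set) = card B"
      using vec.dim_eq_card [of B UNIV] B(3) span by simp
    then show ?thesis
      using vec_dim_card [where 'a = 'k and 'n = 5] by simp
  qed
  then have finB: "finite B"
    using card.infinite by fastforce
  have "card (- I) = card (B - f ` I)"
    using cB B(1) finB fin by (simp add: card_Diff_subset Compl_eq_Diff_UNIV card_image [OF inj])
  then obtain g where g: "bij_betw g (- I) (B - f ` I)"
    using finite_same_card_bij [of "- I" "B - f ` I"] finB by auto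
  define A where "A = (\<chi> i. if i \<in> I then f i else g i)"
  have "B \<subseteq> rows A"
  proof
    fix b
    assume b: "b \<in> B"
    show "b \<in> rows A"
    proof (cases "b \<in> f ` I")
      case True
      then obtain i where "i \<in> I" "b = f i"
        by blast
      then have "row i A = b"
        by (simp add: A_def row_def vec_eq_iff)
      then show ?thesis
        by (auto simp: rows_def)
    next
      case False
      then have "b \<in> g ` (- I)"
        using g b by (simp add: bij_betw_def)
      then obtain i where "i \<notin> I" "b = g i"
        by blast
      then have "row i A = b"
        by (simp add: A_def row_def vec_eq_iff)
      then show ?thesis
        by (auto simp: rows_def)
    qed
  qed
  then have "vec.span (rows A) = UNIV"
    using span vec.span_mono by blast
  then have "invertible A"
    using invertible_left_inverse matrix_left_invertible_span_rows_gen by blast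
  moreover have "\<exists>a. A $ i = axis a 1 \<and> axis a 1 \<notin> f ` I" if "i \<notin> I" for i
  proof -
    have "g i \<in> B - f ` I"
      using g that by (auto simp: bij_betw_def)
    moreover from this obtain a where "g i = axis a 1"
      using B(2) by (auto simp: V_def)
    ultimately show ?thesis
      using that by (auto simp: A_def)
  qed
  ultimately show ?thesis
    by (intro that [of A]) (simp_all add: A_def)
qed

definition indep2 :: "'k::field^5 \<Rightarrow> 'k^5 \<Rightarrow> bool" where
  "indep2 u w \<longleftrightarrow> (\<forall>a b. a *s u + b *s w = 0 \<longrightarrow> a = 0 \<and> b = 0)"

text \<open>
  The point \<open>p\<close> lies on the curve, and the three linear forms which cut out the tangent space at \<open>p\<close>
  satisfy the relation given by the bivector \<open>u \<and> w\<close> of the kernel of \<open>\<Phi>\<close> at \<open>p\<close>.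
\<close>

definition node :: "'k::field matrix_of_forms \<Rightarrow> 'k^5 \<Rightarrow> 'k^5 \<Rightarrow> 'k^5 \<Rightarrow> bool" where
  "node \<Phi> u w p \<longleftrightarrow> \<Phi> \<in> X5 UNIV \<and> indep2 u w \<and> p \<noteq> 0 \<and>
     (\<forall>x. tri \<Phi> u x p = 0) \<and> (\<forall>x. tri \<Phi> w x p = 0) \<and> (\<forall>x. tri \<Phi> u w x = 0)"

context pfaffian_invariant
begin

text \<open>
  At a generic model the infinitesimal symmetries span all normal directions except \<open>(3, 4, 0)\<close>. The
  model \<open>S\<close> is generic in this sense; comparing leading coefficients along the line from \<open>\<Phi>\<close> in the
  direction \<open>S\<close> extends the result to every \<open>\<Phi>\<close>.
\<close>

lemma partial_node0:
  fixes \<Phi> :: "'k matrix_of_forms"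
  assumes N: "node0 \<Phi>" and x: "x \<noteq> (3, 4, 0)"
  shows "eval5 (mpoly_partial x D) \<Phi> = 0"
proof (cases "x \<in> normal_coords")
  case False
  then show ?thesis
    by (rule partial_tangent_node0 [OF N])
next
  case True
  \<comment> \<open>The five entries make the ten equations triangular with pivots 1 or -1: eight of
    them contain a single unknown, and the last two contain one further unknown that is already
    solved.\<close>
  define S :: "'k matrix_of_forms" where
    "S = elem5 0 1 0 + elem5 2 4 1 + elem5 2 3 2 + elem5 0 4 3 + elem5 1 3 4"
  have S_X: "S \<in> X5 UNIV"
    unfolding S_def by (intro add_X5 elem5_X5) simp_all
  have N': "node0 (\<Phi> + scale5 u S)" for u
    using N S_X by (auto simp: node0_def S_def elem5_def intro!: add_X5 scale5_X5)
  define q where "q x = eval5 (mpoly_partial x D) (line5 \<Phi> S)" for x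
  have q: "poly (q x) u = eval5 (mpoly_partial x D) (\<Phi> + scale5 u S)" for x u
    by (simp add: q_def eval5_line5)
  have e1: "q (0,3,0) * [:\<Phi> $ 0 $ a $ 0, S $ 0 $ a $ 0:] + q (1,3,0) * [:\<Phi> $ 1 $ a $ 0, S $ 1 $ a $ 0:] +
      q (2,3,0) * [:\<Phi> $ 2 $ a $ 0, S $ 2 $ a $ 0:] + q (3,4,1) * [:\<Phi> $ a $ 4 $ 1, S $ a $ 4 $ 1:] +
      q (3,4,2) * [:\<Phi> $ a $ 4 $ 2, S $ a $ 4 $ 2:] + q (3,4,3) * [:\<Phi> $ a $ 4 $ 3, S $ a $ 4 $ 3:] +
      q (3,4,4) * [:\<Phi> $ a $ 4 $ 4, S $ a $ 4 $ 4:] = 0" if "a \<noteq> 3" "a \<noteq> 4" for a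
    by (rule poly_eqI) (use node0_equations(1) [OF N', of a] that in \<open>simp add: q del: mult_pCons_right\<close>)
  have e2: "q (0,4,0) * [:\<Phi> $ 0 $ a $ 0, S $ 0 $ a $ 0:] + q (1,4,0) * [:\<Phi> $ 1 $ a $ 0, S $ 1 $ a $ 0:] +
      q (2,4,0) * [:\<Phi> $ 2 $ a $ 0, S $ 2 $ a $ 0:] + q (3,4,1) * [:\<Phi> $ 3 $ a $ 1, S $ 3 $ a $ 1:] +
      q (3,4,2) * [:\<Phi> $ 3 $ a $ 2, S $ 3 $ a $ 2:] + q (3,4,3) * [:\<Phi> $ 3 $ a $ 3, S $ 3 $ a $ 3:] +
      q (3,4,4) * [:\<Phi> $ 3 $ a $ 4, S $ 3 $ a $ 4:] = 0" if "a \<noteq> 3" "a \<noteq> 4" for a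
    by (rule poly_eqI) (use node0_equations(2) [OF N', of a] that in \<open>simp add: q del: mult_pCons_right\<close>)
  have e3: "q (0,3,0) * [:\<Phi> $ 0 $ 3 $ k, S $ 0 $ 3 $ k:] + q (1,3,0) * [:\<Phi> $ 1 $ 3 $ k, S $ 1 $ 3 $ k:] +
      q (2,3,0) * [:\<Phi> $ 2 $ 3 $ k, S $ 2 $ 3 $ k:] + q (0,4,0) * [:\<Phi> $ 0 $ 4 $ k, S $ 0 $ 4 $ k:] +
      q (1,4,0) * [:\<Phi> $ 1 $ 4 $ k, S $ 1 $ 4 $ k:] + q (2,4,0) * [:\<Phi> $ 2 $ 4 $ k, S $ 2 $ 4 $ k:] = 0"
    if "k \<noteq> 0" for k
    by (rule poly_eqI) (use node0_equations(3) [OF N', of k] that in \<open>simp add: q del: mult_pCons_right\<close>)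
  define C where "C = normal_coords - {(3, 4, 0)}"
  have finC: "finite C"
    by simp
  \<comment> \<open>The coefficient of degree n + 1 in an equation combines the degree n + 1 part of
    \<open>q\<close> with \<Phi> and its degree n part with \<open>S\<close>. Once all coefficients
    of degree n + 1 vanish, the triangular system for \<open>S\<close> kills those of degree n, so
    the induction runs downwards from above all degrees.\<close>
  define Z where "Z n \<longleftrightarrow> (\<forall>x\<in>C. poly.coeff (q x) n = 0)" for n
  have step: "Z n" if "Z (Suc n)" for n
  proof -
    have c: "poly.coeff (q x) (Suc n) = 0" if "x \<in> C" for x
      using \<open>Z (Suc n)\<close> that by (simp add: Z_def)
    note c' = c [of "(0,3,0)"] c [of "(1,3,0)"] c [of "(2,3,0)"] c [of "(0,4,0)"] c [of "(1,4,0)"]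
      c [of "(2,4,0)"] c [of "(3,4,1)"] c [of "(3,4,2)"] c [of "(3,4,3)"] c [of "(3,4,4)"]
    note simps = c' C_def normal_coords_def coeff_mult_linear S_def elem5_def
    have s1: "poly.coeff (q (0,3,0)) n = 0"
      using arg_cong [OF e1 [of 1], of "\<lambda>p. poly.coeff p (Suc n)"] by (simp add: simps)
    have s2: "poly.coeff (q (3,4,1)) n = 0"
      using arg_cong [OF e1 [of 2], of "\<lambda>p. poly.coeff p (Suc n)"] by (simp add: simps)
    have s3: "poly.coeff (q (1,4,0)) n = 0"
      using arg_cong [OF e2 [of 0], of "\<lambda>p. poly.coeff p (Suc n)"] by (simp add: simps)
    have s4: "poly.coeff (q (3,4,2)) n = 0"
      using arg_cong [OF e2 [of 2], of "\<lambda>p. poly.coeff p (Suc n)"] by (simp add: simps)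
    have s5: "poly.coeff (q (2,4,0)) n = 0"
      using arg_cong [OF e3 [of 1], of "\<lambda>p. poly.coeff p (Suc n)"] by (simp add: simps)
    have s6: "poly.coeff (q (2,3,0)) n = 0"
      using arg_cong [OF e3 [of 2], of "\<lambda>p. poly.coeff p (Suc n)"] by (simp add: simps)
    have s7: "poly.coeff (q (0,4,0)) n = 0"
      using arg_cong [OF e3 [of 3], of "\<lambda>p. poly.coeff p (Suc n)"] by (simp add: simps)
    have s8: "poly.coeff (q (1,3,0)) n = 0"
      using arg_cong [OF e3 [of 4], of "\<lambda>p. poly.coeff p (Suc n)"] by (simp add: simps)
    have s9: "poly.coeff (q (3,4,3)) n = 0"
      using arg_cong [OF e1 [of 0], of "\<lambda>p. poly.coeff p (Suc n)"] s8 by (simp add: simps)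
    have s10: "poly.coeff (q (3,4,4)) n = 0"
      using arg_cong [OF e2 [of 1], of "\<lambda>p. poly.coeff p (Suc n)"] s7 by (simp add: simps)
    show "Z n"
      unfolding Z_def C_def normal_coords_def using s1 s2 s3 s4 s5 s6 s7 s8 s9 s10 by auto
  qed
  define M where "M = Max ((\<lambda>x. Polynomial.degree (q x)) ` C)"
  have "Z (Suc M)"
  proof -
    have "Polynomial.degree (q x) \<le> M" if "x \<in> C" for x
      unfolding M_def using that finC by simp
    then show ?thesis
      unfolding Z_def by (auto intro!: coeff_eq_0 simp: less_Suc_eq_le)
  qed
  then have "Z 0"
    using step by (rule inc_induct [OF le0])
  moreover have "x \<in> C"
    using True x by (simp add: C_def)
  ultimately have "poly (q x) 0 = 0"
    by (simp add: Z_def poly_0_coeff_0)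
  then show ?thesis
    by (simp add: q)
qed

text \<open>Taking \<open>u\<close>, \<open>w\<close> as rows 3 and 4 and \<open>p\<close> as the
  new e_0 puts the node in standard position. There only the derivative at (3, 4, 0) survives, and
  that entry of the transformed \<Psi> is \<open>tri \<Psi> u w p\<close>.\<close>

lemma node_vanishing:
  fixes \<Phi> \<Psi> :: "'k matrix_of_forms"
  assumes N: "node \<Phi> u w p"
  shows "eval5 D \<Phi> = 0" and "\<Psi> \<in> X5 UNIV \<Longrightarrow> tri \<Psi> u w p = 0 \<Longrightarrow> dir5 D \<Phi> \<Psi> = 0"
proof -
  have X: "\<Phi> \<in> X5 UNIV" and "indep2 u w" "p \<noteq> 0"
    and t: "\<And>x. tri \<Phi> u x p = 0" "\<And>x. tri \<Phi> w x p = 0" "\<And>x. tri \<Phi> u w x = 0"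
    using N by (auto simp: node_def)
  obtain A :: "'k^5^5" where A: "invertible A" "A $ 3 = u" "A $ 4 = w"
  proof (rule extend_to_invertible [where I = "{3, 4}" and f = "\<lambda>i. if i = 3 then u else w"])
    show "\<forall>i\<in>{3, 4 :: 5}. c i = 0" if "(\<Sum>i\<in>{3, 4}. c i *s (if i = 3 then u else w)) = 0" for c
      using that \<open>indep2 u w\<close> by (simp add: indep2_def)
  qed (use that in auto)
  obtain B :: "'k^5^5" where B: "invertible B" "B $ 0 = p"
  proof (rule extend_to_invertible [where I = "{0}" and f = "\<lambda>i. p"])
    show "\<forall>i\<in>{0 :: 5}. c i = 0" if "(\<Sum>i\<in>{0}. c i *s p) = 0" for c
      using that \<open>p \<noteq> 0\<close> by (simp add: vec.scale_eq_0_iff)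
  qed (use that in auto)
  have chi: "((det A)\<^sup>2 * det B) ^ 12 \<noteq> 0"
    using A(1) B(1) by (simp add: invertible_det_nz)
  have N0: "node0 (act5 A B \<Phi>)"
    by (simp add: node0_def act5_X5 X act5_nth A B t)
  show "eval5 D \<Phi> = 0"
    using vanish_node0 [OF N0] invariance [OF A(1) B(1) X] chi by simp
  show "dir5 D \<Phi> \<Psi> = 0" if \<Psi>: "\<Psi> \<in> X5 UNIV" "tri \<Psi> u w p = 0"
  proof -
    have "dir5 D (act5 A B \<Phi>) (act5 A B \<Psi>) = 0"
      using \<Psi>(2) by (simp add: dir5_node0 [OF N0] partial_node0 [OF N0] act5_nth A B)
    then show ?thesis
      using dir5_act5 [OF A(1) B(1) X \<Psi>(1)] chi by simp
  qed
qed

section \<open>Models where the invariant vanishes to order two\<close>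

definition flat :: "'k matrix_of_forms \<Rightarrow> bool" where
  "flat \<Phi> \<longleftrightarrow> \<Phi> \<in> X5 UNIV \<and> eval5 D \<Phi> = 0 \<and> (\<forall>\<Psi>\<in>X5 UNIV. dir5 D \<Phi> \<Psi> = 0)"

text \<open>The first node makes the derivative vanish on the hyperplane where
  \<open>tri \<Psi> u w p = 0\<close>, the second makes it vanish at \<Omega>, which lies outside
  this hyperplane.\<close>

lemma flat_if_two_nodes:
  assumes "node \<Phi> u w p" "node \<Phi> u' w' p'"
    and \<Omega>: "\<Omega> \<in> X5 UNIV" "tri \<Omega> u w p \<noteq> 0" "tri \<Omega> u' w' p' = 0"
  shows "flat \<Phi>"
  unfolding flat_def
proof (intro conjI ballI)
  show "\<Phi> \<in> X5 UNIV"
    using assms(1) by (simp add: node_def)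
  show "eval5 D \<Phi> = 0"
    using assms(1) by (rule node_vanishing)
  fix \<Psi> :: "'k matrix_of_forms"
  assume \<Psi>: "\<Psi> \<in> X5 UNIV"
  define c where "c = - tri \<Psi> u w p / tri \<Omega> u w p"
  have "dir5 D \<Phi> (\<Psi> + scale5 c \<Omega>) = 0"
  proof (rule node_vanishing [OF assms(1)])
    show "\<Psi> + scale5 c \<Omega> \<in> X5 UNIV"
      by (intro add_X5 scale5_X5 \<Psi> \<Omega>)
    show "tri (\<Psi> + scale5 c \<Omega>) u w p = 0"
      using \<Omega>(2) by (simp add: tri_model_add tri_model_scale c_def)
  qed
  moreover have "dir5 D \<Phi> \<Omega> = 0"
    using assms(2) \<Omega> by (intro node_vanishing(2))
  ultimately show "dir5 D \<Phi> \<Psi> = 0"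
    by (simp add: dir5_add dir5_scale)
qed

text \<open>Along the line, the value and each directional derivative are polynomials in the
  parameter; infinitely many roots force them to be zero.\<close>

lemma flat_closed:
  assumes "\<Phi> \<in> X5 UNIV" "infinite {u. flat (\<Phi> + scale5 u \<Psi>)}"
  shows "flat \<Phi>"
  unfolding flat_def
proof (intro conjI ballI)
  have "eval5 D (line5 \<Phi> \<Psi>) = 0"
    by (rule poly_eq_0I, rule infinite_super [OF _ assms(2)]) (auto simp: eval5_line5 flat_def)
  then show "eval5 D \<Phi> = 0"
    using eval5_line5 [of D \<Phi> \<Psi> 0] by simp
  fix \<Omega> :: "'k matrix_of_forms"
  assume \<Omega>: "\<Omega> \<in> X5 UNIV"
  define Q where "Q = (\<Sum>i\<in>UNIV. \<Sum>j\<in>UNIV. \<Sum>k\<in>UNIV. eval5 (mpoly_partial (i, j, k) D) (line5 \<Phi> \<Psi>) * [:\<Omega> $ i $ j $ k:])"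
  have Q: "poly Q u = dir5 D (\<Phi> + scale5 u \<Psi>) \<Omega>" for u
    by (simp add: Q_def poly_sum eval5_line5 dir5_def mult.commute)
  have "Q = 0"
    by (rule poly_eq_0I, rule infinite_super [OF _ assms(2)]) (auto simp: Q flat_def \<Omega>)
  then show "dir5 D \<Phi> \<Omega> = 0"
    using Q [of 0] by simp
qed (rule assms)

lemma flat_act5:
  assumes "flat (act5 A B \<Phi>)" "\<Phi> \<in> X5 UNIV" "invertible A" "invertible B"
  shows "flat \<Phi>"
proof -
  have chi: "((det A)\<^sup>2 * det B) ^ 12 \<noteq> 0"
    using assms by (simp add: invertible_det_nz)
  have "eval5 D \<Phi> = 0"
    using assms(1) invariance [OF assms(3,4,2)] chi by (simp add: flat_def)
  moreover have "dir5 D \<Phi> \<Psi> = 0" if "\<Psi> \<in> X5 UNIV" for \<Psi>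
  proof -
    have "dir5 D (act5 A B \<Phi>) (act5 A B \<Psi>) = 0"
      using assms(1) that by (simp add: flat_def act5_X5)
    then show ?thesis
      using dir5_act5 [OF assms(3,4,2) that] chi by simp
  qed
  ultimately show ?thesis
    using assms(2) by (simp add: flat_def)
qed

end

section \<open>Pencils of determinants\<close>

definition mat5 :: "'k^5 \<Rightarrow> 'k^5 \<Rightarrow> 'k^5 \<Rightarrow> 'k^5 \<Rightarrow> 'k^5 \<Rightarrow> 'k^5^5" where
  "mat5 a b c d e = (\<chi> i. if i = 0 then a else if i = 1 then b else if i = 2 then c else if i = 3 then d else e)"

lemma mat5_nth [simp]:
  "mat5 a b c d e $ 0 = a" "mat5 a b c d e $ 1 = b" "mat5 a b c d e $ 2 = c"
  "mat5 a b c d e $ 3 = d" "mat5 a b c d e $ 4 = e"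
  by (simp_all add: mat5_def)

lemma det_mat5_row3:
  fixes a :: "'k::comm_ring_1^5"
  shows "det (mat5 a b c (x *s d + y *s d') e) = x * det (mat5 a b c d e) + y * det (mat5 a b c d' e)"
proof -
  define R where "R i = (if i = 0 then a else if i = 1 then b else if i = 2 then c else e)" for i :: 5
  have M: "mat5 a b c f e = (\<chi> i. if i = 3 then f else R i)" for f
    by (auto simp: mat5_def R_def vec_eq_iff)
  show ?thesis
    unfolding M det_row_add det_row_mul ..
qed

lemma det_mat5_row4:
  fixes a :: "'k::comm_ring_1^5"
  shows "det (mat5 a b c d (x *s e + y *s e')) = x * det (mat5 a b c d e) + y * det (mat5 a b c d e')"
proof -
  define R where "R i = (if i = 0 then a else if i = 1 then b else if i = 2 then c else d)" for i :: 5
  have "\<forall>i :: 5. mat5 a b c d f $ i = (if i = 4 then f else R i)" for f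
    unfolding all_5 by (simp add: R_def)
  then have M: "mat5 a b c d f = (\<chi> i. if i = 4 then f else R i)" for f
    by (simp add: vec_eq_iff)
  show ?thesis
    unfolding M det_row_add det_row_mul ..
qed

lemma det_mat5_same: "det (mat5 a b c d d) = (0 :: 'k::comm_ring_1)"
  by (rule det_identical_rows [of 3 4]) (simp_all add: row_def)

lemma det_mat5_row3_0: "det (mat5 a b c 0 e) = (0 :: 'k::comm_ring_1)"
  using det_mat5_row3 [of a b c 0 0 0 0 e] by simp

lemma det_0_right_kernel:
  fixes M :: "'k::field^5^5"
  assumes "det M = 0"
  obtains p where "p \<noteq> 0" "\<And>i. (\<Sum>k\<in>UNIV. M $ i $ k * p $ k) = 0"
proof -
  have "\<not> invertible M"
    using assms by (simp add: invertible_det_nz)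
  then have "\<not> (\<forall>x. M *v x = 0 \<longrightarrow> x = 0)"
    by (simp add: invertible_left_inverse matrix_left_invertible_ker)
  then obtain p where "M *v p = 0" "p \<noteq> 0"
    by blast
  then show ?thesis
    by (intro that [of p]) (auto simp: matrix_vector_mult_def vec_eq_iff)
qed

lemma det_0_left_kernel:
  fixes M :: "'k::field^5^5"
  assumes "det M = 0"
  obtains c where "c \<noteq> 0" "\<And>k. (\<Sum>i\<in>UNIV. c $ i * M $ i $ k) = 0"
proof -
  have "det (transpose M) = 0"
    using assms by (simp add: det_transpose)
  then obtain c where "c \<noteq> 0" "\<And>i. (\<Sum>k\<in>UNIV. transpose M $ i $ k * c $ k) = 0"
    using det_0_right_kernel [of "transpose M"] by blast
  then show ?thesis
    by (intro that [of c]) (simp_all add: transpose_def mult.commute)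
qed

lemma poly_det: "poly (det M) t = det (\<chi> i j. poly (M $ i $ j) t)"
  for M :: "'k::comm_ring_1 poly^5^5"
  by (simp add: det_def poly_sum poly_prod of_int_poly)

lemma det_axis_square:
  fixes \<sigma> :: "5 \<Rightarrow> 5"
  assumes "inj \<sigma>"
  shows "(det ((\<chi> i. axis (\<sigma> i) 1) :: 'k::comm_ring_1^5^5))\<^sup>2 = 1"
proof -
  define M :: "'k^5^5" where "M = (\<chi> i. axis (\<sigma> i) 1)"
  have "M ** transpose M = mat 1"
    using assms by (simp add: M_def vec_eq_iff matrix_matrix_mult_def transpose_def sum_axis mat_def)
      (auto simp: axis_def inj_def)
  then have "det M * det (transpose M) = 1"
    by (metis det_mul det_I)
  then show ?thesis
    by (simp add: M_def det_transpose power2_eq_square)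
qed

text \<open>The determinant is a binary form A a^2 + B a b + C b^2. Replacing
  \<open>\<alpha>\<close> by \<open>\<alpha> + z *s \<beta>'\<close> adds z \<delta> to A and
  nothing to B and C, because \<open>d \<beta>' \<beta>' = 0\<close>. Instead of solving for a root,
  one prescribes it and solves for z.\<close>

lemma pencil_roots:
  fixes \<rho>0 \<rho>1 \<rho>2 \<alpha> \<beta> \<alpha>' \<beta>' :: "'k::field^5"
  defines "d \<equiv> \<lambda>x y. det (mat5 \<rho>0 \<rho>1 \<rho>2 x y)"
  assumes inf: "infinite (UNIV :: 'k set)"
    and \<delta>: "d \<beta>' \<alpha>' \<noteq> 0" and B: "d \<alpha> \<beta>' + d \<beta> \<alpha>' \<noteq> 0"
  shows "infinite {z. \<exists>a b a' b'. a * b' - a' * b \<noteq> 0 \<and>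
    d (a *s (\<alpha> + z *s \<beta>') + b *s \<beta>) (a *s \<alpha>' + b *s \<beta>') = 0 \<and>
    d (a' *s (\<alpha> + z *s \<beta>') + b' *s \<beta>) (a' *s \<alpha>' + b' *s \<beta>') = 0}" (is "infinite ?Z")
proof -
  define \<delta> where "\<delta> = d \<beta>' \<alpha>'"
  define A where "A = d \<alpha> \<alpha>'"
  define B where "B = d \<alpha> \<beta>' + d \<beta> \<alpha>'"
  define C where "C = d \<beta> \<beta>'"
  have nz: "\<delta> \<noteq> 0" "B \<noteq> 0"
    using assms by (simp_all add: \<delta>_def B_def)
  have q: "d (a *s (\<alpha> + z *s \<beta>') + b *s \<beta>) (a *s \<alpha>' + b *s \<beta>') =
      a * a * (A + z * \<delta>) + a * b * B + b * b * C" for a b z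
  proof -
    have "a *s (\<alpha> + z *s \<beta>') + b *s \<beta> = a *s (1 *s \<alpha> + z *s \<beta>') + b *s \<beta>"
      by simp
    then show ?thesis
      unfolding d_def A_def B_def C_def \<delta>_def
      by (simp only: det_mat5_row3 det_mat5_row4 det_mat5_same) (simp add: algebra_simps)
  qed
  \<comment> \<open>The value of the parameter for which (1 : \<tau>) is a root.\<close>
  define z where "z \<tau> = - (A + B * \<tau> + C * \<tau> * \<tau>) / \<delta>" for \<tau>
  \<comment> \<open>The condition that the two roots differ. Since B is nonzero it excludes only
    finitely many \<tau>, also in characteristic 2.\<close>
  define T where "T = {\<tau>. B + 2 * C * \<tau> \<noteq> 0}"
  have "infinite T"
  proof -
    have "- T = {\<tau>. poly [:B, 2 * C:] \<tau> = 0}"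
      by (auto simp: T_def algebra_simps)
    moreover have "finite \<dots>"
      using nz by (intro poly_roots_finite) simp
    ultimately show ?thesis
      using inf by (metis Compl_eq_Diff_UNIV finite_Diff2 Compl_UNIV_eq)
  qed
  have "z \<tau> \<in> ?Z" if "\<tau> \<in> T" for \<tau>
  proof -
    have e: "A + z \<tau> * \<delta> = - (B * \<tau> + C * \<tau> * \<tau>)"
      using nz by (simp add: z_def)
    show ?thesis
      unfolding mem_Collect_eq q e
    proof (intro exI conjI)
      \<comment> \<open>This fixes the witnesses by unification: the roots are (1 : \<tau>) and (C :
        -(B + C \<tau>)), the second obtained from the sum of the roots and valid for C = 0
        too.\<close>
      show "1 * - (B + C * \<tau>) - C * \<tau> \<noteq> 0"
      proof -
        have "1 * - (B + C * \<tau>) - C * \<tau> = - (B + 2 * C * \<tau>)"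
          by (simp add: algebra_simps)
        moreover have "- (B + 2 * C * \<tau>) \<noteq> 0"
          using that by (simp only: T_def mem_Collect_eq neg_equal_0_iff_equal not_False_eq_True)
        ultimately show ?thesis
          by (simp only: not_False_eq_True)
      qed
    qed (simp_all add: algebra_simps)
  qed
  moreover have "infinite (z ` T)"
  proof
    assume "finite (z ` T)"
    then obtain \<tau>0 where "infinite {\<tau> \<in> T. z \<tau> = z \<tau>0}"
      using pigeonhole_infinite [OF \<open>infinite T\<close>] by blast
    moreover have "{\<tau> \<in> T. z \<tau> = z \<tau>0} \<subseteq> {\<tau>. poly [:A + z \<tau>0 * \<delta>, B, C:] \<tau> = 0}"
    proof clarify
      fix \<tau>
      assume "z \<tau> = z \<tau>0"
      then have "A + z \<tau>0 * \<delta> = - (B * \<tau> + C * \<tau> * \<tau>)"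
        using nz by (simp add: z_def [of \<tau>] flip: \<open>z \<tau> = z \<tau>0\<close>)
      then show "poly [:A + z \<tau>0 * \<delta>, B, C:] \<tau> = 0"
        by (simp add: algebra_simps)
    qed
    moreover have "finite {\<tau>. poly [:A + z \<tau>0 * \<delta>, B, C:] \<tau> = 0}"
      using nz by (intro poly_roots_finite) simp
    ultimately show False
      using finite_subset by blast
  qed
  ultimately show ?thesis
    using infinite_super [of "z ` T" ?Z] by blast
qed

section \<open>Reducible curves\<close>

definition entry5 :: "5 \<Rightarrow> 5 \<Rightarrow> 'k::comm_ring_1^5 \<Rightarrow> 'k matrix_of_forms" where
  "entry5 i j \<xi> = (\<chi> a b. if a = i \<and> b = j then \<xi> else if a = j \<and> b = i then - \<xi> else 0)"

lemma entry5_X5: "i \<noteq> j \<Longrightarrow> entry5 i j \<xi> \<in> X5 UNIV"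
  by (rule X5_UNIV_I) (auto simp: entry5_def)

definition ev_form :: "'k::comm_ring_1 matrix_of_forms \<Rightarrow> 'k^5 \<Rightarrow> 5 \<Rightarrow> 5 \<Rightarrow> 'k" where
  "ev_form \<Phi> p i j = (\<Sum>k\<in>UNIV. p $ k * \<Phi> $ i $ j $ k)"

lemma tri_ev_form: "tri \<Phi> u w p = (\<Sum>i\<in>UNIV. u $ i * (\<Sum>j\<in>UNIV. w $ j * ev_form \<Phi> p i j))"
  by (simp add: tri_nested ev_form_def)

lemma ev_form_alt:
  assumes "\<Phi> \<in> X5 R"
  shows "ev_form \<Phi> p j i = - ev_form \<Phi> p i j" "ev_form \<Phi> p i i = 0"
  unfolding ev_form_def sum_negf [symmetric]
  by (intro sum.cong refl, simp add: X5_alt [OF assms, of j i], simp add: X5_diag [OF assms])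

lemma tri_elem5:
  assumes "i \<noteq> j"
  shows "tri (elem5 i j k) u w p = (u $ i * w $ j - u $ j * w $ i) * p $ k"
proof -
  have e: "ev_form (elem5 i j k) p a b = (if a = i \<and> b = j then p $ k else if a = j \<and> b = i then - p $ k else 0)"
    (is "_ = ?e a b") for a b
    by (simp add: ev_form_def elem5_def if_distrib [where f = "\<lambda>x. _ * x"] cong: if_cong)
  have "w $ b * ?e a b = (if b = j then (if a = i then w $ j * p $ k else 0) else 0) +
      (if b = i then (if a = j then - w $ i * p $ k else 0) else 0)" for a b
    using assms by auto
  then have "(\<Sum>b\<in>UNIV. w $ b * ?e a b) =
      (if a = i then w $ j * p $ k else 0) + (if a = j then - w $ i * p $ k else 0)" for a
    by (simp add: sum.distrib)
  then have "tri (elem5 i j k) u w p = (\<Sum>a\<in>UNIV. (if a = i then u $ i * (w $ j * p $ k) else 0) +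
      (if a = j then - u $ j * (w $ i * p $ k) else 0))"
    unfolding tri_ev_form e by (intro sum.cong refl) (auto simp: algebra_simps)
  then show ?thesis
    by (simp add: sum.distrib algebra_simps)
qed

context pfaffian_invariant
begin

text \<open>The product of the two quantities that \<open>pencil_roots\<close> requires to be
  nonzero, for the determinant in \<open>conic_node\<close>. It is defined over any ring so that it
  can be followed along a line of models.\<close>

definition conic_disc :: "'a::comm_ring_1 matrix_of_forms \<Rightarrow> 'a" where
  "conic_disc F = det (mat5 (F $ 0 $ 4) (F $ 1 $ 4) (F $ 2 $ 3) (F $ 1 $ 3) (F $ 1 $ 2)) *
    (det (mat5 (F $ 0 $ 4) (F $ 1 $ 4) (F $ 2 $ 3) (F $ 0 $ 2) (F $ 1 $ 3)) +
     det (mat5 (F $ 0 $ 4) (F $ 1 $ 4) (F $ 2 $ 3) (F $ 0 $ 3) (F $ 1 $ 2)))"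

text \<open>The conic lies in the plane where the entries (0, 4) and (1, 4) vanish. With kernel
  vectors a e_2 + b e_3 and e_4, the point must satisfy five linear equations: these two, entry (2,
  3), and the combination of columns 2 and 3 in rows 0 and 1. The determinant is the solvability
  condition.\<close>

lemma conic_node:
  fixes \<Phi> :: "'k matrix_of_forms"
  assumes X: "\<Phi> \<in> X5 UNIV" and z: "\<Phi> $ 2 $ 4 = 0" "\<Phi> $ 3 $ 4 = 0" and ab: "a \<noteq> 0 \<or> b \<noteq> 0"
    and d: "det (mat5 (\<Phi> $ 0 $ 4) (\<Phi> $ 1 $ 4) (\<Phi> $ 2 $ 3)
      (a *s \<Phi> $ 0 $ 2 + b *s \<Phi> $ 0 $ 3) (a *s \<Phi> $ 1 $ 2 + b *s \<Phi> $ 1 $ 3)) = 0"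
  obtains p where "node \<Phi> (a *s axis 2 1 + b *s axis 3 1) (axis 4 1) p"
proof -
  obtain p where p: "p \<noteq> 0" "\<And>i. (\<Sum>k\<in>UNIV. mat5 (\<Phi> $ 0 $ 4) (\<Phi> $ 1 $ 4) (\<Phi> $ 2 $ 3)
      (a *s \<Phi> $ 0 $ 2 + b *s \<Phi> $ 0 $ 3) (a *s \<Phi> $ 1 $ 2 + b *s \<Phi> $ 1 $ 3) $ i $ k * p $ k) = 0"
    using det_0_right_kernel [OF d] by blast
  have e: "ev_form \<Phi> p 0 4 = 0" "ev_form \<Phi> p 1 4 = 0" "ev_form \<Phi> p 2 3 = 0"
    "a * ev_form \<Phi> p 0 2 + b * ev_form \<Phi> p 0 3 = 0" "a * ev_form \<Phi> p 1 2 + b * ev_form \<Phi> p 1 3 = 0"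
    using p(2) [of 0] p(2) [of 1] p(2) [of 2] p(2) [of 3] p(2) [of 4]
    by (simp_all add: ev_form_def sum_distrib_left sum.distrib algebra_simps)
  have z': "ev_form \<Phi> x 2 4 = 0" "ev_form \<Phi> x 3 4 = 0" for x
    by (simp_all add: ev_form_def z)
  note alt = ev_form_alt(1) [OF X]
  note alts = alt [of _ 2 0] alt [of _ 2 1] alt [of _ 3 0] alt [of _ 3 1] alt [of _ 3 2] alt [of _ 4 0]
    alt [of _ 4 1] alt [of _ 4 2] alt [of _ 4 3] ev_form_alt(2) [OF X]
  show ?thesis
  proof (rule that [of p], unfold node_def, intro conjI allI X p(1))
    show "indep2 (a *s axis 2 1 + b *s axis 3 1) (axis 4 1 :: 'k^5)"
      using ab unfolding indep2_def by (auto simp: vec_eq_iff all_5 axis_def)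
    show "tri \<Phi> (a *s axis 2 1 + b *s axis 3 1) x p = 0" for x
    proof -
      have "tri \<Phi> (a *s axis 2 1 + b *s axis 3 1) x p =
        - x $ 0 * (a * ev_form \<Phi> p 0 2 + b * ev_form \<Phi> p 0 3) - x $ 1 * (a * ev_form \<Phi> p 1 2 + b * ev_form \<Phi> p 1 3)"
        by (simp add: tri_ev_form sum_5 axis_def alts e(1-3) z' algebra_simps)
      then show ?thesis
        by (simp add: e)
    qed
    show "tri \<Phi> (axis 4 1) x p = 0" for x
      by (simp add: tri_ev_form sum_5 axis_def alts e(1-3) z')
    show "tri \<Phi> (a *s axis 2 1 + b *s axis 3 1) (axis 4 1) x = 0" for x
      by (simp add: tri_ev_form sum_5 axis_def alts z')
  qed
qed

text \<open>
  The singular points on the conic correspond to the roots \<open>(a : b)\<close> of a binary quadratic form.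
  Adding \<open>z\<close> times entry \<open>(1, 3)\<close> to entry \<open>(0, 2)\<close> changes only its coefficient at \<open>a\<^sup>2\<close>, so that the
  roots become rational for infinitely many \<open>z\<close>.
\<close>

lemma flat_conic_generic:
  fixes \<Phi> :: "'k matrix_of_forms"
  assumes X: "\<Phi> \<in> X5 UNIV" and z: "\<Phi> $ 2 $ 4 = 0" "\<Phi> $ 3 $ 4 = 0" and g: "conic_disc \<Phi> \<noteq> 0"
  shows "flat \<Phi>"
proof (rule flat_closed [OF X, of "entry5 0 2 (\<Phi> $ 1 $ 3)"],
    rule infinite_super [OF _ pencil_roots [OF infinite_field,
    of "\<Phi> $ 0 $ 4" "\<Phi> $ 1 $ 4" "\<Phi> $ 2 $ 3" "\<Phi> $ 1 $ 3" "\<Phi> $ 1 $ 2" "\<Phi> $ 0 $ 2" "\<Phi> $ 0 $ 3"]],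
    clarify)
  fix z a b a' b' :: 'k
  define \<Phi>z where "\<Phi>z = \<Phi> + scale5 z (entry5 0 2 (\<Phi> $ 1 $ 3))"
  have Xz: "\<Phi>z \<in> X5 UNIV"
    unfolding \<Phi>z_def by (intro add_X5 scale5_X5 entry5_X5 X) simp
  have sc: "scale5 z (entry5 0 2 \<xi>) $ i $ j = (if i = 0 \<and> j = 2 then z *s \<xi> else if i = 2 \<and> j = 0 then - z *s \<xi> else 0)" for \<xi> :: "'k^5" and i j
    by (simp add: entry5_def vec_eq_iff)
  have e: "\<Phi>z $ 0 $ 4 = \<Phi> $ 0 $ 4" "\<Phi>z $ 1 $ 4 = \<Phi> $ 1 $ 4" "\<Phi>z $ 2 $ 3 = \<Phi> $ 2 $ 3" "\<Phi>z $ 1 $ 3 = \<Phi> $ 1 $ 3"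
    "\<Phi>z $ 1 $ 2 = \<Phi> $ 1 $ 2" "\<Phi>z $ 0 $ 3 = \<Phi> $ 0 $ 3" "\<Phi>z $ 2 $ 4 = 0" "\<Phi>z $ 3 $ 4 = 0"
    "\<Phi>z $ 0 $ 2 = \<Phi> $ 0 $ 2 + z *s \<Phi> $ 1 $ 3"
    by (simp_all add: \<Phi>z_def sc z)
  assume nz: "a * b' - a' * b \<noteq> 0"
    and "det (mat5 (\<Phi> $ 0 $ 4) (\<Phi> $ 1 $ 4) (\<Phi> $ 2 $ 3) (a *s (\<Phi> $ 0 $ 2 + z *s \<Phi> $ 1 $ 3) + b *s \<Phi> $ 0 $ 3)
        (a *s \<Phi> $ 1 $ 2 + b *s \<Phi> $ 1 $ 3)) = 0"
    and "det (mat5 (\<Phi> $ 0 $ 4) (\<Phi> $ 1 $ 4) (\<Phi> $ 2 $ 3) (a' *s (\<Phi> $ 0 $ 2 + z *s \<Phi> $ 1 $ 3) + b' *s \<Phi> $ 0 $ 3)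
        (a' *s \<Phi> $ 1 $ 2 + b' *s \<Phi> $ 1 $ 3)) = 0"
  moreover from nz have "a \<noteq> 0 \<or> b \<noteq> 0" "a' \<noteq> 0 \<or> b' \<noteq> 0"
    by auto
  ultimately obtain p p' where p: "node \<Phi>z (a *s axis 2 1 + b *s axis 3 1) (axis 4 1) p"
    and p': "node \<Phi>z (a' *s axis 2 1 + b' *s axis 3 1) (axis 4 1) p'"
    using conic_node [OF Xz, of a b] conic_node [OF Xz, of a' b'] unfolding e by metis
  then obtain k where "p $ k \<noteq> 0"
    by (auto simp: node_def vec_eq_iff)
  have "flat \<Phi>z"
  proof (rule flat_if_two_nodes [OF p p'])
    \<comment> \<open>On (a e_2 + b e_3, e_4; p) this direction takes the value (a b' - a' b) p_k,
      and it vanishes for (a', b'): it separates the two nodes because the roots are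
      distinct.\<close>
    show "scale5 b' (elem5 2 4 k) + scale5 (- a') (elem5 3 4 k) \<in> X5 UNIV"
      by (intro add_X5 scale5_X5 elem5_X5) simp_all
    show "tri (scale5 b' (elem5 2 4 k) + scale5 (- a') (elem5 3 4 k)) (a *s axis 2 1 + b *s axis 3 1) (axis 4 1) p \<noteq> 0"
      using nz \<open>p $ k \<noteq> 0\<close>
      by (simp add: tri_model_add tri_model_scale tri_elem5 axis_def flip: left_diff_distrib mult.assoc) (simp add: algebra_simps)
    show "tri (scale5 b' (elem5 2 4 k) + scale5 (- a') (elem5 3 4 k)) (a' *s axis 2 1 + b' *s axis 3 1) (axis 4 1) p' = 0"
      by (simp add: tri_model_add tri_model_scale tri_elem5 axis_def)
  qed
  then show "flat (\<Phi> + scale5 z (entry5 0 2 (\<Phi> $ 1 $ 3)))"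
    by (simp add: \<Phi>z_def)
qed (use g in \<open>auto simp: conic_disc_def\<close>)


lemma flat_if_generic:
  fixes P :: "'k poly"
  assumes "\<Phi> \<in> X5 UNIV" "P \<noteq> 0" "\<And>t. poly P t \<noteq> 0 \<Longrightarrow> flat (\<Phi> + scale5 t \<Psi>)"
  shows "flat \<Phi>"
proof (rule flat_closed [OF assms(1)])
  have "infinite (- {t. poly P t = 0})"
    using poly_roots_finite [OF assms(2)] infinite_field by (metis finite_compl double_compl)
  moreover have "- {t. poly P t = 0} \<subseteq> {t. flat (\<Phi> + scale5 t \<Psi>)}"
    using assms(3) by auto
  ultimately show "infinite {t. flat (\<Phi> + scale5 t \<Psi>)}"
    using infinite_super by blast
qed

lemma poly_det_mat5:
  "poly (det (mat5 a b c d e)) t = det (mat5 (\<chi> k. poly (a $ k) t) (\<chi> k. poly (b $ k) t)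
    (\<chi> k. poly (c $ k) t) (\<chi> k. poly (d $ k) t) (\<chi> k. poly (e $ k) (t :: 'k)))"
  unfolding poly_det by (rule arg_cong [where f = det]) (simp add: vec_eq_iff mat5_def)

lemma poly_line5_nth: "(\<chi> k. poly (line5 \<Phi> \<Psi> $ i $ j $ k) t) = (\<Phi> + scale5 (t :: 'k) \<Psi>) $ i $ j"
  by (simp add: vec_eq_iff line5_def)

lemma det_mat5_axis:
  assumes "distinct [a, b, c, d, e]"
  shows "det (mat5 (axis a 1) (axis b 1) (axis c 1) (axis d 1) (axis e (1 :: 'k))) \<noteq> 0"
proof -
  define \<sigma> where "\<sigma> i = (if i = 0 then a else if i = 1 then b else if i = 2 then c else if i = 3 then d else e)" for i :: 5
  have "inj \<sigma>"
    unfolding inj_def all_5 using assms by (auto simp: \<sigma>_def)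
  moreover have "mat5 (axis a 1) (axis b 1) (axis c 1) (axis d 1) (axis e (1 :: 'k)) = (\<chi> i. axis (\<sigma> i) 1)"
    by (auto simp: mat5_def \<sigma>_def vec_eq_iff)
  ultimately show ?thesis
    using det_axis_square [OF \<open>inj \<sigma>\<close>, where 'k = 'k] by auto
qed

lemma flat_conic:
  fixes \<Phi> :: "'k matrix_of_forms"
  assumes X: "\<Phi> \<in> X5 UNIV" and z: "\<Phi> $ 2 $ 4 = 0" "\<Phi> $ 3 $ 4 = 0"
  shows "flat \<Phi>"
proof -
  \<comment> \<open>In \<open>conic_disc S\<close> two determinants are permutation determinants,
    and the third is zero because entry (0, 3) is zero. The required zero entries persist along the
    line through \<open>S\<close>, so the generic case applies at almost all of its points.\<close>
  define S :: "'k matrix_of_forms" where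
    "S = entry5 0 4 (axis 3 1) + entry5 1 4 (axis 4 1) + entry5 2 3 (axis 2 1) +
         entry5 1 3 (axis 0 1) + entry5 1 2 (axis 1 1) + entry5 0 2 (axis 1 1)"
  have S_X: "S \<in> X5 UNIV"
    unfolding S_def by (intro add_X5 entry5_X5) simp_all
  define P where "P = conic_disc (line5 \<Phi> (S - \<Phi>))"
  have P: "poly P t = conic_disc (\<Phi> + scale5 t (S - \<Phi>))" for t
    by (simp only: P_def conic_disc_def poly_mult poly_add poly_det_mat5 poly_line5_nth)
  have "conic_disc S \<noteq> 0"
    unfolding conic_disc_def S_def
    by (simp add: entry5_def det_mat5_row3_0) (intro conjI det_mat5_axis; simp)
  moreover have "\<Phi> + scale5 1 (S - \<Phi>) = S"
    by (simp add: vec_eq_iff)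
  ultimately have "P \<noteq> 0"
    using P [of 1] by auto
  then show ?thesis
  proof (rule flat_if_generic [OF X])
    fix t
    assume "poly P t \<noteq> 0"
    moreover have "(\<Phi> + scale5 t (S - \<Phi>)) $ 2 $ 4 = 0" "(\<Phi> + scale5 t (S - \<Phi>)) $ 3 $ 4 = 0"
      by (simp_all add: vec_eq_iff z S_def entry5_def)
    ultimately show "flat (\<Phi> + scale5 t (S - \<Phi>))"
      using X S_X by (intro flat_conic_generic add_X5 scale5_X5 diff_X5) (simp_all add: P)
  qed
qed

text \<open>As for \<open>conic_disc\<close>, the nonvanishing conditions of
  \<open>pencil_roots\<close>. The forms involved lack the first two variables on a
  \<open>line_model\<close>; the two basis rows pad a determinant of size 3 to size 5.\<close>

definition line_disc :: "'a::comm_ring_1 matrix_of_forms \<Rightarrow> 'a" where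
  "line_disc F = det (mat5 (axis 0 1) (axis 1 1) (F $ 3 $ 4) (F $ 2 $ 4) (F $ 2 $ 3)) *
    (det (mat5 (axis 0 1) (axis 1 1) (F $ 3 $ 4) (F $ 1 $ 3) (F $ 2 $ 4)) +
     det (mat5 (axis 0 1) (axis 1 1) (F $ 3 $ 4) (F $ 1 $ 4) (F $ 2 $ 3)))"

text \<open>The line is spanned by e_0 and e_1. Above the diagonal only the entries (0, 1) and (0,
  2) survive on it, and they share a row, so every Pfaffian vanishes on the line.\<close>

definition line_model :: "'k matrix_of_forms \<Rightarrow> bool" where
  "line_model \<Phi> \<longleftrightarrow> \<Phi> \<in> X5 UNIV \<and> (\<forall>k\<in>{0, 1}. \<Phi> $ 0 $ 3 $ k = 0 \<and> \<Phi> $ 0 $ 4 $ k = 0 \<and> \<Phi> $ 1 $ 2 $ k = 0 \<and>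
    \<Phi> $ 1 $ 3 $ k = 0 \<and> \<Phi> $ 1 $ 4 $ k = 0 \<and> \<Phi> $ 2 $ 3 $ k = 0 \<and> \<Phi> $ 2 $ 4 $ k = 0 \<and> \<Phi> $ 3 $ 4 $ k = 0)"

text \<open>All points of the line have e_3 and e_4 in the kernel, so w = a e_3 + b e_4 is available
  for any a, b. The left kernel vector \<open>c\<close> is a linear relation between entry (3, 4)
  and the pairings of rows 1 and 2 with w; it dictates a \<open>u\<close> for which the form
  \<Phi>(u, w; x) is identically zero.\<close>

lemma line_node:
  fixes \<Phi> :: "'k matrix_of_forms"
  assumes L: "line_model \<Phi>" and nz: "\<Phi> $ 3 $ 4 \<noteq> 0" and ab: "a \<noteq> 0 \<or> b \<noteq> 0"
    and d: "det (mat5 (axis 0 1) (axis 1 1) (\<Phi> $ 3 $ 4)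
      (a *s \<Phi> $ 1 $ 3 + b *s \<Phi> $ 1 $ 4) (a *s \<Phi> $ 2 $ 3 + b *s \<Phi> $ 2 $ 4)) = 0"
  obtains u p where "node \<Phi> u (a *s axis 3 1 + b *s axis 4 1) p" "u $ 1 \<noteq> 0 \<or> u $ 2 \<noteq> 0"
proof -
  have X: "\<Phi> \<in> X5 UNIV"
    using L by (simp add: line_model_def)
  obtain c where c: "c \<noteq> 0" "\<And>k. (\<Sum>i\<in>UNIV. c $ i * mat5 (axis 0 1) (axis 1 1) (\<Phi> $ 3 $ 4)
      (a *s \<Phi> $ 1 $ 3 + b *s \<Phi> $ 1 $ 4) (a *s \<Phi> $ 2 $ 3 + b *s \<Phi> $ 2 $ 4) $ i $ k) = 0"
    using det_0_left_kernel [OF d] by blast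
  have rel0: "c $ 0 * axis 0 1 $ k + c $ 1 * axis 1 1 $ k + c $ 2 * \<Phi> $ 3 $ 4 $ k +
      c $ 3 * (a * \<Phi> $ 1 $ 3 $ k + b * \<Phi> $ 1 $ 4 $ k) + c $ 4 * (a * \<Phi> $ 2 $ 3 $ k + b * \<Phi> $ 2 $ 4 $ k) = 0" for k
    using c(2) [of k] by (simp add: sum_5)
  have c01: "c $ 0 = 0" "c $ 1 = 0"
    using rel0 [of 0] rel0 [of 1] L by (simp_all add: line_model_def axis_def)
  have rel: "c $ 2 * \<Phi> $ 3 $ 4 $ k + c $ 3 * (a * \<Phi> $ 1 $ 3 $ k + b * \<Phi> $ 1 $ 4 $ k) +
      c $ 4 * (a * \<Phi> $ 2 $ 3 $ k + b * \<Phi> $ 2 $ 4 $ k) = 0" for k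
    using rel0 [of k] by (simp add: c01)
  have c34: "c $ 3 \<noteq> 0 \<or> c $ 4 \<noteq> 0"
  proof (rule ccontr)
    assume "\<not> (c $ 3 \<noteq> 0 \<or> c $ 4 \<noteq> 0)"
    then have "c $ 3 = 0" "c $ 4 = 0"
      by auto
    then have "c $ 2 = 0"
      using rel nz by (auto simp: vec_eq_iff)
    then have "c = 0"
      using c01 \<open>c $ 3 = 0\<close> \<open>c $ 4 = 0\<close> by (simp add: vec_eq_iff all_5)
    then show False
      using c(1) by simp
  qed
  \<comment> \<open>Pairing f e_3 + g e_4 with w gives (f b - g a) times entry (3, 4), so this
    normalisation reproduces the coefficient \<open>c $ 2\<close> of the relation.\<close>
  obtain f g where fg: "f * b - g * a = 1"
  proof (cases "a = 0")
    case True
    then show ?thesis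
      using ab by (intro that [of "1 / b" 0]) simp
  next
    case False
    then show ?thesis
      by (intro that [of 0 "- 1 / a"]) simp
  qed
  define u where "u = c $ 3 *s axis 1 1 + c $ 4 *s axis 2 1 + (c $ 2 * f) *s axis 3 1 + (c $ 2 * g) *s (axis 4 1 :: 'k^5)"
  have u: "u $ 0 = 0" "u $ 1 = c $ 3" "u $ 2 = c $ 4" "u $ 3 = c $ 2 * f" "u $ 4 = c $ 2 * g"
    by (simp_all add: u_def axis_def)
  define m where "m k = c $ 3 * \<Phi> $ 0 $ 1 $ k + c $ 4 * \<Phi> $ 0 $ 2 $ k" for k
  \<comment> \<open>On the line, \<open>u\<close> is in the kernel where one linear form in two
    variables vanishes; such a point always exists.\<close>
  obtain y0 y1 where y: "y0 \<noteq> 0 \<or> y1 \<noteq> 0" "y0 * m 0 + y1 * m 1 = 0"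
  proof (cases "m 0 = 0 \<and> m 1 = 0")
    case True
    then show ?thesis
      by (intro that [of 1 0]) simp_all
  next
    case False
    then show ?thesis
      by (intro that [of "m 1" "- m 0"]) auto
  qed
  define p where "p = y0 *s axis 0 1 + y1 *s (axis 1 1 :: 'k^5)"
  have p: "p $ 0 = y0" "p $ 1 = y1" "p $ 2 = 0" "p $ 3 = 0" "p $ 4 = 0"
    by (simp_all add: p_def axis_def)
  have ev: "ev_form \<Phi> p i j = y0 * \<Phi> $ i $ j $ 0 + y1 * \<Phi> $ i $ j $ 1" for i j
    by (simp add: ev_form_def sum_5 p)
  have e: "ev_form \<Phi> p 0 3 = 0" "ev_form \<Phi> p 0 4 = 0" "ev_form \<Phi> p 1 2 = 0" "ev_form \<Phi> p 1 3 = 0"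
    "ev_form \<Phi> p 1 4 = 0" "ev_form \<Phi> p 2 3 = 0" "ev_form \<Phi> p 2 4 = 0" "ev_form \<Phi> p 3 4 = 0"
    "c $ 3 * ev_form \<Phi> p 0 1 + c $ 4 * ev_form \<Phi> p 0 2 = 0"
    using L y(2) by (simp_all add: ev line_model_def m_def algebra_simps)
  have rel': "c $ 2 * ev_form \<Phi> x 3 4 + c $ 3 * (a * ev_form \<Phi> x 1 3 + b * ev_form \<Phi> x 1 4) +
      c $ 4 * (a * ev_form \<Phi> x 2 3 + b * ev_form \<Phi> x 2 4) = 0" for x
  proof -
    have "c $ 2 * ev_form \<Phi> x 3 4 + c $ 3 * (a * ev_form \<Phi> x 1 3 + b * ev_form \<Phi> x 1 4) +
      c $ 4 * (a * ev_form \<Phi> x 2 3 + b * ev_form \<Phi> x 2 4) =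
      (\<Sum>k\<in>UNIV. x $ k * (c $ 2 * \<Phi> $ 3 $ 4 $ k + c $ 3 * (a * \<Phi> $ 1 $ 3 $ k + b * \<Phi> $ 1 $ 4 $ k) +
      c $ 4 * (a * \<Phi> $ 2 $ 3 $ k + b * \<Phi> $ 2 $ 4 $ k)))"
      by (simp add: ev_form_def sum_distrib_left sum.distrib algebra_simps)
    then show ?thesis
      by (simp add: rel)
  qed
  note alt = ev_form_alt(1) [OF X]
  note alts = alt [of _ 1 0] alt [of _ 2 0] alt [of _ 2 1] alt [of _ 3 0] alt [of _ 3 1] alt [of _ 3 2] alt [of _ 4 0]
    alt [of _ 4 1] alt [of _ 4 2] alt [of _ 4 3] ev_form_alt(2) [OF X]
  show ?thesis
  proof (rule that [of u p], unfold node_def, intro conjI allI X)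
    show "indep2 u (a *s axis 3 1 + b *s axis 4 1)"
      unfolding indep2_def
    proof (intro allI impI)
      fix s t
      assume "s *s u + t *s (a *s axis 3 1 + b *s axis 4 1) = 0"
      then have st: "s * c $ 3 = 0" "s * c $ 4 = 0" "s * (c $ 2 * f) + t * a = 0" "s * (c $ 2 * g) + t * b = 0"
        by (auto simp: vec_eq_iff all_5 u axis_def)
      then have "s = 0"
        using c34 by auto
      then show "s = 0 \<and> t = 0"
        using st ab by auto
    qed
    show "p \<noteq> 0"
      using y(1) p(1,2) by (auto simp: vec_eq_iff)
    show "tri \<Phi> u x p = 0" for x
    proof -
      have "tri \<Phi> u x p = - x $ 0 * (c $ 3 * ev_form \<Phi> p 0 1 + c $ 4 * ev_form \<Phi> p 0 2)"
        by (simp add: tri_ev_form sum_5 u alts e(1-8) algebra_simps)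
      then show ?thesis
        by (simp add: e)
    qed
    show "tri \<Phi> (a *s axis 3 1 + b *s axis 4 1) x p = 0" for x
      by (simp add: tri_ev_form sum_5 axis_def alts e(1-8))
    show "tri \<Phi> u (a *s axis 3 1 + b *s axis 4 1) x = 0" for x
    proof -
      have "tri \<Phi> u (a *s axis 3 1 + b *s axis 4 1) x =
        c $ 2 * (f * b - g * a) * ev_form \<Phi> x 3 4 + c $ 3 * (a * ev_form \<Phi> x 1 3 + b * ev_form \<Phi> x 1 4) +
        c $ 4 * (a * ev_form \<Phi> x 2 3 + b * ev_form \<Phi> x 2 4)"
        by (simp add: tri_ev_form sum_5 axis_def u alts algebra_simps)
      then show ?thesis
        using rel' [of x] by (simp add: fg)
    qed
    show "u $ 1 \<noteq> 0 \<or> u $ 2 \<noteq> 0"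
      using c34 by (simp add: u)
  qed
qed

text \<open>The same perturbation as for the conic: adding z times entry (2, 4) to entry (1, 3)
  changes only the leading coefficient of the quadratic form and preserves
  \<open>line_model\<close>.\<close>

lemma flat_line_generic:
  fixes \<Phi> :: "'k matrix_of_forms"
  assumes L: "line_model \<Phi>" and g: "line_disc \<Phi> \<noteq> 0"
  shows "flat \<Phi>"
proof -
  have X: "\<Phi> \<in> X5 UNIV"
    using L by (simp add: line_model_def)
  have nz34: "\<Phi> $ 3 $ 4 \<noteq> 0"
  proof
    assume "\<Phi> $ 3 $ 4 = 0"
    then have "det (mat5 (axis 0 1) (axis 1 1) (\<Phi> $ 3 $ 4) (\<Phi> $ 2 $ 4) (\<Phi> $ 2 $ 3)) = 0"
      by (intro det_zero_row [of 2]) (simp add: row_def vec_eq_iff)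
    with g show False
      by (simp add: line_disc_def)
  qed
  show ?thesis
  proof (rule flat_closed [OF X, of "entry5 1 3 (\<Phi> $ 2 $ 4)"],
    rule infinite_super [OF _ pencil_roots [OF infinite_field,
    of "axis 0 1" "axis 1 1" "\<Phi> $ 3 $ 4" "\<Phi> $ 2 $ 4" "\<Phi> $ 2 $ 3" "\<Phi> $ 1 $ 3" "\<Phi> $ 1 $ 4"]],
    clarify)
    fix z a b a' b' :: 'k
    define \<Phi>z where "\<Phi>z = \<Phi> + scale5 z (entry5 1 3 (\<Phi> $ 2 $ 4))"
    have Xz: "\<Phi>z \<in> X5 UNIV"
      unfolding \<Phi>z_def by (intro add_X5 scale5_X5 entry5_X5 X) simp
    have sc: "scale5 z (entry5 1 3 \<xi>) $ i $ j = (if i = 1 \<and> j = 3 then z *s \<xi> else if i = 3 \<and> j = 1 then - z *s \<xi> else 0)"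
      for \<xi> :: "'k^5" and i j
      by (simp add: entry5_def vec_eq_iff)
    have e: "\<Phi>z $ 3 $ 4 = \<Phi> $ 3 $ 4" "\<Phi>z $ 2 $ 4 = \<Phi> $ 2 $ 4" "\<Phi>z $ 2 $ 3 = \<Phi> $ 2 $ 3" "\<Phi>z $ 1 $ 4 = \<Phi> $ 1 $ 4"
      "\<Phi>z $ 1 $ 3 = \<Phi> $ 1 $ 3 + z *s \<Phi> $ 2 $ 4"
      by (simp_all add: \<Phi>z_def sc)
    have Lz: "line_model \<Phi>z"
      using L Xz by (simp add: line_model_def \<Phi>z_def sc)
    assume nz: "a * b' - a' * b \<noteq> 0"
      and "det (mat5 (axis 0 1) (axis 1 1) (\<Phi> $ 3 $ 4) (a *s (\<Phi> $ 1 $ 3 + z *s \<Phi> $ 2 $ 4) + b *s \<Phi> $ 1 $ 4)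
          (a *s \<Phi> $ 2 $ 3 + b *s \<Phi> $ 2 $ 4)) = 0"
      and "det (mat5 (axis 0 1) (axis 1 1) (\<Phi> $ 3 $ 4) (a' *s (\<Phi> $ 1 $ 3 + z *s \<Phi> $ 2 $ 4) + b' *s \<Phi> $ 1 $ 4)
          (a' *s \<Phi> $ 2 $ 3 + b' *s \<Phi> $ 2 $ 4)) = 0"
    moreover from nz have "a \<noteq> 0 \<or> b \<noteq> 0" "a' \<noteq> 0 \<or> b' \<noteq> 0"
      by auto
    ultimately obtain u p u' p' where p: "node \<Phi>z u (a *s axis 3 1 + b *s axis 4 1) p" "u $ 1 \<noteq> 0 \<or> u $ 2 \<noteq> 0"
      and p': "node \<Phi>z u' (a' *s axis 3 1 + b' *s axis 4 1) p'"
      using line_node [OF Lz, of a b] line_node [OF Lz, of a' b'] nz34 unfolding e by metis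
    from p(1) obtain k where k: "p $ k \<noteq> 0"
      by (auto simp: node_def vec_eq_iff)
    \<comment> \<open>The vectors a e_3 + b e_4 have no coordinate \<open>m\<close>, so a direction
      supported at (m, 3) and (m, 4) sees \<open>u\<close> only through \<open>u $ m\<close>. It can
      then be made to vanish at the second node without controlling \<open>u'\<close>.\<close>
    from p(2) obtain m where m: "m = 1 \<or> m = 2" "u $ m \<noteq> 0"
      by blast
    then have m': "m \<noteq> 3" "m \<noteq> 4" "axis 3 (1::'k) $ m = 0" "axis 4 (1::'k) $ m = 0"
      by (auto simp: axis_def)
    have "flat \<Phi>z"
    proof (rule flat_if_two_nodes [OF p(1) p'])
      show "scale5 b' (elem5 m 3 k) + scale5 (- a') (elem5 m 4 k) \<in> X5 UNIV"
        using m' by (intro add_X5 scale5_X5 elem5_X5) simp_all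
      have "tri (scale5 b' (elem5 m 3 k) + scale5 (- a') (elem5 m 4 k)) u (a *s axis 3 1 + b *s axis 4 1) p =
          u $ m * (a * b' - a' * b) * p $ k"
        using m' by (simp add: tri_model_add tri_model_scale tri_elem5) (simp add: axis_def algebra_simps)
      then show "tri (scale5 b' (elem5 m 3 k) + scale5 (- a') (elem5 m 4 k)) u (a *s axis 3 1 + b *s axis 4 1) p \<noteq> 0"
        using nz k m by simp
      show "tri (scale5 b' (elem5 m 3 k) + scale5 (- a') (elem5 m 4 k)) u' (a' *s axis 3 1 + b' *s axis 4 1) p' = 0"
        using m' by (simp add: tri_model_add tri_model_scale tri_elem5) (simp add: axis_def)
    qed
    then show "flat (\<Phi> + scale5 z (entry5 1 3 (\<Phi> $ 2 $ 4)))"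
      by (simp add: \<Phi>z_def)
  qed (use g in \<open>auto simp: line_disc_def\<close>)
qed

lemma flat_line:
  fixes \<Phi> :: "'k matrix_of_forms"
  assumes L: "line_model \<Phi>"
  shows "flat \<Phi>"
proof -
  have X: "\<Phi> \<in> X5 UNIV"
    using L by (simp add: line_model_def)
  \<comment> \<open>Again two permutation determinants and one zero determinant, now from the zero
    entry (1, 4).\<close>
  define S :: "'k matrix_of_forms" where
    "S = entry5 3 4 (axis 2 1) + entry5 2 4 (axis 3 1) + entry5 2 3 (axis 4 1) + entry5 1 3 (axis 4 1)"
  have S_X: "S \<in> X5 UNIV"
    unfolding S_def by (intro add_X5 entry5_X5) simp_all
  define P where "P = line_disc (line5 \<Phi> (S - \<Phi>))"
  have ax: "(\<chi> k. poly (axis i 1 $ k) t) = axis i (1 :: 'k)" for i :: 5 and t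
    by (simp add: vec_eq_iff axis_def)
  have P: "poly P t = line_disc (\<Phi> + scale5 t (S - \<Phi>))" for t
    by (simp only: P_def line_disc_def poly_mult poly_add poly_det_mat5 poly_line5_nth ax)
  have "line_disc S \<noteq> 0"
    unfolding line_disc_def S_def
    by (simp add: entry5_def det_mat5_row3_0) (intro conjI det_mat5_axis; simp)
  moreover have "\<Phi> + scale5 1 (S - \<Phi>) = S"
    by (simp add: vec_eq_iff)
  ultimately have "P \<noteq> 0"
    using P [of 1] by auto
  then show ?thesis
  proof (rule flat_if_generic [OF X])
    fix t
    assume "poly P t \<noteq> 0"
    moreover have "\<Phi> + scale5 t (S - \<Phi>) \<in> X5 UNIV"
      using X S_X by (intro add_X5 scale5_X5 diff_X5)
    then have "line_model (\<Phi> + scale5 t (S - \<Phi>))"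
      using L by (simp add: line_model_def S_def entry5_def axis_def)
    ultimately show "flat (\<Phi> + scale5 t (S - \<Phi>))"
      by (intro flat_line_generic) (simp_all add: P)
  qed
qed

end

section \<open>Zero patterns that split off a conic or a line\<close>

definition app :: "'k::comm_ring_1^5 \<Rightarrow> 'k^5 \<Rightarrow> 'k" where
  "app l x = (\<Sum>i\<in>UNIV. l $ i * x $ i)"

lemma app_axis [simp]: "app (axis i 1) x = x $ i"
  by (simp add: app_def sum_axis)

lemma app_add: "app l (x + y) = app l x + app l y"
  by (simp add: app_def distrib_left sum.distrib)

lemma app_scale: "app l (c *s x) = c * app l x"
  by (simp add: app_def sum_distrib_left mult_ac)

lemma app_0 [simp]: "app l 0 = 0"
  by (simp add: app_def)

lemma common_zero:
  fixes l1 :: "'k::field^5"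
  obtains p where "p \<noteq> 0" "app l1 p = 0" "app l2 p = 0" "app l3 p = 0" "app l4 p = 0"
proof -
  have "det (mat5 l1 l2 l3 l4 0) = 0"
    by (intro det_zero_row [of 4]) (simp add: row_def vec_eq_iff)
  then obtain p where "p \<noteq> 0" "\<And>i. (\<Sum>k\<in>UNIV. mat5 l1 l2 l3 l4 0 $ i $ k * p $ k) = 0"
    using det_0_right_kernel by blast
  from this(1) this(2) [of 0] this(2) [of 1] this(2) [of 2] this(2) [of 3] show ?thesis
    by (intro that [of p]) (simp_all add: app_def)
qed

lemma indep2_if_zero:
  assumes "p $ m \<noteq> 0" "q $ m = 0" "q \<noteq> 0"
  shows "indep2 p q"
  unfolding indep2_def
proof (intro allI impI)
  fix a b
  assume e: "a *s p + b *s q = 0"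
  then have "(a *s p + b *s q) $ m = 0"
    by simp
  then have "a = 0"
    using assms by simp
  then show "a = 0 \<and> b = 0"
    using e assms(3) by (simp add: vec.scale_eq_0_iff)
qed

lemma common_zeros:
  fixes l1 :: "'k::field^5"
  obtains p q where "indep2 p q" "app l1 p = 0" "app l2 p = 0" "app l3 p = 0"
    "app l1 q = 0" "app l2 q = 0" "app l3 q = 0"
proof -
  obtain p where p: "p \<noteq> 0" "app l1 p = 0" "app l2 p = 0" "app l3 p = 0"
    using common_zero [of l1 l2 l3 0] by blast
  then obtain m where "p $ m \<noteq> 0"
    by (auto simp: vec_eq_iff)
  obtain q where "q \<noteq> 0" "app l1 q = 0" "app l2 q = 0" "app l3 q = 0" "app (axis m 1) q = 0"
    using common_zero [of l1 l2 l3 "axis m 1"] by blast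
  then show ?thesis
    using p \<open>p $ m \<noteq> 0\<close> by (intro that [of p q] indep2_if_zero [of p m q]) simp_all
qed

lemma act5_id_left: "act5 (mat 1) B \<Phi> $ i $ j $ k = tri \<Phi> (axis i 1) (axis j 1) (B $ k)"
  by (simp add: act5_nth mat_1_nth)

lemma act5_id_right: "act5 A (mat 1) \<Phi> $ i $ j $ k = tri \<Phi> (A $ i) (A $ j) (axis k 1)"
  by (simp add: act5_nth mat_1_nth)

lemma tri_axis_right: "tri \<Phi> u w (axis k 1) = (\<Sum>i\<in>UNIV. u $ i * (\<Sum>j\<in>UNIV. w $ j * \<Phi> $ i $ j $ k))"
  by (simp add: tri_nested sum_axis)

lemma tri_axis_mid: "tri \<Phi> u (axis j 1) p = (\<Sum>i\<in>UNIV. u $ i * (\<Sum>k\<in>UNIV. p $ k * \<Phi> $ i $ j $ k))"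
  by (simp add: tri_nested sum_axis)

lemma tri_axis_left: "tri \<Phi> (axis i 1) w p = (\<Sum>j\<in>UNIV. w $ j * (\<Sum>k\<in>UNIV. p $ k * \<Phi> $ i $ j $ k))"
  by (simp add: tri_nested sum_axis)

context pfaffian_invariant
begin

text \<open>Three linear conditions leave two independent vectors; since \<open>l1\<close> is
  nonzero at \<open>w\<close>, they are also independent of \<open>w\<close>. As rows 2 and 3, with
  \<open>w\<close> as row 4, they produce the zero entries of \<open>flat_conic\<close>.\<close>

lemma flat_conic_kernel:
  fixes \<Phi> :: "'k matrix_of_forms"
  assumes X: "\<Phi> \<in> X5 UNIV" and w: "app l1 w \<noteq> 0"
    and ker: "\<And>z x. app l1 z = 0 \<Longrightarrow> app l2 z = 0 \<Longrightarrow> app l3 z = 0 \<Longrightarrow> tri \<Phi> z w x = 0"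
  shows "flat \<Phi>"
proof -
  obtain z1 z2 where z: "indep2 z1 z2" "app l1 z1 = 0" "app l2 z1 = 0" "app l3 z1 = 0"
    "app l1 z2 = 0" "app l2 z2 = 0" "app l3 z2 = 0"
    using common_zeros by blast
  define f where "f i = (if i = 2 then z1 else if i = 3 then z2 else w)" for i :: 5
  obtain A :: "'k^5^5" where A: "invertible A" "\<And>i. i \<in> {2, 3, 4} \<Longrightarrow> A $ i = f i"
  proof (rule extend_to_invertible [where I = "{2, 3, 4}" and f = f])
    show "\<forall>i\<in>{2, 3, 4}. c i = 0" if "(\<Sum>i\<in>{2, 3, 4}. c i *s f i) = 0" for c
    proof -
      have c: "c 2 *s z1 + (c 3 *s z2 + c 4 *s w) = 0"
        using that by (simp add: f_def)
      then have "app l1 (c 2 *s z1 + (c 3 *s z2 + c 4 *s w)) = 0"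
        by simp
      then have "c 4 = 0"
        using z w by (simp add: app_add app_scale)
      with c z(1) show ?thesis
        by (simp add: indep2_def)
    qed
  qed (use that in auto)
  have "act5 A (mat 1) \<Phi> $ 2 $ 4 = 0" "act5 A (mat 1) \<Phi> $ 3 $ 4 = 0"
    using z ker by (simp_all add: vec_eq_iff act5_nth A f_def)
  then have "flat (act5 A (mat 1) \<Phi>)"
    by (intro flat_conic act5_X5 X)
  then show ?thesis
    using X A(1) invertible_one by (rule flat_act5)
qed

text \<open>Pairing with e_4 gives a form in x_3 and x_4 alone, so two conditions on
  \<open>z\<close> kill it; the third keeps \<open>z\<close> away from e_4.\<close>

lemma flat_column_two_variables:
  fixes \<Phi> :: "'k matrix_of_forms"
  assumes X: "\<Phi> \<in> X5 UNIV" and z: "\<And>i k. k \<in> {0, 1, 2} \<Longrightarrow> \<Phi> $ i $ 4 $ k = 0"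
  shows "flat \<Phi>"
proof (rule flat_conic_kernel [OF X, of "axis 4 1" "axis 4 1" "\<chi> i. \<Phi> $ i $ 4 $ 3" "\<chi> i. \<Phi> $ i $ 4 $ 4"])
  fix y x :: "'k^5"
  assume "app (\<chi> i. \<Phi> $ i $ 4 $ 3) y = 0" "app (\<chi> i. \<Phi> $ i $ 4 $ 4) y = 0"
  moreover have "tri \<Phi> y (axis 4 1) x = x $ 3 * app (\<chi> i. \<Phi> $ i $ 4 $ 3) y + x $ 4 * app (\<chi> i. \<Phi> $ i $ 4 $ 4) y"
    by (simp add: tri_axis_mid app_def sum_5 z algebra_simps)
  ultimately show "tri \<Phi> y (axis 4 1) x = 0"
    by simp
qed simp

lemma flat_column_one_variable:
  fixes \<Phi> :: "'k matrix_of_forms"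
  assumes X: "\<Phi> \<in> X5 UNIV" and z: "\<And>i k. i \<in> {1, 2, 3} \<Longrightarrow> k \<in> {0, 1, 2, 3} \<Longrightarrow> \<Phi> $ i $ 4 $ k = 0"
  shows "flat \<Phi>"
proof (rule flat_conic_kernel [OF X, of "axis 4 1" "axis 4 1" "axis 0 1" "\<chi> i. \<Phi> $ i $ 4 $ 4"])
  fix y x :: "'k^5"
  assume y: "app (axis 4 1) y = 0" "app (axis 0 1) y = 0" "app (\<chi> i. \<Phi> $ i $ 4 $ 4) y = 0"
  from y have "y $ 4 = 0" "y $ 0 = 0"
    by simp_all
  then have "tri \<Phi> y (axis 4 1) x = x $ 4 * app (\<chi> i. \<Phi> $ i $ 4 $ 4) y"
    by (simp add: tri_axis_mid app_def sum_5 z algebra_simps)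
  with y(3) show "tri \<Phi> y (axis 4 1) x = 0"
    by simp
qed simp

text \<open>The block is x_4 times a constant alternating matrix of odd size 3, hence singular. Its
  kernel vector (m_34, -m_24, m_23) serves as \<open>w\<close>, unless the block is zero and any
  vector will do.\<close>

lemma flat_block_one_variable:
  fixes \<Phi> :: "'k matrix_of_forms"
  assumes X: "\<Phi> \<in> X5 UNIV" and z: "\<And>i j k. i \<in> {2, 3, 4} \<Longrightarrow> j \<in> {2, 3, 4} \<Longrightarrow> k \<in> {0, 1, 2, 3} \<Longrightarrow> \<Phi> $ i $ j $ k = 0"
  shows "flat \<Phi>"
proof -
  define m where "m i j = \<Phi> $ i $ j $ 4" for i j
  have m: "m i i = 0" "m 3 2 = - m 2 3" "m 4 2 = - m 2 4" "m 4 3 = - m 3 4" for i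
    by (simp_all add: m_def X5_diag [OF X] X5_alt [OF X, of 3 2] X5_alt [OF X, of 4 2] X5_alt [OF X, of 4 3])
  obtain w :: "'k^5" where w: "w \<noteq> 0" "w $ 0 = 0" "w $ 1 = 0" "m 2 3 * w $ 3 + m 2 4 * w $ 4 = 0"
    "- m 2 3 * w $ 2 + m 3 4 * w $ 4 = 0" "- m 2 4 * w $ 2 - m 3 4 * w $ 3 = 0"
  proof (cases "m 2 3 = 0 \<and> m 2 4 = 0 \<and> m 3 4 = 0")
    case True
    then show ?thesis
      by (intro that [of "axis 4 1"]) (simp_all add: axis_def vec_eq_iff)
  next
    case False
    then show ?thesis
      by (intro that [of "m 3 4 *s axis 2 1 - m 2 4 *s axis 3 1 + m 2 3 *s axis 4 1"])
        (auto simp: axis_def vec_eq_iff all_5)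
  qed
  obtain n where n: "w $ n \<noteq> 0"
    using w(1) by (auto simp: vec_eq_iff)
  show ?thesis
  proof (rule flat_conic_kernel [OF X, of "axis n 1" w "axis 0 1" "axis 1 1"])
    fix y x :: "'k^5"
    assume y: "app (axis 0 1) y = 0" "app (axis 1 1) y = 0"
    have "tri \<Phi> y w x = x $ 4 * (y $ 2 * (m 2 3 * w $ 3 + m 2 4 * w $ 4) +
        y $ 3 * (- m 2 3 * w $ 2 + m 3 4 * w $ 4) + y $ 4 * (- m 2 4 * w $ 2 - m 3 4 * w $ 3))"
      using y m by (simp add: tri_nested sum_5 z w(2,3) m_def algebra_simps)
    then show "tri \<Phi> y w x = 0"
      by (simp only: w) simp
  qed (simp add: n)
qed

text \<open>On the line only the block of rows 0, 1, 2 matters. Its value at e_0 is alternating of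
  size 3 and has a kernel vector \<open>f1\<close>; pairing with \<open>f1\<close> at e_1 is one
  linear condition, met by an independent \<open>f2\<close> in the block. With them as rows 1 and 2
  the model becomes a \<open>line_model\<close>.\<close>

lemma flat_line_last_rows:
  fixes \<Phi> :: "'k matrix_of_forms"
  assumes X: "\<Phi> \<in> X5 UNIV" and z: "\<And>i j k. j \<in> {3, 4} \<Longrightarrow> k \<in> {0, 1} \<Longrightarrow> \<Phi> $ i $ j $ k = 0"
  shows "flat \<Phi>"
proof -
  define m where "m i j = \<Phi> $ i $ j $ 0" for i j
  have m: "m i i = 0" "m 1 0 = - m 0 1" "m 2 0 = - m 0 2" "m 2 1 = - m 1 2" for i
    by (simp_all add: m_def X5_diag [OF X] X5_alt [OF X, of 1 0] X5_alt [OF X, of 2 0] X5_alt [OF X, of 2 1])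
  obtain f1 :: "'k^5" where f1: "f1 \<noteq> 0" "f1 $ 3 = 0" "f1 $ 4 = 0" "m 0 1 * f1 $ 1 + m 0 2 * f1 $ 2 = 0"
    "- m 0 1 * f1 $ 0 + m 1 2 * f1 $ 2 = 0" "- m 0 2 * f1 $ 0 - m 1 2 * f1 $ 1 = 0"
  proof (cases "m 0 1 = 0 \<and> m 0 2 = 0 \<and> m 1 2 = 0")
    case True
    then show ?thesis
      by (intro that [of "axis 0 1"]) (simp_all add: axis_def vec_eq_iff)
  next
    case False
    then show ?thesis
      by (intro that [of "m 1 2 *s axis 0 1 - m 0 2 *s axis 1 1 + m 0 1 *s axis 2 1"])
        (auto simp: axis_def vec_eq_iff all_5)
  qed
  obtain n where n: "f1 $ n \<noteq> 0"
    using f1(1) by (auto simp: vec_eq_iff)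
  define l where "l = (\<chi> i. tri \<Phi> (axis i 1) f1 (axis 1 1))"
  obtain f2 where f2: "f2 \<noteq> 0" "f2 $ 3 = 0" "f2 $ 4 = 0" "app l f2 = 0" "f2 $ n = 0"
    using common_zero [of "axis 3 1" "axis 4 1" l "axis n 1"] unfolding app_axis by blast
  have ind: "indep2 f1 f2"
    using n f2 by (intro indep2_if_zero)
  have t0: "tri \<Phi> f1 f2 (axis 0 1) = 0"
  proof -
    have "tri \<Phi> f2 f1 (axis 0 1) = f2 $ 0 * (m 0 1 * f1 $ 1 + m 0 2 * f1 $ 2) +
        f2 $ 1 * (- m 0 1 * f1 $ 0 + m 1 2 * f1 $ 2) + f2 $ 2 * (- m 0 2 * f1 $ 0 - m 1 2 * f1 $ 1)"
      using m by (simp add: tri_axis_right sum_5 f1(2,3) f2(2,3) m_def algebra_simps)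
    also have "\<dots> = 0"
      by (simp only: f1) simp
    finally show ?thesis
      using tri_alt(1) [OF X, of f2 f1 "axis 0 1"] by simp
  qed
  have t1: "tri \<Phi> f1 f2 (axis 1 1) = 0"
  proof -
    have "tri \<Phi> f2 f1 (axis 1 1) = app l f2"
      by (simp add: l_def app_def tri_axis_right sum_axis mult.commute)
    then show ?thesis
      using f2(4) tri_alt(1) [OF X, of f2 f1 "axis 1 1"] by simp
  qed
  define f where "f i = (if i = 1 then f1 else if i = 2 then f2 else axis i 1)" for i :: 5
  obtain A :: "'k^5^5" where A: "invertible A" "\<And>i. i \<in> {1, 2, 3, 4} \<Longrightarrow> A $ i = f i"
  proof (rule extend_to_invertible [where I = "{1, 2, 3, 4}" and f = f])
    show "\<forall>i\<in>{1, 2, 3, 4}. c i = 0" if "(\<Sum>i\<in>{1, 2, 3, 4}. c i *s f i) = 0" for c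
    proof -
      have c: "c 1 *s f1 + (c 2 *s f2 + (c 3 *s axis 3 1 + c 4 *s axis 4 1)) = 0"
        using that by (simp add: f_def)
      then have "(c 1 *s f1 + (c 2 *s f2 + (c 3 *s axis 3 1 + c 4 *s axis 4 1))) $ i = 0" for i
        by simp
      from this [of 3] this [of 4] have "c 3 = 0" "c 4 = 0"
        using f1 f2 by (simp_all add: axis_def)
      with c ind show ?thesis
        by (simp add: indep2_def)
    qed
  qed (use that in auto)
  have t34: "tri \<Phi> u (axis j 1) (axis k 1) = 0" if "j \<in> {3, 4}" "k \<in> {0, 1}" for u j k
    using z [OF that] by (simp add: tri_axis_right sum_axis)
  have "line_model (act5 A (mat 1) \<Phi>)"
    unfolding line_model_def
    by (intro conjI act5_X5 X) (auto simp: act5_id_right A f_def t34 t0 t1)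
  then have "flat (act5 A (mat 1) \<Phi>)"
    by (rule flat_line)
  then show ?thesis
    using X A(1) invertible_one by (rule flat_act5)
qed

text \<open>Within z_0 = 0, pairing with e_0 at the two points e_0 and e_1 imposes two conditions on
  a space of dimension 4. Two independent solutions become rows 3 and 4.\<close>

lemma flat_line_first_row:
  fixes \<Phi> :: "'k matrix_of_forms"
  assumes X: "\<Phi> \<in> X5 UNIV" and z: "\<And>i j k. i \<noteq> 0 \<Longrightarrow> j \<noteq> 0 \<Longrightarrow> k \<in> {0, 1} \<Longrightarrow> \<Phi> $ i $ j $ k = 0"
  shows "flat \<Phi>"
proof -
  obtain f3 f4 where f: "indep2 f3 f4" "f3 $ 0 = 0" "f4 $ 0 = 0"
    "app (\<chi> j. \<Phi> $ 0 $ j $ 0) f3 = 0" "app (\<chi> j. \<Phi> $ 0 $ j $ 1) f3 = 0"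
    "app (\<chi> j. \<Phi> $ 0 $ j $ 0) f4 = 0" "app (\<chi> j. \<Phi> $ 0 $ j $ 1) f4 = 0"
    using common_zeros [of "axis 0 1" "\<chi> j. \<Phi> $ 0 $ j $ 0" "\<chi> j. \<Phi> $ 0 $ j $ 1"]
    unfolding app_axis by blast
  define f where "f i = (if i = 3 then f3 else if i = 4 then f4 else axis i 1)" for i :: 5
  obtain A :: "'k^5^5" where A: "invertible A" "\<And>i. i \<in> {0, 3, 4} \<Longrightarrow> A $ i = f i"
    "\<And>i. i \<notin> {0, 3, 4} \<Longrightarrow> \<exists>a. A $ i = axis a 1 \<and> axis a 1 \<notin> f ` {0, 3, 4}"
  proof (rule extend_to_invertible [where I = "{0, 3, 4}" and f = f])
    show "\<forall>i\<in>{0, 3, 4}. c i = 0" if "(\<Sum>i\<in>{0, 3, 4}. c i *s f i) = 0" for c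
    proof -
      have c: "c 0 *s axis 0 1 + (c 3 *s f3 + c 4 *s f4) = 0"
        using that by (simp add: f_def)
      then have "(c 0 *s axis 0 1 + (c 3 *s f3 + c 4 *s f4)) $ 0 = 0"
        by simp
      then have "c 0 = 0"
        using f by (simp add: axis_def)
      with c f(1) show ?thesis
        by (simp add: indep2_def)
    qed
  qed (use that in auto)
  \<comment> \<open>The completing rows are basis vectors other than e_0, so they lie in the
    hyperplane z_0 = 0 too.\<close>
  have A0: "A $ i $ 0 = 0" if "i \<noteq> 0" for i
  proof (cases "i \<in> {3, 4}")
    case True
    then show ?thesis
      using f(2,3) by (auto simp: A(2) f_def)
  next
    case False
    with that obtain a where a: "A $ i = axis a 1" "axis a 1 \<notin> f ` {0, 3, 4}"
      using A(3) [of i] by auto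
    then have "a \<noteq> 0"
      by (auto simp: f_def)
    then show ?thesis
      by (simp add: a axis_def)
  qed
  have t0: "tri \<Phi> u w (axis k 1) = 0" if "u $ 0 = 0" "w $ 0 = 0" "k \<in> {0, 1}" for u w k
    using that by (simp add: tri_axis_right sum_5 z)
  have t1: "tri \<Phi> (axis 0 1) w (axis k 1) = app (\<chi> j. \<Phi> $ 0 $ j $ k) w" for w k
    by (simp add: tri_axis_right sum_axis app_def mult.commute)
  have "A $ 0 = axis 0 1" "A $ 3 = f3" "A $ 4 = f4"
    by (simp_all add: A(2) f_def)
  then have "line_model (act5 A (mat 1) \<Phi>)"
    unfolding line_model_def using A0
    by (intro conjI act5_X5 X) (auto simp: act5_id_right t0 t1 f)
  then have "flat (act5 A (mat 1) \<Phi>)"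
    by (rule flat_line)
  then show ?thesis
    using X A(1) invertible_one by (rule flat_act5)
qed

text \<open>In the plane x_3 = x_4 = 0 entry (1, 2) is the only one outside row and column 0 that
  may survive. Its zero locus contains a line, which a change of variables moves to the span of e_0
  and e_1.\<close>

lemma flat_line_in_plane:
  fixes \<Phi> :: "'k matrix_of_forms"
  assumes X: "\<Phi> \<in> X5 UNIV"
    and z: "\<And>k. k \<in> {0, 1, 2} \<Longrightarrow> \<Phi> $ 1 $ 3 $ k = 0 \<and> \<Phi> $ 1 $ 4 $ k = 0 \<and> \<Phi> $ 2 $ 3 $ k = 0 \<and>
      \<Phi> $ 2 $ 4 $ k = 0 \<and> \<Phi> $ 3 $ 4 $ k = 0"
  shows "flat \<Phi>"
proof -
  obtain p q where pq: "indep2 p q" "p $ 3 = 0" "p $ 4 = 0" "app (\<Phi> $ 1 $ 2) p = 0"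
    "q $ 3 = 0" "q $ 4 = 0" "app (\<Phi> $ 1 $ 2) q = 0"
    using common_zeros [of "axis 3 1" "axis 4 1" "\<Phi> $ 1 $ 2"] unfolding app_axis by blast
  define f where "f i = (if i = 0 then p else q)" for i :: 5
  obtain B :: "'k^5^5" where B: "invertible B" "\<And>i. i \<in> {0, 1} \<Longrightarrow> B $ i = f i"
  proof (rule extend_to_invertible [where I = "{0, 1}" and f = f])
    show "\<forall>i\<in>{0, 1}. c i = 0" if "(\<Sum>i\<in>{0, 1}. c i *s f i) = 0" for c
      using that pq(1) by (simp add: f_def indep2_def)
  qed (use that in auto)
  have t: "act5 (mat 1) B \<Phi> $ i $ j $ k = ev_form \<Phi> (B $ k) i j" for i j k
    by (simp add: act5_id_left tri_axis_left sum_axis ev_form_def)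
  have t': "ev_form \<Phi> x 1 2 = 0" "ev_form \<Phi> x 1 3 = 0" "ev_form \<Phi> x 1 4 = 0" "ev_form \<Phi> x 2 3 = 0"
    "ev_form \<Phi> x 2 4 = 0" "ev_form \<Phi> x 3 4 = 0" if "x = p \<or> x = q" for x
    using that pq z by (auto simp: ev_form_def app_def sum_5 mult.commute)
  note alt = ev_form_alt(1) [OF X]
  note alts = alt [of _ 2 1] alt [of _ 3 1] alt [of _ 3 2] alt [of _ 4 1] alt [of _ 4 2] alt [of _ 4 3]
    ev_form_alt(2) [OF X]
  have "\<forall>i j. i \<noteq> 0 \<longrightarrow> j \<noteq> 0 \<longrightarrow> ev_form \<Phi> x i j = 0" if "x = p \<or> x = q" for x
    unfolding all_5 using t' [OF that] by (simp add: alts)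
  then have "flat (act5 (mat 1) B \<Phi>)"
    using B(2) by (intro flat_line_first_row act5_X5 X) (auto simp: t f_def)
  then show ?thesis
    using X invertible_one B(1) by (rule flat_act5)
qed

end

section \<open>Valuations\<close>

lemma X5_entry: "\<Phi> \<in> X5 R \<Longrightarrow> \<Phi> $ i $ j $ k \<in> R"
  unfolding X5_def by blast

locale discretely_valued_field =
  fixes v :: "'k::field \<Rightarrow> ereal" and \<pi> :: 'k
  assumes valuation: "normalised_discrete_valuation v" and uniformiser: "uniformiser v \<pi>"
begin

lemma v_0 [simp]: "v 0 = \<infinity>"
  and v_mult: "v (x * y) = v x + v y"
  and v_add: "min (v x) (v y) \<le> v (x + y)"
  using valuation by (simp_all add: normalised_discrete_valuation_def)

lemma v_int:
  assumes "x \<noteq> 0"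
  obtains n :: int where "v x = ereal (real_of_int n)"
  using valuation assms unfolding normalised_discrete_valuation_def by blast

lemma v_pi [simp]: "v \<pi> = 1"
  using uniformiser by (simp add: uniformiser_def)

lemma pi_neq_0 [simp]: "\<pi> \<noteq> 0"
  using v_pi by (metis v_0 PInfty_neq_ereal(1) one_ereal_def)

lemma v_1 [simp]: "v 1 = 0"
proof -
  obtain n :: int where "v 1 = ereal (real_of_int n)"
    using v_int [of 1] by auto
  with v_mult [of 1 1] show ?thesis
    by simp
qed

lemma v_minus_1: "v (- 1) = 0"
proof -
  obtain n :: int where "v (- 1) = ereal (real_of_int n)"
    using v_int [of "- 1"] by auto
  with v_mult [of "- 1" "- 1"] show ?thesis
    by simp
qed

lemma v_minus [simp]: "v (- x) = v x"
  using v_mult [of "- 1" x] by (simp add: v_minus_1)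

lemma v_inverse: "x \<noteq> 0 \<Longrightarrow> v (inverse x) = - v x"
proof -
  assume "x \<noteq> 0"
  then obtain m n :: int where "v x = ereal (real_of_int m)" "v (inverse x) = ereal (real_of_int n)"
    using v_int [of x] v_int [of "inverse x"] by (metis inverse_nonzero_iff_nonzero)
  with v_mult [of x "inverse x"] \<open>x \<noteq> 0\<close> show ?thesis
    by simp
qed

lemma v_power_pi: "v (\<pi> ^ n) = ereal (real n)"
  by (induction n) (simp_all add: v_mult one_ereal_def)

lemma v_powi_pi: "v (\<pi> powi n) = ereal (real_of_int n)"
  by (cases "n \<ge> 0") (simp_all add: power_int_def power_inverse v_power_pi v_inverse)

lemma infinite_valued_field: "infinite (UNIV :: 'k set)"
proof
  assume "finite (UNIV :: 'k set)"
  then have "finite (range (\<lambda>n::nat. \<pi> ^ n))"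
    by (rule finite_subset [rotated]) simp
  moreover have "inj (\<lambda>n::nat. \<pi> ^ n)"
    by (rule injI) (metis v_power_pi ereal.inject of_nat_eq_iff)
  ultimately show False
    using finite_imageD by blast
qed

lemma v_add_ge: "c \<le> v x \<Longrightarrow> c \<le> v y \<Longrightarrow> c \<le> v (x + y)"
  using v_add [of x y] by (metis min.boundedI order_trans)

lemma v_mult_ge: "a \<le> v x \<Longrightarrow> b \<le> v y \<Longrightarrow> a + b \<le> v (x * y)"
  unfolding v_mult by (rule add_mono)

lemma ring_closed:
  "0 \<in> valuation_ring v" "1 \<in> valuation_ring v" "of_int n \<in> valuation_ring v"
  "x \<in> valuation_ring v \<Longrightarrow> y \<in> valuation_ring v \<Longrightarrow> x + y \<in> valuation_ring v"
  "x \<in> valuation_ring v \<Longrightarrow> y \<in> valuation_ring v \<Longrightarrow> x * y \<in> valuation_ring v"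
proof -
  show add: "x + y \<in> valuation_ring v" if "x \<in> valuation_ring v" "y \<in> valuation_ring v" for x y
    using that v_add_ge by (simp add: valuation_ring_def)
  show "x * y \<in> valuation_ring v" if "x \<in> valuation_ring v" "y \<in> valuation_ring v"
    using that v_mult_ge [of 0 x 0 y] by (simp add: valuation_ring_def)
  show "0 \<in> valuation_ring v" "1 \<in> valuation_ring v"
    by (simp_all add: valuation_ring_def)
  have "of_nat n \<in> valuation_ring v" for n
    by (induction n) (simp_all add: add valuation_ring_def v_add_ge)
  then show "of_int n \<in> valuation_ring v"
    by (cases n rule: int_cases2) (simp_all add: valuation_ring_def)
qed

lemma sum_ring_closed: "(\<And>i. i \<in> I \<Longrightarrow> f i \<in> valuation_ring v) \<Longrightarrow> (\<Sum>i\<in>I. f i) \<in> valuation_ring v"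
  by (induction I rule: infinite_finite_induct) (simp_all add: ring_closed)

lemma divide_pi:
  assumes "ereal (real_of_int (n + 1)) \<le> v x"
  shows "ereal (real_of_int n) \<le> v (x / \<pi>)"
proof (cases "x = 0")
  case False
  then obtain m :: int where m: "v x = ereal (real_of_int m)"
    using v_int by blast
  have "v (x / \<pi>) = v x + - 1"
    using v_mult [of x "inverse \<pi>"] by (simp add: divide_inverse v_inverse)
  then show ?thesis
    using assms by (simp add: m one_ereal_def)
qed simp

end

lemma eval5_closed:
  assumes "0 \<in> R" "1 \<in> R" "\<And>n. of_int n \<in> R" "\<And>x y. x \<in> R \<Longrightarrow> y \<in> R \<Longrightarrow> x + y \<in> R"
    "\<And>x y. x \<in> R \<Longrightarrow> y \<in> R \<Longrightarrow> x * y \<in> R" and F: "\<And>i j k. F $ i $ j $ k \<in> R"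
  shows "eval5 E F \<in> R"
proof -
  have sum: "(\<Sum>x\<in>A. f x) \<in> R" if "\<And>x. x \<in> A \<Longrightarrow> f x \<in> R" for A and f :: "(5 \<times> 5 \<times> 5 \<Rightarrow>\<^sub>0 nat) \<Rightarrow> 'a"
    using that by (induction A rule: infinite_finite_induct) (simp_all add: assms)
  have prod: "(\<Prod>x\<in>A. f x) \<in> R" if "\<And>x. x \<in> A \<Longrightarrow> f x \<in> R" for A and f :: "5 \<times> 5 \<times> 5 \<Rightarrow> 'a"
    using that by (induction A rule: infinite_finite_induct) (simp_all add: assms)
  have pow: "x ^ n \<in> R" if "x \<in> R" for x n
    using that by (induction n) (simp_all add: assms)
  show ?thesis
    unfolding eval5_def mpoly_eval_def
    by (intro sum assms(5) assms(3) prod pow) (auto simp: F)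
qed

section \<open>Second-order Taylor expansion over the valuation ring\<close>

locale valued_pfaffian_invariant = pfaffian_invariant D "TYPE('k)" + discretely_valued_field v \<pi>
  for D and v :: "'k::field \<Rightarrow> ereal" and \<pi>
begin

lemma eval5_ring: "(\<And>i j k. \<Phi> $ i $ j $ k \<in> valuation_ring v) \<Longrightarrow> eval5 E \<Phi> \<in> valuation_ring v"
  by (rule eval5_closed) (simp_all add: ring_closed)

lemma coeff_eval5_line5_ring:
  assumes "\<And>i j k. \<Phi> $ i $ j $ k \<in> valuation_ring v" "\<And>i j k. \<Psi> $ i $ j $ k \<in> valuation_ring v"
  shows "poly.coeff (eval5 E (line5 \<Phi> \<Psi>)) n \<in> valuation_ring v"
proof -
  define R where "R = {f :: 'k poly. \<forall>n. poly.coeff f n \<in> valuation_ring v}"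
  have "eval5 E (line5 \<Phi> \<Psi>) \<in> R"
  proof (rule eval5_closed)
    show "0 \<in> R" "1 \<in> R" "of_int n \<in> R" for n
      by (auto simp: R_def ring_closed of_int_poly coeff_pCons split: nat.split)
    show "x + y \<in> R" "x * y \<in> R" if "x \<in> R" "y \<in> R" for x y
      using that by (auto simp: R_def ring_closed coeff_mult intro!: sum_ring_closed)
    show "line5 \<Phi> \<Psi> $ i $ j $ k \<in> R" for i j k
      using assms by (auto simp: R_def line5_def ring_closed coeff_pCons split: nat.split)
  qed
  then show ?thesis
    by (simp add: R_def)
qed

text \<open>Stands in for reduction modulo \<pi>: if the coefficients marked by \<open>Z\<close> are
  divisible by \<pi>, the truncation is a model over K with the same reduction, and \<Phi> is the
  truncation plus \<pi> times \<open>quotient\<close>.\<close>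

definition truncate :: "(5 \<Rightarrow> 5 \<Rightarrow> 5 \<Rightarrow> bool) \<Rightarrow> 'k matrix_of_forms \<Rightarrow> 'k matrix_of_forms" where
  "truncate Z \<Phi> = (\<chi> i j k. if Z i j k then 0 else \<Phi> $ i $ j $ k)"

definition quotient :: "(5 \<Rightarrow> 5 \<Rightarrow> 5 \<Rightarrow> bool) \<Rightarrow> 'k matrix_of_forms \<Rightarrow> 'k matrix_of_forms" where
  "quotient Z \<Phi> = (\<chi> i j k. if Z i j k then \<Phi> $ i $ j $ k / \<pi> else 0)"

lemma truncate_X5:
  assumes "\<Phi> \<in> X5 UNIV" "\<And>i j k. Z i j k \<longleftrightarrow> Z j i k"
  shows "truncate Z \<Phi> \<in> X5 UNIV"
proof (rule X5_UNIV_I)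
  show "truncate Z \<Phi> $ j $ i $ k = - truncate Z \<Phi> $ i $ j $ k" for i j k
    using X5_alt [OF assms(1), of j i k] assms(2) [of i j k] by (simp add: truncate_def)
qed (simp add: truncate_def X5_diag [OF assms(1)])

lemma quotient_X5:
  assumes "\<Phi> \<in> X5 UNIV" "\<And>i j k. Z i j k \<longleftrightarrow> Z j i k"
  shows "quotient Z \<Phi> \<in> X5 UNIV"
proof (rule X5_UNIV_I)
  show "quotient Z \<Phi> $ j $ i $ k = - quotient Z \<Phi> $ i $ j $ k" for i j k
    using X5_alt [OF assms(1), of j i k] assms(2) [of i j k] by (simp add: quotient_def)
qed (simp add: quotient_def X5_diag [OF assms(1)])

lemma v_X5: "\<Phi> \<in> X5 R \<Longrightarrow> v (\<Phi> $ j $ i $ k) = v (\<Phi> $ i $ j $ k)"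
  using X5_alt [of \<Phi> R j i k] by simp

text \<open>The expansion is D(\<Phi>) = 0 + \<pi> b + \<pi>^2 G(\<pi>) with integral
  \<open>G\<close>, where \<open>b\<close> is the derivative at the truncation and is itself
  divisible by \<pi>.\<close>

lemma v_eval5_ge_2:
  assumes \<Phi>: "\<Phi> \<in> X5 (valuation_ring v)" and Z: "\<And>i j k. Z i j k \<Longrightarrow> 1 \<le> v (\<Phi> $ i $ j $ k)"
    and 0: "eval5 D (truncate Z \<Phi>) = 0" and 1: "1 \<le> v (dir5 D (truncate Z \<Phi>) (quotient Z \<Phi>))"
  shows "2 \<le> v (eval5 D \<Phi>)"
proof -
  have R: "\<Phi> $ i $ j $ k \<in> valuation_ring v" for i j k
    using \<Phi> by (rule X5_entry)
  have tR: "truncate Z \<Phi> $ i $ j $ k \<in> valuation_ring v" for i j k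
    using R by (simp add: truncate_def ring_closed)
  have qR: "quotient Z \<Phi> $ i $ j $ k \<in> valuation_ring v" for i j k
    using divide_pi [of 0] Z [of i j k]
    by (simp add: quotient_def valuation_ring_def one_ereal_def zero_ereal_def)
  define F where "F = eval5 D (line5 (truncate Z \<Phi>) (quotient Z \<Phi>))"
  obtain a b G where F: "F = pCons a (pCons b G)"
    by (metis pCons_cases)
  have "a = poly F 0"
    by (simp add: F)
  then have a: "a = 0"
    using 0 by (simp add: F_def eval5_line5)
  have b: "b = dir5 D (truncate Z \<Phi>) (quotient Z \<Phi>)"
    unfolding coeff_1_eval5_line5 [symmetric] F_def [symmetric] F by simp
  have "poly.coeff G n = poly.coeff F (Suc (Suc n))" for n
    by (simp add: F)
  then have G: "poly.coeff G n \<in> valuation_ring v" for n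
    unfolding F_def using coeff_eval5_line5_ring [OF tR qR] by simp
  have "poly G \<pi> \<in> valuation_ring v"
    using G
  proof (induction G)
    case (pCons c G)
    have "c \<in> valuation_ring v" "poly.coeff G n \<in> valuation_ring v" for n
      using pCons.prems [of 0] pCons.prems [of "Suc n"] by simp_all
    moreover have "\<pi> \<in> valuation_ring v"
      by (simp add: valuation_ring_def)
    ultimately show ?case
      using pCons.IH by (simp add: ring_closed)
  qed (simp add: ring_closed)
  then have "1 + 0 \<le> v (\<pi> * poly G \<pi>)"
    by (intro v_mult_ge) (simp_all add: valuation_ring_def)
  then have "1 \<le> v (b + \<pi> * poly G \<pi>)"
    using 1 by (intro v_add_ge) (simp_all add: b)
  then have "1 + 1 \<le> v (\<pi> * (b + \<pi> * poly G \<pi>))"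
    by (intro v_mult_ge) simp_all
  moreover have "\<Phi> = truncate Z \<Phi> + scale5 \<pi> (quotient Z \<Phi>)"
    by (simp add: vec_eq_iff truncate_def quotient_def)
  then have "eval5 D \<Phi> = poly F \<pi>"
    by (simp add: F_def eval5_line5)
  ultimately show ?thesis
    by (simp add: F a)
qed

lemma v_eval5_ge_2_if_flat:
  assumes \<Phi>: "\<Phi> \<in> X5 (valuation_ring v)" and Z: "\<And>i j k. Z i j k \<Longrightarrow> 1 \<le> v (\<Phi> $ i $ j $ k)"
    and sym: "\<And>i j k. Z i j k \<longleftrightarrow> Z j i k" and flat: "flat (truncate Z \<Phi>)"
  shows "2 \<le> v (eval5 D \<Phi>)"
proof (rule v_eval5_ge_2 [OF \<Phi> Z])
  have "quotient Z \<Phi> \<in> X5 UNIV"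
    using X5_subset_UNIV [OF \<Phi>] sym by (rule quotient_X5)
  then show "1 \<le> v (dir5 D (truncate Z \<Phi>) (quotient Z \<Phi>))"
    using flat by (simp add: flat_def)
  show "eval5 D (truncate Z \<Phi>) = 0"
    using flat by (simp add: flat_def)
qed

lemma truncate_ring:
  assumes "\<Phi> \<in> X5 (valuation_ring v)"
  shows "truncate Z \<Phi> $ i $ j $ k \<in> valuation_ring v"
  using X5_entry [OF assms] by (simp add: truncate_def ring_closed)

text \<open>One node is enough if \<Phi> vanishes to high order there: the derivative sees only the
  entry (3, 4, 0) of \<open>quotient\<close>, and this is still divisible by \<pi>.\<close>

lemma v_eval5_ge_2_node:
  assumes \<Phi>: "\<Phi> \<in> X5 (valuation_ring v)"
    and v1: "\<And>j. 1 \<le> v (\<Phi> $ 3 $ j $ 0)" "\<And>j. 1 \<le> v (\<Phi> $ 4 $ j $ 0)" "\<And>k. 1 \<le> v (\<Phi> $ 3 $ 4 $ k)"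
    and v2: "2 \<le> v (\<Phi> $ 3 $ 4 $ 0)"
  shows "2 \<le> v (eval5 D \<Phi>)"
proof -
  define Z where "Z i j k \<longleftrightarrow> k = 0 \<and> (i \<in> {3, 4} \<or> j \<in> {3, 4}) \<or> i = 3 \<and> j = 4 \<or> i = 4 \<and> j = 3" for i j k :: 5
  note X = X5_subset_UNIV [OF \<Phi>]
  have X': "truncate Z \<Phi> \<in> X5 UNIV"
    by (rule truncate_X5 [OF X]) (auto simp: Z_def)
  have N: "node0 (truncate Z \<Phi>)"
    using X' by (auto simp: node0_def truncate_def Z_def)
  show ?thesis
  proof (rule v_eval5_ge_2 [OF \<Phi>])
    show "eval5 D (truncate Z \<Phi>) = 0"
      by (rule vanish_node0 [OF N])
    show "1 \<le> v (\<Phi> $ i $ j $ k)" if "Z i j k" for i j k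
      using that v1 v_X5 [OF \<Phi>] unfolding Z_def by (metis insert_iff singletonD)
    have "dir5 D (truncate Z \<Phi>) (quotient Z \<Phi>) =
        eval5 (mpoly_partial (3, 4, 0) D) (truncate Z \<Phi>) * (\<Phi> $ 3 $ 4 $ 0 / \<pi>)"
      by (simp add: dir5_node0 [OF N] partial_node0 [OF N] quotient_def Z_def)
    also have "0 + 1 \<le> v \<dots>"
    proof (rule v_mult_ge)
      show "0 \<le> v (eval5 (mpoly_partial (3, 4, 0) D) (truncate Z \<Phi>))"
        using eval5_ring [OF truncate_ring [OF \<Phi>]] by (simp add: valuation_ring_def)
      show "1 \<le> v (\<Phi> $ 3 $ 4 $ 0 / \<pi>)"
        using divide_pi [of 1] v2 by (simp add: one_ereal_def)
    qed
    finally show "1 \<le> v (dir5 D (truncate Z \<Phi>) (quotient Z \<Phi>))"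
      by simp
  qed
qed

lemma v_eval5_ge_2_node':
  assumes \<Phi>: "\<Phi> \<in> X5 (valuation_ring v)"
    and v1: "\<And>i j. i \<in> {2, 3, 4} \<Longrightarrow> 1 \<le> v (\<Phi> $ i $ j $ 0)"
      "\<And>i k. i \<in> {2, 3} \<Longrightarrow> k \<in> {0, 1, 2, 3} \<Longrightarrow> 1 \<le> v (\<Phi> $ i $ 4 $ k)"
    and v2: "\<And>i. i \<in> {2, 3} \<Longrightarrow> 2 \<le> v (\<Phi> $ i $ 4 $ 0)"
  shows "2 \<le> v (eval5 D \<Phi>)"
proof -
  define Z where "Z i j k \<longleftrightarrow> k = 0 \<and> (i \<in> {2, 3, 4} \<or> j \<in> {2, 3, 4}) \<or>
    k \<noteq> 4 \<and> (i \<in> {2, 3} \<and> j = 4 \<or> i = 4 \<and> j \<in> {2, 3})" for i j k :: 5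
  note X = X5_subset_UNIV [OF \<Phi>]
  define \<Phi>' where "\<Phi>' = truncate Z \<Phi>"
  have X': "\<Phi>' \<in> X5 UNIV"
    unfolding \<Phi>'_def by (rule truncate_X5 [OF X]) (auto simp: Z_def)
  have z: "\<Phi>' $ i $ j $ 0 = 0" if "i \<in> {2, 3, 4} \<or> j \<in> {2, 3, 4}" for i j
    using that by (auto simp: \<Phi>'_def truncate_def Z_def)
  have z4: "\<Phi>' $ i $ 4 $ k = 0" if "i \<in> {2, 3}" "k \<noteq> 4" for i k
    using that by (auto simp: \<Phi>'_def truncate_def Z_def)
  \<comment> \<open>The entries (2, 4) and (3, 4) are truncated to multiples of x_4, so some
    combination of rows 2 and 3 pairs to zero with row 4 and yields the second kernel
    vector.\<close>
  have ex: "\<exists>a b. (a \<noteq> 0 \<or> b \<noteq> 0) \<and> a * \<Phi>' $ 2 $ 4 $ 4 + b * \<Phi>' $ 3 $ 4 $ 4 = 0"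
  proof (cases "\<Phi>' $ 2 $ 4 $ 4 = 0 \<and> \<Phi>' $ 3 $ 4 $ 4 = 0")
    case True
    then show ?thesis
      by (intro exI [of _ 1] exI [of _ 0]) simp
  next
    case False
    then show ?thesis
      by (intro exI [of _ "\<Phi>' $ 3 $ 4 $ 4"] exI [of _ "- \<Phi>' $ 2 $ 4 $ 4"]) auto
  qed
  then obtain a b where ab: "a \<noteq> 0 \<or> b \<noteq> 0" "a * \<Phi>' $ 2 $ 4 $ 4 + b * \<Phi>' $ 3 $ 4 $ 4 = 0"
    by blast
  have N: "node \<Phi>' (a *s axis 2 1 + b *s axis 3 1) (axis 4 1) (axis 0 1)"
    unfolding node_def
  proof (intro conjI allI X')
    show "indep2 (a *s axis 2 1 + b *s axis 3 1) (axis 4 1 :: 'k^5)"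
      using ab unfolding indep2_def by (auto simp: vec_eq_iff all_5 axis_def)
    show "(axis 0 1 :: 'k^5) \<noteq> 0"
      by (simp add: axis_eq_0_iff)
    show "tri \<Phi>' (a *s axis 2 1 + b *s axis 3 1) x (axis 0 1) = 0" for x
      by (simp add: tri_add_left tri_scale_left tri_axis_left sum_axis z)
    show "tri \<Phi>' (axis 4 1) x (axis 0 1) = 0" for x
      by (simp add: tri_axis_left sum_axis z)
    show "tri \<Phi>' (a *s axis 2 1 + b *s axis 3 1) (axis 4 1) x = 0" for x
    proof -
      have "tri \<Phi>' (axis i 1) (axis 4 1) x = ev_form \<Phi>' x i 4" for i
        by (simp add: tri_axis_left sum_axis ev_form_def)
      then have "tri \<Phi>' (a *s axis 2 1 + b *s axis 3 1) (axis 4 1) x =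
          x $ 4 * (a * \<Phi>' $ 2 $ 4 $ 4 + b * \<Phi>' $ 3 $ 4 $ 4)"
        by (simp add: tri_add_left tri_scale_left ev_form_def sum_5 z4 algebra_simps)
      then show ?thesis
        by (simp add: ab)
    qed
  qed
  show ?thesis
  proof (rule v_eval5_ge_2 [OF \<Phi>, of Z, folded \<Phi>'_def])
    show "eval5 D \<Phi>' = 0"
      by (rule node_vanishing(1) [OF N])
    show "1 \<le> v (\<Phi> $ i $ j $ k)" if "Z i j k" for i j k
    proof -
      have "\<forall>k. k \<noteq> 4 \<longrightarrow> k \<in> {0, 1, 2, 3 :: 5}"
        unfolding all_5 by simp
      then show ?thesis
        using that v1(1) [of i j] v1(1) [of j i] v1(2) [of i k] v1(2) [of j k]
          v_X5 [OF \<Phi>, of j i k] unfolding Z_def by metis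
    qed
    \<comment> \<open>The pair (a, b) need not be integral, so the derivative is not expressed
      through it. Subtracting the two entries of \<open>quotient\<close> that the node sees leaves a
      direction of derivative zero; the subtracted part is integral derivatives times
      \<open>q2\<close> and \<open>q3\<close>, both divisible by \<pi>.\<close>
    define q2 where "q2 = quotient Z \<Phi> $ 2 $ 4 $ 0"
    define q3 where "q3 = quotient Z \<Phi> $ 3 $ 4 $ 0"
    define \<Psi> where "\<Psi> = quotient Z \<Phi> + scale5 (- q2) (elem5 2 4 0) + scale5 (- q3) (elem5 3 4 0)"
    have qX: "quotient Z \<Phi> \<in> X5 UNIV"
      by (rule quotient_X5 [OF X]) (auto simp: Z_def)
    have "dir5 D \<Phi>' \<Psi> = 0"
    proof (rule node_vanishing(2) [OF N])
      show "\<Psi> \<in> X5 UNIV"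
        unfolding \<Psi>_def by (intro add_X5 scale5_X5 elem5_X5 qX) simp_all
      have "tri \<Psi> (a *s axis 2 1 + b *s axis 3 1) (axis 4 1) (axis 0 1) = a * \<Psi> $ 2 $ 4 $ 0 + b * \<Psi> $ 3 $ 4 $ 0"
        by (simp add: tri_add_left tri_scale_left tri_axis)
      then show "tri \<Psi> (a *s axis 2 1 + b *s axis 3 1) (axis 4 1) (axis 0 1) = 0"
        by (simp add: \<Psi>_def elem5_def q2_def q3_def)
    qed
    then have "dir5 D \<Phi>' (quotient Z \<Phi>) =
        q2 * eval5 (mpoly_partial (2, 4, 0) D) \<Phi>' + q3 * eval5 (mpoly_partial (3, 4, 0) D) \<Phi>'"
      by (simp add: \<Psi>_def dir5_add dir5_scale dir5_elem5 order_5 algebra_simps)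
    moreover have "1 \<le> v q2" "1 \<le> v q3"
      using divide_pi [of 1] v2 [of 2] v2 [of 3] by (simp_all add: q2_def q3_def quotient_def Z_def one_ereal_def)
    moreover have "0 \<le> v (eval5 (mpoly_partial x D) \<Phi>')" for x
      using eval5_ring [OF truncate_ring [OF \<Phi>]] by (simp add: valuation_ring_def \<Phi>'_def)
    ultimately show "1 \<le> v (dir5 D \<Phi>' (quotient Z \<Phi>))"
      using v_mult_ge [of 1 q2 0] v_mult_ge [of 1 q3 0] by (simp add: v_add_ge)
  qed
qed

end

section \<open>Inequalities between the weights\<close>

context valued_pfaffian_invariant
begin

text \<open>With sorted weights, the failure of an inequality makes a whole block of coefficients
  divisible by \<pi>. For the second to the eighth, the block is the zero pattern of a flatness
  lemma; the first is a rescaling of x_0, and the two conditional ones come from a node of high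
  order.\<close>

lemma weight_inequalities:
  fixes r s :: "5 \<Rightarrow> int"
  assumes \<Phi>: "\<Phi> \<in> X5 (valuation_ring v)" and D: "v (eval5 D \<Phi>) \<le> 1"
    and w: "\<And>i j k. ereal (real_of_int (r i + r j - s k)) \<le> v (\<Phi> $ i $ j $ k)"
    and r: "r 0 \<le> r 1" "r 1 \<le> r 2" "r 2 \<le> r 3" "r 3 \<le> r 4"
    and s: "s 0 \<le> s 1" "s 1 \<le> s 2" "s 2 \<le> s 3" "s 3 \<le> s 4"
  shows "r 0 + r 1 \<le> s 0" "r 0 + r 3 \<le> s 1" "r 1 + r 2 \<le> s 1" "r 0 + r 4 \<le> s 2" "r 1 + r 3 \<le> s 2"
    "r 1 + r 4 \<le> s 3" "r 2 + r 3 \<le> s 3" "r 2 + r 4 \<le> s 4"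
    "s 0 < s 4 \<Longrightarrow> s 0 < r 0 + r 3 \<Longrightarrow> r 3 + r 4 \<le> s 4"
    "s 0 < s 3 \<Longrightarrow> s 0 < r 0 + r 2 \<Longrightarrow> r 2 + r 4 \<le> s 3"
proof -
  note X = X5_subset_UNIV [OF \<Phi>]
  have not2: "\<not> 2 \<le> v (eval5 D \<Phi>)"
  proof
    assume "2 \<le> v (eval5 D \<Phi>)"
    with D have "(2 :: ereal) \<le> 1"
      by (rule order_trans [rotated])
    then show False
      by simp
  qed
  have v1: "1 \<le> v (\<Phi> $ i $ j $ k)" if "s k < r i + r j \<or> i = j" for i j k
  proof (cases "i = j")
    case False
    with that have "(1 :: real) \<le> real_of_int (r i + r j - s k)"
      by linarith
    then have "1 \<le> ereal (real_of_int (r i + r j - s k))"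
      by (simp add: one_ereal_def)
    then show ?thesis
      using w order_trans by blast
  qed (simp add: X5_diag [OF \<Phi>])
  have v2: "2 \<le> v (\<Phi> $ i $ j $ k)" if "s k + 2 \<le> r i + r j" for i j k
  proof -
    from that have "(2 :: real) \<le> real_of_int (r i + r j - s k)"
      by linarith
    then have "2 \<le> ereal (real_of_int (r i + r j - s k))"
      by simp
    then show ?thesis
      using w order_trans by blast
  qed
  have flat_pattern: False if Z: "\<forall>i j k. Z i j k \<longrightarrow> s k < r i + r j \<or> i = j" and sym: "\<And>i j k. Z i j k \<longleftrightarrow> Z j i k"
    and flat: "truncate Z \<Phi> \<in> X5 UNIV \<Longrightarrow> flat (truncate Z \<Phi>)" for Z
  proof -
    have flat: "flat (truncate Z \<Phi>)"
      by (rule flat, rule truncate_X5 [OF X sym])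
    have "2 \<le> v (eval5 D \<Phi>)"
    proof (rule v_eval5_ge_2_if_flat [OF \<Phi> _ sym flat])
      fix i j k
      assume "Z i j k"
      with Z have "s k < r i + r j \<or> i = j"
        by simp
      then show "1 \<le> v (\<Phi> $ i $ j $ k)"
        by (rule v1)
    qed
    then show False
      using not2 by blast
  qed
  show "r 0 + r 1 \<le> s 0"
  proof (rule ccontr)
    assume "\<not> ?thesis"
    then have "\<forall>i j. s 0 < r i + r j \<or> i = j"
      using r unfolding all_5 by auto
    then have 1: "1 \<le> v (\<Phi> $ i $ j $ 0)" for i j
      using v1 by blast
    \<comment> \<open>All coefficients of x_0 are divisible by \<pi>, so \<Phi> arises from an
      integral model by substituting \<pi> x_0 for x_0, which multiplies the invariant by
      \<pi>^12.\<close>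
    define \<Psi> where "\<Psi> = (\<chi> i j k. if k = 0 then \<Phi> $ i $ j $ k / \<pi> else \<Phi> $ i $ j $ k)"
    define B :: "'k^5^5" where "B = (\<chi> i. (if i = 0 then \<pi> else 1) *s axis i 1)"
    have \<Psi>_X: "\<Psi> \<in> X5 UNIV"
    proof (rule X5_UNIV_I)
      show "\<Psi> $ j $ i $ k = - \<Psi> $ i $ j $ k" for i j k
        using X5_alt [OF X, of j i k] by (cases "k = 0") (simp_all add: \<Psi>_def)
    qed (simp add: \<Psi>_def X5_diag [OF X])
    have \<Psi>_R: "\<Psi> $ i $ j $ k \<in> valuation_ring v" for i j k
      using divide_pi [of 0] 1 [of i j] X5_entry [OF \<Phi>, of i j k]
      by (auto simp: \<Psi>_def valuation_ring_def one_ereal_def zero_ereal_def)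
    have "det B = (\<Prod>i\<in>UNIV. B $ i $ i)"
      by (rule det_diagonal) (auto simp: B_def axis_def)
    also have "\<dots> = \<pi>"
      unfolding UNIV_5 by (simp add: B_def axis_def)
    finally have det: "det B = \<pi>" .
    have "\<Phi> = act5 (mat 1) B \<Psi>"
      by (simp add: vec_eq_iff act5_id_left B_def tri_scale_right tri_axis) (simp add: \<Psi>_def)
    moreover have "eval5 D (act5 (mat 1) B \<Psi>) = \<pi> ^ 12 * eval5 D \<Psi>"
      using invariance [OF invertible_one _ \<Psi>_X, of B] det by (simp add: invertible_det_nz)
    ultimately have "v (eval5 D \<Phi>) = v (\<pi> ^ 12 * eval5 D \<Psi>)"
      by simp
    also have "2 + 0 \<le> \<dots>"
      using eval5_ring [OF \<Psi>_R] by (intro v_mult_ge) (simp_all only: v_power_pi, simp_all add: valuation_ring_def)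
    finally show False
      using not2 by simp
  qed
  show "r 0 + r 3 \<le> s 1"
  proof (rule ccontr)
    assume a: "\<not> ?thesis"
    show False
    proof (rule flat_pattern [of "\<lambda>i j k. k \<in> {0, 1} \<and> (i \<in> {3, 4} \<or> j \<in> {3, 4})"])
      show "\<forall>i j k. k \<in> {0, 1} \<and> (i \<in> {3, 4} \<or> j \<in> {3, 4}) \<longrightarrow> s k < r i + r j \<or> i = j"
        using a r s unfolding all_5 by auto
    qed (auto intro!: flat_line_last_rows simp: truncate_def)
  qed
  show "r 1 + r 2 \<le> s 1"
  proof (rule ccontr)
    assume a: "\<not> ?thesis"
    show False
    proof (rule flat_pattern [of "\<lambda>i j k. k \<in> {0, 1} \<and> i \<noteq> 0 \<and> j \<noteq> 0"])
      show "\<forall>i j k. k \<in> {0, 1} \<and> i \<noteq> 0 \<and> j \<noteq> 0 \<longrightarrow> s k < r i + r j \<or> i = j"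
        using a r s unfolding all_5 by auto
    qed (auto intro!: flat_line_first_row simp: truncate_def)
  qed
  show "r 0 + r 4 \<le> s 2"
  proof (rule ccontr)
    assume a: "\<not> ?thesis"
    show False
    proof (rule flat_pattern [of "\<lambda>i j k. k \<in> {0, 1, 2} \<and> (i = 4 \<or> j = 4)"])
      show "\<forall>i j k. k \<in> {0, 1, 2} \<and> (i = 4 \<or> j = 4) \<longrightarrow> s k < r i + r j \<or> i = j"
        using a r s unfolding all_5 by auto
    qed (auto intro!: flat_column_two_variables simp: truncate_def)
  qed
  show "r 1 + r 3 \<le> s 2"
  proof (rule ccontr)
    assume a: "\<not> ?thesis"
    show False
    proof (rule flat_pattern [of "\<lambda>i j k. k \<in> {0, 1, 2} \<and> i \<noteq> 0 \<and> j \<noteq> 0 \<and> (i \<in> {3, 4} \<or> j \<in> {3, 4})"])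
      show "\<forall>i j k. k \<in> {0, 1, 2} \<and> i \<noteq> 0 \<and> j \<noteq> 0 \<and> (i \<in> {3, 4} \<or> j \<in> {3, 4}) \<longrightarrow> s k < r i + r j \<or> i = j"
        using a r s unfolding all_5 by auto
    qed (auto intro!: flat_line_in_plane simp: truncate_def)
  qed
  show "r 1 + r 4 \<le> s 3"
  proof (rule ccontr)
    assume a: "\<not> ?thesis"
    show False
    proof (rule flat_pattern [of "\<lambda>i j k. k \<in> {0, 1, 2, 3} \<and> (i = 4 \<and> j \<noteq> 0 \<or> j = 4 \<and> i \<noteq> 0)"])
      show "\<forall>i j k. k \<in> {0, 1, 2, 3} \<and> (i = 4 \<and> j \<noteq> 0 \<or> j = 4 \<and> i \<noteq> 0) \<longrightarrow> s k < r i + r j \<or> i = j"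
        using a r s unfolding all_5 by auto
    qed (auto intro!: flat_column_one_variable simp: truncate_def)
  qed
  show "r 2 + r 3 \<le> s 3"
  proof (rule ccontr)
    assume a: "\<not> ?thesis"
    show False
    proof (rule flat_pattern [of "\<lambda>i j k. k \<in> {0, 1, 2, 3} \<and> i \<in> {2, 3, 4} \<and> j \<in> {2, 3, 4}"])
      show "\<forall>i j k. k \<in> {0, 1, 2, 3} \<and> i \<in> {2, 3, 4} \<and> j \<in> {2, 3, 4} \<longrightarrow> s k < r i + r j \<or> i = j"
        using a r s unfolding all_5 by auto
    qed (auto intro!: flat_block_one_variable simp: truncate_def)
  qed
  show "r 2 + r 4 \<le> s 4"
  proof (rule ccontr)
    assume a: "\<not> ?thesis"
    show False
    proof (rule flat_pattern [of "\<lambda>i j k. i \<in> {2, 3} \<and> j = 4 \<or> i = 4 \<and> j \<in> {2, 3}"])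
      show "\<forall>i j k. i \<in> {2, 3} \<and> j = 4 \<or> i = 4 \<and> j \<in> {2, 3} \<longrightarrow> s k < r i + r j \<or> i = j"
        using a r s unfolding all_5 by auto
    qed (auto intro!: flat_conic simp: truncate_def vec_eq_iff)
  qed
  show "r 3 + r 4 \<le> s 4" if "s 0 < s 4" "s 0 < r 0 + r 3"
  proof (rule ccontr)
    assume a: "\<not> ?thesis"
    have "\<forall>j. s 0 < r 3 + r j \<and> s 0 < r 4 + r j \<and> s j < r 3 + r 4"
      using that a r s unfolding all_5 by auto
    \<comment> \<open>Each of the strict inequalities s_0 < s_4 < r_3 + r_4 contributes one; this is
      the extra power of \<pi> needed at (3, 4, 0).\<close>
    moreover have "s 0 + 2 \<le> r 3 + r 4"
      using that a by linarith
    ultimately have "2 \<le> v (eval5 D \<Phi>)"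
      by (intro v_eval5_ge_2_node [OF \<Phi>] v1 v2) auto
    then show False
      using not2 by blast
  qed
  show "r 2 + r 4 \<le> s 3" if "s 0 < s 3" "s 0 < r 0 + r 2"
  proof (rule ccontr)
    assume a: "\<not> ?thesis"
    have "\<forall>i j. i \<in> {2, 3, 4} \<longrightarrow> s 0 < r i + r j" "\<forall>i k. i \<in> {2, 3} \<longrightarrow> k \<in> {0, 1, 2, 3} \<longrightarrow> s k < r i + r 4"
      "\<forall>i. i \<in> {2, 3} \<longrightarrow> s 0 + 2 \<le> r i + r 4"
      using that a r s unfolding all_5 by auto
    then have "2 \<le> v (eval5 D \<Phi>)"
      by (intro v_eval5_ge_2_node' [OF \<Phi>] v1 v2) auto
    then show False
      using not2 by blast
  qed
qed

end

section \<open>Sorting the weights and comparing both models\<close>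

lemma sorting_permutation:
  fixes f :: "5 \<Rightarrow> int"
  obtains \<sigma> :: "5 \<Rightarrow> 5" where "bij \<sigma>" "f (\<sigma> 0) \<le> f (\<sigma> 1)" "f (\<sigma> 1) \<le> f (\<sigma> 2)" "f (\<sigma> 2) \<le> f (\<sigma> 3)" "f (\<sigma> 3) \<le> f (\<sigma> 4)"
proof -
  define xs where "xs = sort_key f [0, 1, 2, 3, 4]"
  have len: "length xs = 5" and dist: "distinct xs" and sorted: "sorted (map f xs)"
    by (simp_all add: xs_def)
  define \<sigma> where "\<sigma> i = (if i = 0 then xs ! 0 else if i = 1 then xs ! 1 else if i = 2 then xs ! 2
    else if i = 3 then xs ! 3 else xs ! 4)" for i :: 5
  have "\<forall>i j. \<sigma> i = \<sigma> j \<longrightarrow> i = j"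
    unfolding all_5 using dist len by (simp add: \<sigma>_def nth_eq_iff_index_eq)
  then have "inj \<sigma>"
    by (simp add: inj_def)
  then have "bij \<sigma>"
    by (simp add: bij_def finite_UNIV_inj_surj)
  moreover have "f (xs ! i) \<le> f (xs ! j)" if "i \<le> j" "j < 5" for i j
    using sorted_nth_mono [OF sorted that(1)] that len by simp
  ultimately show ?thesis
    by (intro that [of \<sigma>]) (simp_all add: \<sigma>_def)
qed

context valued_pfaffian_invariant
begin

definition permute :: "(5 \<Rightarrow> 5) \<Rightarrow> (5 \<Rightarrow> 5) \<Rightarrow> 'k matrix_of_forms \<Rightarrow> 'k matrix_of_forms" where
  "permute \<sigma> \<tau> \<Phi> = (\<chi> i j k. \<Phi> $ \<sigma> i $ \<sigma> j $ \<tau> k)"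

lemma permute_X5:
  assumes "\<Phi> \<in> X5 R"
  shows "permute \<sigma> \<tau> \<Phi> \<in> X5 R"
  unfolding X5_def mem_Collect_eq
proof (intro conjI allI)
  show "permute \<sigma> \<tau> \<Phi> $ i $ i = 0" for i
    by (simp add: permute_def vec_eq_iff X5_diag [OF assms])
  show "permute \<sigma> \<tau> \<Phi> $ j $ i = - permute \<sigma> \<tau> \<Phi> $ i $ j" for i j
    using X5_alt [OF assms, of "\<sigma> j" "\<sigma> i"] by (simp add: permute_def vec_eq_iff)
  show "permute \<sigma> \<tau> \<Phi> $ i $ j $ k \<in> R" for i j k
    by (simp add: permute_def X5_entry [OF assms])
qed

text \<open>Permutation matrices have determinant of square 1, and both determinants enter the
  character with even exponent.\<close>

lemma eval5_permute:
  assumes "\<Phi> \<in> X5 UNIV" "bij \<sigma>" "bij \<tau>"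
  shows "eval5 D (permute \<sigma> \<tau> \<Phi>) = eval5 D \<Phi>"
proof -
  define A :: "'k^5^5" where "A = (\<chi> i. axis (\<sigma> i) 1)"
  define B :: "'k^5^5" where "B = (\<chi> i. axis (\<tau> i) 1)"
  have A: "(det A)\<^sup>2 = 1" and B: "(det B)\<^sup>2 = 1"
    unfolding A_def B_def using assms by (simp_all add: det_axis_square bij_is_inj)
  have "permute \<sigma> \<tau> \<Phi> = act5 A B \<Phi>"
    by (simp add: vec_eq_iff permute_def act5_nth A_def B_def tri_axis)
  moreover have "invertible A" "invertible B"
    using A B by (auto simp: invertible_det_nz)
  moreover have "det B ^ 12 = 1"
    using power_mult [of "det B" 2 6] B by simp
  ultimately show ?thesis
    using invariance [of A B \<Phi>] assms(1) A by simp
qed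

lemma v_power: "v x = ereal c \<Longrightarrow> v (x ^ n) = ereal (real n * c)"
  by (induction n) (simp_all add: v_mult algebra_simps)

lemma prod_powi: "(\<Prod>i\<in>(UNIV :: 5 set). \<pi> powi f i) = \<pi> powi (\<Sum>i\<in>UNIV. f i)"
  unfolding UNIV_5 by (simp add: power_int_add)

lemma act5_Diag: "act5 (Diag a) (Diag b) \<Phi> $ i $ j $ k = a i * a j * b k * \<Phi> $ i $ j $ k"
  for \<Phi> :: "'k matrix_of_forms"
proof -
  have "Diag d $ i = d i *s axis i 1" for d :: "5 \<Rightarrow> 'k" and i :: 5
    by (simp add: Diag_def axis_def vec_eq_iff)
  then show ?thesis
    by (simp add: act5_nth tri_scale_left tri_scale_mid tri_scale_right tri_axis)
qed

lemma det_Diag: "det (Diag d) = (\<Prod>i\<in>UNIV. d i)" for d :: "5 \<Rightarrow> 'k"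
proof -
  have "det (Diag d) = (\<Prod>i\<in>UNIV. Diag d $ i $ i)"
    by (rule det_diagonal) (simp add: Diag_def)
  then show ?thesis
    by (simp add: Diag_def)
qed

lemma weights_constant:
  fixes r s :: "5 \<Rightarrow> int"
  assumes \<Phi>: "\<Phi> \<in> X5 (valuation_ring v)" and \<Phi>': "\<Phi>' \<in> X5 (valuation_ring v)"
    and D: "v (eval5 D \<Phi>) \<le> 1" and D': "v (eval5 D \<Phi>') \<le> 1"
    and act: "\<Phi>' = act5 (Diag (\<lambda>i. \<pi> powi (- r i))) (Diag (\<lambda>i. \<pi> powi s i)) \<Phi>"
  shows "\<forall>i j. s i = s j"
proof -
  note X = X5_subset_UNIV [OF \<Phi>]
  define A where "A = Diag (\<lambda>i. \<pi> powi (- r i))"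
  define B where "B = Diag (\<lambda>i. \<pi> powi s i)"
  have detA: "det A = \<pi> powi (- (\<Sum>i\<in>UNIV. r i))"
    unfolding A_def det_Diag prod_powi by (simp add: sum_negf)
  have detB: "det B = \<pi> powi (\<Sum>i\<in>UNIV. s i)"
    unfolding B_def det_Diag prod_powi ..
  have inv: "invertible A" "invertible B"
    by (simp_all add: invertible_det_nz detA detB)
  \<comment> \<open>The two valuations lie between 0 and 1 and differ by a multiple of 12, hence are
    equal.\<close>
  have total: "(\<Sum>i\<in>UNIV. s i) = 2 * (\<Sum>i\<in>UNIV. r i)"
  proof -
    define m where "m = (\<Sum>i\<in>UNIV. s i) - 2 * (\<Sum>i\<in>UNIV. r i)"
    have "v ((det A)\<^sup>2) = ereal (real 2 * real_of_int (- (\<Sum>i\<in>UNIV. r i)))"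
      unfolding detA by (rule v_power) (rule v_powi_pi)
    then have "v ((det A)\<^sup>2 * det B) = ereal (real_of_int m)"
      by (simp add: v_mult detB v_powi_pi m_def)
    then have chi: "v (((det A)\<^sup>2 * det B) ^ 12) = ereal (real 12 * real_of_int m)"
      by (rule v_power)
    have "eval5 D \<Phi> \<noteq> 0"
      using D by auto
    then obtain n :: int where n: "v (eval5 D \<Phi>) = ereal (real_of_int n)"
      by (rule v_int)
    have n': "v (eval5 D \<Phi>') = ereal (real 12 * real_of_int m) + ereal (real_of_int n)"
      unfolding act A_def [symmetric] B_def [symmetric] invariance [OF inv X] v_mult chi n ..
    have "0 \<le> v (eval5 D \<Phi>)" "0 \<le> v (eval5 D \<Phi>')"
      using eval5_ring [OF X5_entry [OF \<Phi>]] eval5_ring [OF X5_entry [OF \<Phi>']]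
      by (simp_all add: valuation_ring_def)
    then have "0 \<le> real_of_int n" "real_of_int n \<le> 1" "0 \<le> 12 * real_of_int m + real_of_int n"
      "12 * real_of_int m + real_of_int n \<le> 1"
      using D D' unfolding n n' by (simp_all add: one_ereal_def)
    then have "0 \<le> n" "n \<le> 1" "0 \<le> 12 * m + n" "12 * m + n \<le> 1"
      by linarith+
    then show ?thesis
      by (simp add: m_def)
  qed
  have entry: "v (\<Phi>' $ i $ j $ k) = ereal (real_of_int (s k - r i - r j)) + v (\<Phi> $ i $ j $ k)" for i j k
    unfolding act act5_Diag v_mult v_powi_pi by (simp add: algebra_simps)
  have w: "ereal (real_of_int (r i + r j - s k)) \<le> v (\<Phi> $ i $ j $ k)" for i j k
  proof -
    have "0 \<le> ereal (real_of_int (s k - r i - r j)) + v (\<Phi> $ i $ j $ k)"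
      using X5_entry [OF \<Phi>', of i j k] unfolding entry [symmetric] by (simp add: valuation_ring_def)
    then show ?thesis
      by (cases "v (\<Phi> $ i $ j $ k)") simp_all
  qed
  \<comment> \<open>Passing from \<Phi>' back to \<Phi> negates all weights, so integrality of
    \<Phi> bounds \<Phi>' in the same form.\<close>
  have w': "ereal (real_of_int (- r i + - r j - - s k)) \<le> v (\<Phi>' $ i $ j $ k)" for i j k
  proof -
    have "0 \<le> v (\<Phi> $ i $ j $ k)"
      using X5_entry [OF \<Phi>, of i j k] by (simp add: valuation_ring_def)
    then show ?thesis
      unfolding entry by (cases "v (\<Phi> $ i $ j $ k)") simp_all
  qed
  obtain \<sigma> :: "5 \<Rightarrow> 5" where \<sigma>: "bij \<sigma>" "r (\<sigma> 0) \<le> r (\<sigma> 1)" "r (\<sigma> 1) \<le> r (\<sigma> 2)" "r (\<sigma> 2) \<le> r (\<sigma> 3)" "r (\<sigma> 3) \<le> r (\<sigma> 4)"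
    using sorting_permutation by blast
  obtain \<tau> :: "5 \<Rightarrow> 5" where \<tau>: "bij \<tau>" "s (\<tau> 0) \<le> s (\<tau> 1)" "s (\<tau> 1) \<le> s (\<tau> 2)" "s (\<tau> 2) \<le> s (\<tau> 3)" "s (\<tau> 3) \<le> s (\<tau> 4)"
    using sorting_permutation by blast
  \<comment> \<open>Negated weights are sorted by reversing the order of the indices.\<close>
  have "bij (\<lambda>i :: 5. 4 - i)"
    by (rule involuntory_imp_bij) simp
  then have rev: "bij (\<lambda>i. \<sigma> (4 - i))" "bij (\<lambda>i. \<tau> (4 - i))"
    using bij_comp [of "\<lambda>i :: 5. 4 - i" \<sigma>] bij_comp [of "\<lambda>i :: 5. 4 - i" \<tau>] \<sigma>(1) \<tau>(1) by (simp_all add: comp_def)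
  have E: "v (eval5 D (permute \<sigma> \<tau> \<Phi>)) \<le> 1"
    using D by (simp add: eval5_permute X \<sigma>(1) \<tau>(1))
  have E': "v (eval5 D (permute (\<lambda>i. \<sigma> (4 - i)) (\<lambda>i. \<tau> (4 - i)) \<Phi>')) \<le> 1"
    using D' by (simp add: eval5_permute X5_subset_UNIV [OF \<Phi>'] rev)
  have W: "ereal (real_of_int (r (\<sigma> i) + r (\<sigma> j) - s (\<tau> k))) \<le> v (permute \<sigma> \<tau> \<Phi> $ i $ j $ k)" for i j k
    using w by (simp add: permute_def)
  have W': "ereal (real_of_int (- r (\<sigma> (4 - i)) + - r (\<sigma> (4 - j)) - - s (\<tau> (4 - k)))) \<le>
      v (permute (\<lambda>i. \<sigma> (4 - i)) (\<lambda>i. \<tau> (4 - i)) \<Phi>' $ i $ j $ k)" for i j k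
    using w' by (simp add: permute_def)
  note I = weight_inequalities [where r = "\<lambda>i. r (\<sigma> i)" and s = "\<lambda>i. s (\<tau> i)",
      OF permute_X5 [OF \<Phi>] E W \<sigma>(2-5) \<tau>(2-5)]
  have sub: "(4::5) - 0 = 4" "(4::5) - 1 = 3" "(4::5) - 2 = 2" "(4::5) - 3 = 1" "(4::5) - 4 = 0"
    by simp_all
  have mono': "- r (\<sigma> (4 - 0)) \<le> - r (\<sigma> (4 - 1))" "- r (\<sigma> (4 - 1)) \<le> - r (\<sigma> (4 - 2))"
    "- r (\<sigma> (4 - 2)) \<le> - r (\<sigma> (4 - 3))" "- r (\<sigma> (4 - 3)) \<le> - r (\<sigma> (4 - 4))"
    "- s (\<tau> (4 - 0)) \<le> - s (\<tau> (4 - 1))" "- s (\<tau> (4 - 1)) \<le> - s (\<tau> (4 - 2))"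
    "- s (\<tau> (4 - 2)) \<le> - s (\<tau> (4 - 3))" "- s (\<tau> (4 - 3)) \<le> - s (\<tau> (4 - 4))"
    unfolding sub using \<sigma> \<tau> by simp_all
  note I' = weight_inequalities(1-8) [where r = "\<lambda>i. - r (\<sigma> (4 - i))" and s = "\<lambda>i. - s (\<tau> (4 - i))",
      OF permute_X5 [OF \<Phi>'] E' W' mono', unfolded sub]
  have "(\<Sum>i\<in>UNIV. r (\<sigma> i)) = (\<Sum>i\<in>UNIV. r i)" "(\<Sum>i\<in>UNIV. s (\<tau> i)) = (\<Sum>i\<in>UNIV. s i)"
    using sum.reindex_bij_betw [OF \<sigma>(1), of r] sum.reindex_bij_betw [OF \<tau>(1), of s] by simp_all
  then have total': "s (\<tau> 0) + s (\<tau> 1) + s (\<tau> 2) + s (\<tau> 3) + s (\<tau> 4) =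
      2 * (r (\<sigma> 0) + r (\<sigma> 1) + r (\<sigma> 2) + r (\<sigma> 3) + r (\<sigma> 4))"
    using total by (simp add: sum_5)
  have "s (\<tau> 0) = s (\<tau> 4)"
  proof (rule ccontr)
    assume "s (\<tau> 0) \<noteq> s (\<tau> 4)"
    then have lt: "s (\<tau> 0) < s (\<tau> 4)"
      using \<tau> by linarith
    \<comment> \<open>Negation and reversal permute the second to seventh inequalities and turn
      their sense around, so all six are equalities.\<close>
    have eq: "s (\<tau> 1) = r (\<sigma> 0) + r (\<sigma> 3)" "s (\<tau> 1) = r (\<sigma> 1) + r (\<sigma> 2)" "s (\<tau> 2) = r (\<sigma> 0) + r (\<sigma> 4)"
      "s (\<tau> 2) = r (\<sigma> 1) + r (\<sigma> 3)" "s (\<tau> 3) = r (\<sigma> 1) + r (\<sigma> 4)" "s (\<tau> 3) = r (\<sigma> 2) + r (\<sigma> 3)"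
      using I(2-7) I'(2-7) by linarith+
    define d where "d = r (\<sigma> 1) - r (\<sigma> 0)"
    have ap: "r (\<sigma> 1) = r (\<sigma> 0) + d" "r (\<sigma> 2) = r (\<sigma> 0) + 2 * d" "r (\<sigma> 3) = r (\<sigma> 0) + 3 * d"
      "r (\<sigma> 4) = r (\<sigma> 0) + 4 * d"
      using eq by (simp_all add: d_def)
    \<comment> \<open>If d were zero, all r would agree, and the first inequality with its reversal
      would confine every s to the single value 2 r_0.\<close>
    have "d > 0"
      using lt I(1) I(8) I'(1) I'(8) \<sigma>(2) unfolding ap by linarith
    \<comment> \<open>The reversed eighth inequality bounds s_0 by r_0 + r_2, which is below r_0 +
      r_3 since d is positive.\<close>
    then have "r (\<sigma> 3) + r (\<sigma> 4) \<le> s (\<tau> 4)"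
      using I'(8) lt by (intro I(9)) (simp_all add: ap)
    \<comment> \<open>The reversed first inequality now determines s_4, and the relation between the
      sums leaves one value for s_0.\<close>
    then have s0: "s (\<tau> 0) = 2 * r (\<sigma> 0) + d"
      using I'(1) total' eq unfolding ap by simp
    \<comment> \<open>With s_3 = 2 r_0 + 5 d this reads 6 d \<le> 5 d.\<close>
    have "r (\<sigma> 2) + r (\<sigma> 4) \<le> s (\<tau> 3)"
      using \<open>d > 0\<close> by (intro I(10)) (simp_all add: s0 eq(5) ap)
    then show False
      using \<open>d > 0\<close> by (simp add: eq(5) ap)
  qed
  then have "\<forall>i. s (\<tau> i) = s (\<tau> 0)"
    unfolding all_5 using \<tau> by linarith
  then show ?thesis
    using bij_is_surj [OF \<tau>(1)] by (metis surj_def)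
qed

end

theorem theorem8p1:
  fixes v :: "'k::field \<Rightarrow> ereal" and \<pi> :: 'k
    and \<Delta> :: invariant5
    and \<Phi> \<Phi>' :: "'k matrix_of_forms"
    and r s :: "5 \<Rightarrow> int"
  assumes "normalised_discrete_valuation v"
    and "uniformiser v \<pi>"
    and "pfaffian_discriminant TYPE('k) \<Delta>"
    and "\<Phi> \<in> X5 (valuation_ring v)"
    and "\<Phi>' \<in> X5 (valuation_ring v)"
    and "v (eval5 \<Delta> \<Phi>) \<le> 1"
    and "v (eval5 \<Delta> \<Phi>') \<le> 1"
    and "\<Phi>' = act5 (Diag (\<lambda>i. \<pi> powi (- r i))) (Diag (\<lambda>i. \<pi> powi s i)) \<Phi>"
  shows "\<forall>i j. s i = s j"
proof -
  interpret discretely_valued_field v \<pi>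
    using assms(1,2) by unfold_locales
  interpret valued_pfaffian_invariant \<Delta> v \<pi>
  proof unfold_locales
    show "infinite (UNIV :: 'k set)"
      by (rule infinite_valued_field)
    show "in_coordinate_ring_X5 \<Delta>"
      using assms(3) by (simp add: pfaffian_discriminant_def)
    show "eval5 \<Delta> (act5 A B \<Phi>) = ((det A)\<^sup>2 * det B) ^ 12 * eval5 \<Delta> \<Phi>"
      if "invertible A" "invertible B" "\<Phi> \<in> X5 UNIV" for A B :: "'k^5^5" and \<Phi>
      using assms(3) that by (simp add: pfaffian_discriminant_def)
    show "eval5 \<Delta> \<Phi> = 0" if "node0 \<Phi>" for \<Phi> :: "'k matrix_of_forms"
    proof -
      have "\<not> smooth_curve_of_genus 1 (pfaffian \<Phi>)"
        using that by (intro not_smooth_if_node) (simp_all add: node0_def)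
      then show ?thesis
        using assms(3) that by (auto simp: pfaffian_discriminant_def node0_def)
    qed
  qed
  show ?thesis
    using assms(4-8) by (rule weights_constant)
qed

end
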